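(* Let $\mathbb{F}=\mathbb{R}$ or $\mathbb{C}$, let $n \geq 1$, let $\mathcal{V}$ be a linear subspace of $M_n(\mathbb{F})$, and let $E$ and $F$ be linear subspaces of $\mathbb{F}^n$. Then the matricial path capacity $MPC_{\mathcal{V}}(E,F)$ between $E$ and $F$ relative to $\mathcal{V}$ equals the minimum size of an $(E,F)$-separator relative to $\mathcal{V}$.
   Context: For a linear space $\mathcal{X}$ of matrices, $\mathrm{rank}(\mathcal{X}) = \max\{\mathrm{rank}(A) : A \in \mathcal{X}\}$. For a linear subspace $\mathcal{X}\subseteq M_{p,q}(\mathbb{F})$ (or of linear maps between finite-dimensional spaces), the noncommutative rank is $$\operatorname{nc-rank}(\mathcal{X}) = \sup_{r \geq 1} \frac1r\cdot \mathrm{rank}(\mathcal{X}\otimes M_r(\mathbb{F})),$$ where $\mathcal{X}\otimes M_r(\mathbb{F}) \subseteq M_{p,q}(\mathbb{F})\otimes M_r(\mathbb{F}) \cong M_{pr,qr}(\mathbb{F})$. Matricial path capacity: let $\iota: E \to \mathbb{F}^n$ be the natural inclusion and $\pi:\mathbb{F}^n \to F$ the orthogonal projection (standard inner product). Let $\mathcal{W}$ be the space of linear maps from $\mathbb{F}^n\oplus E$ to $\mathbb{F}^n \oplus F$ spanned by the single matrix $\begin{bmatrix} I&\iota\\ \pi&0\end{bmatrix}$ and the matrices $\begin{bmatrix}A&0\\0&0\end{bmatrix}$ for $A \in \mathcal{V}$. Then $MPC_{\mathcal{V}}(E,F) = \operatorname{nc-rank}(\mathcal{W}) - n$. An $(E,F)$-separator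 relative to $\mathcal{V}$ is a pair $(\tilde E,\tilde F)$ of linear subspaces of $\mathbb{F}^n$ such that (1) $E \subseteq \tilde E$ and $F \subseteq \tilde F$; (2) $\tilde F^\perp \subseteq \tilde E$; (3) $\mathcal{V}[\tilde F^\perp] \subseteq \tilde E$, where $\mathcal{V}[G] = \mathrm{span}\{Av: A \in \mathcal{V},\ v \in G\}$. Its size is $\dim(\tilde E\cap\tilde F)$. *)

theory Defs
  imports
    "HOL-Analysis.Analysis"
    "HOL-Library.Function_Algebras"
    "Jordan_Normal_Form.Conjugate"
begin

section \<open>Rank and noncommutative rank of spaces of linear maps\<close>

text \<open>
  Vector spaces are given by a carrier set inside a type together with a scalar multiplication
  \<open>s\<close>, as in \<^locale>\<open>vector_space\<close>. A linear map with domain \<open>D\<close> is represented by any function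
  agreeing with it on \<open>D\<close>. Codomains are left implicit, since the rank (the dimension of the image)
  does not depend on them.
\<close>

definition fun_scale :: "('a \<Rightarrow> 'b \<Rightarrow> 'b) \<Rightarrow> 'a \<Rightarrow> ('i \<Rightarrow> 'b) \<Rightarrow> 'i \<Rightarrow> 'b" where
  "fun_scale s c f = (\<lambda>i. s c (f i))"

definition max_rank ::
  "('a::field \<Rightarrow> 'w \<Rightarrow> 'w::ab_group_add) \<Rightarrow> 'v set \<Rightarrow> ('v \<Rightarrow> 'w) set \<Rightarrow> nat" where
  "max_rank s D X = Max {vector_space.dim s (T ` D) | T. T \<in> X}"

text \<open>
  The space \<open>D \<otimes> F\<^sup>r\<close> is realised as \<open>D\<^sup>r\<close>: the tuple \<open>x\<close> stands for the sum of \<open>x j \<otimes> e\<^sub>j\<close> over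
  \<open>j < r\<close>. Entries with index at least \<open>r\<close> are set to \<open>0\<close>.
\<close>

definition tuple_space :: "nat \<Rightarrow> 'v::zero set \<Rightarrow> (nat \<Rightarrow> 'v) set" where
  "tuple_space r D = {x. (\<forall>i<r. x i \<in> D) \<and> (\<forall>i\<ge>r. x i = 0)}"

text \<open>
  For a linear map \<open>T\<close> and an \<open>r \<times> r\<close> matrix \<open>B\<close> (of which only the entries \<open>B i j\<close> with \<open>i, j < r\<close>
  are used), the map \<open>T \<otimes> B\<close> sends \<open>v \<otimes> e\<^sub>j\<close> to \<open>T v \<otimes> B e\<^sub>j\<close>; in coordinates it is the
  Kronecker product.
\<close>

definition tensor_map ::
  "('a \<Rightarrow> 'w \<Rightarrow> 'w::ab_group_add) \<Rightarrow> nat \<Rightarrow> ('v \<Rightarrow> 'w) \<Rightarrow> (nat \<Rightarrow> nat \<Rightarrow> 'a)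
     \<Rightarrow> (nat \<Rightarrow> 'v) \<Rightarrow> nat \<Rightarrow> 'w" where
  "tensor_map s r T B x = (\<lambda>i. if i < r then \<Sum>j<r. s (B i j) (T (x j)) else 0)"

definition tensor_matrices ::
  "('a::field \<Rightarrow> 'w \<Rightarrow> 'w::ab_group_add) \<Rightarrow> nat \<Rightarrow> ('v \<Rightarrow> 'w) set
     \<Rightarrow> ((nat \<Rightarrow> 'v) \<Rightarrow> nat \<Rightarrow> 'w) set" where
  "tensor_matrices s r X =
     module.span (fun_scale (fun_scale s)) {tensor_map s r T B | T B. T \<in> X}"

definition nc_rank ::
  "('a::field \<Rightarrow> 'w \<Rightarrow> 'w::ab_group_add) \<Rightarrow> 'v::zero set \<Rightarrow> ('v \<Rightarrow> 'w) set \<Rightarrow> real" where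
  "nc_rank s D X =
     (SUP r\<in>{1..}. 1 / real r *
        real (max_rank (fun_scale s) (tuple_space r D) (tensor_matrices s r X)))"


section \<open>Orthogonality in \<open>F\<^sup>n\<close>\<close>

text \<open>
  On \<^typ>\<open>complex\<close>, \<^const>\<open>conjugate\<close> is complex conjugation; on \<^typ>\<open>real\<close> it is the identity. The
  library's inner product on \<^typ>\<open>complex ^ 'n\<close> is only the real part of \<open>std_inner\<close>.
\<close>

definition std_inner :: "'a::conjugatable_field ^ 'n \<Rightarrow> 'a ^ 'n \<Rightarrow> 'a" where
  "std_inner v w = (\<Sum>i\<in>UNIV. v $ i * conjugate (w $ i))"

definition orth_compl :: "('a::conjugatable_field ^ 'n) set \<Rightarrow> ('a ^ 'n) set" where
  "orth_compl G = {v. \<forall>w\<in>G. std_inner v w = 0}"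

definition orth_proj ::
  "('a::conjugatable_field ^ 'n) set \<Rightarrow> 'a ^ 'n \<Rightarrow> 'a ^ 'n" where
  "orth_proj G v = (THE w. w \<in> G \<and> v - w \<in> orth_compl G)"


section \<open>Matricial path capacity and separators\<close>

definition matrix_subspace :: "('a::field ^ 'n ^ 'n) set \<Rightarrow> bool" where
  "matrix_subspace V \<longleftrightarrow> module.subspace (\<lambda>c A. \<chi> i j. c * A $ i $ j) V"

abbreviation pair_scale ::
  "'a::field \<Rightarrow> ('a ^ 'n) \<times> ('a ^ 'n) \<Rightarrow> ('a ^ 'n) \<times> ('a ^ 'n)" where
  "pair_scale \<equiv> module_prod.scale (*s) (*s)"

text \<open>
  The block maps from \<open>F\<^sup>n \<oplus> E\<close> to \<open>F\<^sup>n \<oplus> F\<close> act on pairs \<open>(v, e)\<close> with \<open>e \<in> E\<close>, and the second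
  component of their values lies in \<open>F\<close>. The inclusion of \<open>E\<close> is invisible in this representation;
  \<open>E\<close> enters through the domain \<open>UNIV \<times> E\<close> in the definition of \<open>MPC\<close>.
\<close>

definition MPC_space ::
  "('a::conjugatable_field ^ 'n ^ 'n) set \<Rightarrow> ('a ^ 'n) set
     \<Rightarrow> (('a ^ 'n) \<times> ('a ^ 'n) \<Rightarrow> ('a ^ 'n) \<times> ('a ^ 'n)) set" where
  "MPC_space V F =
     module.span (fun_scale pair_scale)
       (insert (\<lambda>(v, e). (v + e, orth_proj F v)) {\<lambda>(v, e). (A *v v, 0) | A. A \<in> V})"

definition MPC ::
  "('a::conjugatable_field ^ 'n ^ 'n) set \<Rightarrow> ('a ^ 'n) set \<Rightarrow> ('a ^ 'n) set \<Rightarrow> real" where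
  "MPC V E F = nc_rank pair_scale (UNIV \<times> E) (MPC_space V F) - real CARD('n)"

definition action_span ::
  "('a::field ^ 'n ^ 'n) set \<Rightarrow> ('a ^ 'n) set \<Rightarrow> ('a ^ 'n) set" where
  "action_span V G = vec.span {A *v v | A v. A \<in> V \<and> v \<in> G}"

definition separator ::
  "('a::conjugatable_field ^ 'n ^ 'n) set \<Rightarrow> ('a ^ 'n) set \<Rightarrow> ('a ^ 'n) set
     \<Rightarrow> ('a ^ 'n) set \<Rightarrow> ('a ^ 'n) set \<Rightarrow> bool" where
  "separator V E F E' F' \<longleftrightarrow>
     vec.subspace E' \<and> vec.subspace F' \<and>
     E \<subseteq> E' \<and> F \<subseteq> F' \<and>
     orth_compl F' \<subseteq> E' \<and>
     action_span V (orth_compl F') \<subseteq> E'"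

definition min_separator_size ::
  "('a::conjugatable_field ^ 'n ^ 'n) set \<Rightarrow> ('a ^ 'n) set \<Rightarrow> ('a ^ 'n) set \<Rightarrow> nat" where
  "min_separator_size V E F = Min {vec.dim (E' \<inter> F') | E' F'. separator V E F E' F'}"

end

theory Submission
  imports
    Defs
    "Jordan_Normal_Form.Determinant"
    "HOL-Computational_Algebra.Formal_Laurent_Series"
begin

text \<open>
  For a space \<open>X\<close> of linear maps on \<open>D\<close>, every subspace \<open>U\<close> of \<open>D\<close> bounds the noncommutative rank by
  \<open>dim D - dim U + dim X[U]\<close>, and some \<open>U\<close> attains the bound (Fortin and Reutenauer). To see the latter,
  let \<open>L = \<complex>((u))((w))\<close> and consider the elements of \<open>X \<otimes> M\<^sub>d(L)\<close> whose second factors lie in a cyclic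
  division algebra of degree \<open>d\<close>. Their rank over \<open>L\<close> is a multiple of \<open>d\<close>, and the algebra spans
  \<open>M\<^sub>d(L)\<close>, so by specialisation the maximal rank of \<open>X \<otimes> M\<^sub>d\<close> is a multiple of \<open>d\<close>. Hence the supremum
  of the normalised ranks is attained, say at \<open>A \<in> X \<otimes> M\<^sub>d\<close>. The Wong sequence starts with \<open>ker A\<close> and
  continues by taking preimages under \<open>A\<close> of images under \<open>X \<otimes> M\<^sub>d\<close>. These images never leave the image
  of \<open>A\<close>, since otherwise a perturbation of \<open>A \<otimes> I\<^sub>s\<close> would have larger normalised rank; the union of
  the sequence yields \<open>U\<close>. For the space defining the path capacity, a separator \<open>(E', F')\<close> gives
  \<open>U = F'\<^sup>\<bottom> \<oplus> E\<close>, and conversely every \<open>U\<close> can be replaced by one of this form without increasing the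
  bound.
\<close>

section \<open>Dimension and rank in arbitrary vector spaces\<close>

text \<open>Rounding is what makes maximality usable: perturbing \<open>A \<otimes> I_s\<close>
  changes the blow-up degree, so \<open>A\<close> has to be optimal among all degrees
  \<open>d * s\<close>, and a supremum of fractions need not be attained. Over \<complex> there is
  no finite-dimensional division algebra of degree d > 1, hence the two Laurent variables: \<sigma>
  multiplies u by a primitive d-th root of unity and fixes w, and w twists the cyclic shift.
  Divisibility by d is read off the commutant: the semilinear shift \<tau> commutes with every
  element of the algebra, so kernels are \<tau>-invariant, and a nonzero \<tau>-invariant subspace
  of L^d is all of L^d. Commutation holds only for coefficients fixed by \<sigma>, so these are
  specialised to constants before rounding, and everything else is specialised afterwards. Both
  specialisations work because a rank bound is the nonvanishing of a determinant, polynomial in each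
  variable, and the ground field is infinite. Real scalars enter L through \<complex>, where the
  roots of unity live.\<close>

definition fin_dim :: "('a::field \<Rightarrow> 'b \<Rightarrow> 'b::ab_group_add) \<Rightarrow> 'b set \<Rightarrow> bool" where
  "fin_dim s S \<longleftrightarrow> (\<exists>B. finite B \<and> S \<subseteq> module.span s B)"

text \<open>A sequence instead of a set: a repeated vector counts as dependent, and the vectors can
  index the columns of a k by k determinant.\<close>

definition indep_family :: "('a::field \<Rightarrow> 'b \<Rightarrow> 'b::ab_group_add) \<Rightarrow> nat \<Rightarrow> (nat \<Rightarrow> 'b) \<Rightarrow> bool" where
  "indep_family s k x \<longleftrightarrow> (\<forall>c. (\<Sum>j<k. s (c j) (x j)) = 0 \<longrightarrow> (\<forall>j<k. c j = 0))"

abbreviation functional :: "('a::field \<Rightarrow> 'b \<Rightarrow> 'b::ab_group_add) \<Rightarrow> ('b \<Rightarrow> 'a) \<Rightarrow> bool" where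
  "functional s \<equiv> Vector_Spaces.linear s (*)"

context vector_space begin

lemma fin_dim_subset: "fin_dim scale T \<Longrightarrow> S \<subseteq> T \<Longrightarrow> fin_dim scale S"
  unfolding fin_dim_def by blast

lemma fin_dim_basis:
  assumes "fin_dim scale S"
  obtains B where "B \<subseteq> S" "independent B" "S \<subseteq> span B" "finite B" "card B = dim S"
proof -
  obtain B where B: "B \<subseteq> S" "independent B" "S \<subseteq> span B" "card B = dim S"
    by (rule basis_exists)
  obtain C where C: "finite C" "S \<subseteq> span C" using assms unfolding fin_dim_def by blast
  have "finite B" using independent_span_bound[OF C(1) B(2)] B(1) C(2) by blast
  with B that show ?thesis by blast
qed

lemma dim_le_of_subset_span:
  assumes "S \<subseteq> span T" "fin_dim scale T"
  shows "dim S \<le> dim T"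
proof -
  obtain B where B: "B \<subseteq> T" "independent B" "T \<subseteq> span B" "finite B" "card B = dim T"
    using fin_dim_basis[OF assms(2)] .
  have "S \<subseteq> span B" using assms(1) span_minimal[OF B(3)] by auto
  then show ?thesis using dim_le_card[of S B] B by simp
qed

lemma dim_le_of_subset: "S \<subseteq> T \<Longrightarrow> fin_dim scale T \<Longrightarrow> dim S \<le> dim T"
  by (rule dim_le_of_subset_span) (auto intro: span_base)

lemma card_le_dim_of_independent:
  assumes "independent B" "B \<subseteq> T" "fin_dim scale T"
  shows "finite B" "card B \<le> dim T"
proof -
  obtain C where C: "C \<subseteq> T" "independent C" "T \<subseteq> span C" "finite C" "card C = dim T"
    using fin_dim_basis[OF assms(3)] .
  have "B \<subseteq> span C" using assms(2) C(3) by blast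
  then show "finite B" "card B \<le> dim T"
    using independent_span_bound[OF C(4) assms(1)] C(5) by auto
qed

lemma indep_family_inj_on:
  assumes "indep_family scale k x"
  shows "inj_on x {..<k}"
proof (rule inj_onI, rule ccontr)
  fix i j assume ij: "i \<in> {..<k}" "j \<in> {..<k}" "x i = x j" "i \<noteq> j"
  define c where "c = (\<lambda>m. if m = i then 1 else if m = j then - 1 else (0::'a))"
  have "(\<Sum>m<k. scale (c m) (x m)) = (\<Sum>m\<in>{i,j}. scale (c m) (x m))"
    by (rule sum.mono_neutral_right) (use ij in \<open>auto simp: c_def\<close>)
  also have "\<dots> = 0" using ij by (simp add: c_def)
  finally have "c i = 0" using assms ij unfolding indep_family_def by blast
  then show False by (simp add: c_def)
qed

lemma indep_family_independent:
  assumes "indep_family scale k x"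
  shows "independent (x ` {..<k})"
proof (rule independent_if_scalars_zero)
  fix f v assume s: "(\<Sum>x\<in>x ` {..<k}. scale (f x) x) = 0" and v: "v \<in> x ` {..<k}"
  have "(\<Sum>j<k. scale (f (x j)) (x j)) = 0"
    using s by (simp add: sum.reindex[OF indep_family_inj_on[OF assms]])
  then have "\<forall>j<k. f (x j) = 0"
    using assms[unfolded indep_family_def, rule_format, of "\<lambda>j. f (x j)"] by simp
  then show "f v = 0" using v by auto
qed simp

lemma indep_family_le_dim:
  assumes "indep_family scale k x" "\<And>j. j < k \<Longrightarrow> x j \<in> T" "fin_dim scale T"
  shows "k \<le> dim T"
proof -
  have "card (x ` {..<k}) \<le> dim T"
    using card_le_dim_of_independent[OF indep_family_independent[OF assms(1)] _ assms(3)] assms(2) by blast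
  then show ?thesis using card_image[OF indep_family_inj_on[OF assms(1)]] by simp
qed

lemma indep_family_of_independent:
  assumes "inj_on x {..<k}" "independent (x ` {..<k})"
  shows "indep_family scale k x"
  unfolding indep_family_def
proof (intro allI impI)
  fix c j assume c: "(\<Sum>j<k. scale (c j) (x j)) = 0" and j: "j < k"
  have "(\<Sum>v\<in>x ` {..<k}. scale (c (inv_into {..<k} x v)) v) = 0"
    using c assms(1) by (simp add: sum.reindex)
  then have "c (inv_into {..<k} x (x j)) = 0"
    using independentD[OF assms(2), of "x ` {..<k}" "\<lambda>v. c (inv_into {..<k} x v)" "x j"] j by simp
  then show "c j = 0" using assms(1) j by simp
qed

lemma indep_family_basis:
  assumes "fin_dim scale S"
  obtains x where "indep_family scale (dim S) x" "\<forall>j<dim S. x j \<in> S" "S \<subseteq> span (x ` {..<dim S})"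
proof -
  obtain B where B: "B \<subseteq> S" "independent B" "S \<subseteq> span B" "finite B" "card B = dim S"
    using fin_dim_basis[OF assms] .
  obtain x where "bij_betw x {..<dim S} B"
    using B(4,5) by (metis ex_bij_betw_nat_finite atLeast0LessThan)
  then have x: "inj_on x {..<dim S}" "x ` {..<dim S} = B" by (auto simp: bij_betw_def)
  show ?thesis
    by (rule that[of x])
      (use x B in \<open>auto intro!: indep_family_of_independent\<close>)
qed

lemma indep_family_mono: "indep_family scale k x \<Longrightarrow> m \<le> k \<Longrightarrow> indep_family scale m x"
  unfolding indep_family_def
proof (intro allI impI)
  fix c j assume *: "\<forall>c. (\<Sum>j<k. scale (c j) (x j)) = 0 \<longrightarrow> (\<forall>j<k. c j = 0)" "m \<le> k"
    "(\<Sum>j<m. scale (c j) (x j)) = 0" "j < m"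
  have "(\<Sum>j<k. scale (if j < m then c j else 0) (x j)) = (\<Sum>j<m. scale (c j) (x j))"
    by (rule sum.mono_neutral_cong_right) (use *(2) in auto)
  then have "(\<Sum>j<k. scale (if j < m then c j else 0) (x j)) = 0" using *(3) by simp
  then have "(if j < m then c j else 0) = 0"
    using *(1)[rule_format, of "\<lambda>j. if j < m then c j else 0" j] *(2,4) by simp
  then show "c j = 0" using *(4) by simp
qed

lemma span_image_lessThanE:
  assumes "v \<in> span (x ` {..<k::nat})"
  obtains c where "v = (\<Sum>j<k. scale (c j) (x j))"
proof -
  have "span (x ` {..<k}) \<subseteq> {\<Sum>j<k. scale (c j) (x j) |c. True}" (is "_ \<subseteq> ?R")
  proof (rule span_minimal)
    show "subspace ?R"
    proof (rule subspaceI)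
      show "0 \<in> ?R" by (auto intro!: exI[of _ "\<lambda>_. 0"])
      show "a + b \<in> ?R" if "a \<in> ?R" "b \<in> ?R" for a b
        using that by (auto simp: sum.distrib[symmetric] scale_left_distrib[symmetric])
      show "scale r a \<in> ?R" if "a \<in> ?R" for r a
        using that by (auto simp: scale_sum_right)
    qed
    show "x ` {..<k} \<subseteq> ?R"
    proof clarify
      fix j assume "j < k"
      have "x j = (\<Sum>i<k. scale (if i = j then 1 else 0) (x i))"
      proof -
        have "(\<Sum>i<k. scale (if i = j then 1 else 0) (x i)) = (\<Sum>i\<in>{j}. scale (if i = j then 1 else 0) (x i))"
          by (rule sum.mono_neutral_right) (use \<open>j < k\<close> in auto)
        then show ?thesis by simp
      qed
      then show "\<exists>c. x j = (\<Sum>j<k. scale (c j) (x j)) \<and> True"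
        by (intro exI[of _ "\<lambda>i. if i = j then 1 else 0"]) simp
    qed
  qed
  then show ?thesis using assms that by blast
qed

end

context vector_space_pair begin

lemma fin_dim_image:
  assumes "Vector_Spaces.linear s1 s2 f" "fin_dim s1 S"
  shows "fin_dim s2 (f ` S)"
  using assms unfolding fin_dim_def fin_dim_def
  by (metis finite_imageI image_mono linear_span_image)

text \<open>Stated for the restriction to \<open>S\<close>, because the ambient spaces of tuples are
  infinite-dimensional. A basis of the kernel is extended to one of \<open>S\<close>, and the added
  vectors map to a basis of the image.\<close>

lemma rank_nullity:
  assumes f: "Vector_Spaces.linear s1 s2 f" and S: "vs1.subspace S" "fin_dim s1 S"
  shows "vs1.dim S = vs2.dim (f ` S) + vs1.dim {x\<in>S. f x = 0}"
proof -
  interpret p: vector_space_pair s1 s1 by unfold_locales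
  let ?K = "{x\<in>S. f x = 0}"
  have K: "vs1.subspace ?K"
    using vs1.subspace_inter[OF S(1) linear_subspace_kernel[OF f]] by (simp add: Int_def)
  obtain B0 where B0: "B0 \<subseteq> ?K" "vs1.independent B0" "?K \<subseteq> vs1.span B0" "finite B0" "card B0 = vs1.dim ?K"
    using vs1.fin_dim_basis[OF vs1.fin_dim_subset[OF S(2)], of ?K] by blast
  obtain B where B: "B0 \<subseteq> B" "B \<subseteq> S" "vs1.independent B" "S \<subseteq> vs1.span B"
    using vs1.maximal_independent_subset_extend[OF _ B0(2), of S] B0(1) by blast
  have fB: "finite B" using vs1.card_le_dim_of_independent(1)[OF B(3,2) S(2)] .
  have dS: "vs1.dim S = card B" using vs1.basis_card_eq_dim[OF B(2,4,3)] by simp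
  let ?C = "B - B0"
  have spanB: "vs1.span B = S" using B(2,4) vs1.span_minimal[OF B(2) S(1)] by blast
  \<comment> \<open>\<open>p\<close> projects onto the span of \<open>B0\<close> along the span of
    \<open>?C\<close>; a vector in both spans is fixed and killed by \<open>p\<close>, hence zero.
    This makes \<open>f\<close> injective on the span of \<open>?C\<close>.\<close>
  obtain p where p: "Vector_Spaces.linear s1 s1 p" "\<And>b. b \<in> B \<Longrightarrow> p b = (if b \<in> B0 then b else 0)"
    using p.linear_independent_extend[OF B(3), of "\<lambda>b. if b \<in> B0 then b else 0"] by blast
  have inj: "inj_on f (vs1.span ?C)"
    unfolding linear_inj_on_iff_eq_0[OF f vs1.subspace_span]
  proof (intro ballI impI)
    fix y assume y: "y \<in> vs1.span ?C" "f y = 0"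
    have "y \<in> S" using y(1) vs1.span_mono[of ?C B] spanB by auto
    then have y0: "y \<in> vs1.span B0" using y(2) B0(3) by auto
    have "p y = id y"
      by (rule p.linear_eq_on[OF p(1) vs1.linear_id y0]) (use p(2) B(1) in auto)
    moreover have "p y = 0"
      using p.linear_eq_on[OF p(1) p.linear_zero y(1)] p(2) by auto
    ultimately show "y = 0" by simp
  qed
  have ind: "vs2.independent (f ` ?C)"
    by (rule linear_independent_injective_image[OF f _ inj])
      (use vs1.independent_mono[OF B(3)] in auto)
  have "f ` S \<subseteq> vs2.span (f ` ?C)"
  proof -
    have "f ` S = vs2.span (f ` B)" using linear_span_image[OF f, of B] spanB by simp
    also have "\<dots> \<subseteq> vs2.span (f ` ?C)"
    proof (rule vs2.span_minimal)
      show "f ` B \<subseteq> vs2.span (f ` ?C)"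
      proof clarify
        fix b assume "b \<in> B"
        then show "f b \<in> vs2.span (f ` ?C)"
          using B0(1) vs2.span_zero by (cases "b \<in> B0") (auto intro: vs2.span_base)
      qed
    qed (rule vs2.subspace_span)
    finally show ?thesis .
  qed
  moreover have "f ` ?C \<subseteq> f ` S" using B(2) by auto
  ultimately have "vs2.dim (f ` S) = card (f ` ?C)"
    using vs2.basis_card_eq_dim[OF _ _ ind] by simp
  also have "\<dots> = card ?C"
    by (rule card_image) (rule inj_on_subset[OF inj], auto intro: vs1.span_base)
  also have "\<dots> = card B - card B0" using B(1) B0(4) by (simp add: card_Diff_subset)
  finally show ?thesis using dS B0(5) card_mono[OF fB B(1)] by simp
qed

lemma dim_image_le:
  assumes "Vector_Spaces.linear s1 s2 f" "vs1.subspace S" "fin_dim s1 S"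
  shows "vs2.dim (f ` S) \<le> vs1.dim S"
  using rank_nullity[OF assms] by simp

text \<open>The kernel on \<open>S'\<close> sits inside the kernel on \<open>S\<close>, so
  \<open>f\<close> loses at least as many dimensions on \<open>S\<close> as on \<open>S'\<close>.
  This is the source of the bound that a subspace puts on the rank.\<close>

lemma dim_image_le_of_subspace:
  assumes f: "Vector_Spaces.linear s1 s2 f" and S: "vs1.subspace S" "fin_dim s1 S"
    and S': "vs1.subspace S'" "S' \<subseteq> S"
  shows "vs2.dim (f ` S) + vs1.dim S' \<le> vs1.dim S + vs2.dim (f ` S')"
proof -
  have "vs1.dim {x\<in>S'. f x = 0} \<le> vs1.dim {x\<in>S. f x = 0}"
    by (rule vs1.dim_le_of_subset) (use S' vs1.fin_dim_subset[OF S(2)] in auto)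
  then show ?thesis
    using rank_nullity[OF f S] rank_nullity[OF f S'(1) vs1.fin_dim_subset[OF S(2) S'(2)]] by simp
qed

lemma dim_image_eq_of_inj_on:
  assumes f: "Vector_Spaces.linear s1 s2 f" and S: "vs1.subspace S" "fin_dim s1 S" and inj: "inj_on f S"
  shows "vs2.dim (f ` S) = vs1.dim S"
proof -
  have "{x\<in>S. f x = 0} = {0}"
    using linear_inj_on_iff_eq_0[OF f S(1)] inj linear_0[OF f] vs1.subspace_0[OF S(1)] by auto
  moreover have "vs1.dim {0} = 0"
    using vs1.dim_le_card[of "{0}" "{}"] by simp
  ultimately show ?thesis using rank_nullity[OF f S] by simp
qed

end

section \<open>Determinants of families of functionals\<close>

definition ndet :: "nat \<Rightarrow> (nat \<Rightarrow> nat \<Rightarrow> 'a::comm_ring_1) \<Rightarrow> 'a" where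
  "ndet k G = Determinant.det (mat k k (\<lambda>(i, j). G i j))"

lemma ndet_cong: "(\<And>i j. i < k \<Longrightarrow> j < k \<Longrightarrow> G i j = H i j) \<Longrightarrow> ndet k G = ndet k H"
  unfolding ndet_def by (intro arg_cong[of _ _ Determinant.det] eq_matI) auto

lemma ndet_identity: "ndet k (\<lambda>i j. if i = j then 1 else 0) = 1"
proof -
  have "mat k k (\<lambda>(i, j). if i = j then 1 else 0) = (1\<^sub>m k :: 'a::comm_ring_1 mat)"
    by (rule eq_matI) auto
  then show ?thesis unfolding ndet_def by simp
qed

lemma ndet_kernel:
  fixes G :: "nat \<Rightarrow> nat \<Rightarrow> 'a::field"
  assumes "ndet k G \<noteq> 0" "\<And>i. i < k \<Longrightarrow> (\<Sum>j<k. G i j * c j) = 0" "j < k"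
  shows "c j = 0"
proof (rule ccontr)
  assume "c j \<noteq> 0"
  let ?A = "mat k k (\<lambda>(i, j). G i j)" and ?v = "Matrix.vec k c"
  have "?v \<noteq> 0\<^sub>v k"
  proof
    assume "?v = 0\<^sub>v k"
    then have "vec_index ?v j = vec_index (0\<^sub>v k) j" by simp
    then show False using \<open>c j \<noteq> 0\<close> assms(3) by simp
  qed
  moreover have "?A *\<^sub>v ?v = 0\<^sub>v k"
    by (rule eq_vecI) (use assms(2) in \<open>auto simp: scalar_prod_def lessThan_atLeast0\<close>)
  ultimately have "Determinant.det ?A = 0"
    using det_0_iff_vec_prod_zero_field[of ?A k] by (metis mat_carrier vec_carrier)
  then show False using assms(1) unfolding ndet_def by simp
qed

lemma (in comm_ring_hom) hom_ndet: "hom (ndet k G) = ndet k (\<lambda>i j. hom (G i j))"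
proof -
  have "map_mat hom (mat k k (\<lambda>(i, j). G i j)) = mat k k (\<lambda>(i, j). hom (G i j))"
    by (rule eq_matI) auto
  then show ?thesis unfolding ndet_def using hom_det[of "mat k k (\<lambda>(i, j). G i j)"] by simp
qed

context vector_space begin

lemma functional_pair: "vector_space_pair scale ((*) :: 'a \<Rightarrow> 'a \<Rightarrow> 'a)"
  by unfold_locales (auto simp: algebra_simps)

lemma indep_family_dual:
  assumes "indep_family scale k x"
  obtains g where "\<forall>i. functional scale (g i)"
    "\<forall>i<k. \<forall>j<k. g i (x j) = (if i = j then 1 else 0)"
proof -
  interpret p: vector_space_pair scale "(*) :: 'a \<Rightarrow> 'a \<Rightarrow> 'a" by (rule functional_pair)
  have "\<exists>g. functional scale g \<and> (\<forall>v\<in>x ` {..<k}. g v = (if v = x i then 1 else 0))" for i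
    by (rule p.linear_independent_extend[OF indep_family_independent[OF assms]])
  then obtain g where g: "\<And>i. functional scale (g i)"
    "\<And>i v. v \<in> x ` {..<k} \<Longrightarrow> g i v = (if v = x i then 1 else 0)" by metis
  show ?thesis
    by (rule that[of g]) (use g indep_family_inj_on[OF assms] in \<open>auto dest: inj_onD\<close>)
qed

text \<open>With \<open>indep_family_dual\<close> this says that rank at least k means a nonzero k
  by k determinant for some vectors and functionals, a condition that survives perturbation and
  specialisation.\<close>

lemma indep_family_of_ndet:
  assumes g: "\<And>i. i < k \<Longrightarrow> functional scale (g i)" and nz: "ndet k (\<lambda>i j. g i (x j)) \<noteq> 0"
  shows "indep_family scale k x"
  unfolding indep_family_def
proof (intro allI impI)
  fix c j assume c: "(\<Sum>j<k. scale (c j) (x j)) = 0" and j: "j < k"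
  interpret p: vector_space_pair scale "(*) :: 'a \<Rightarrow> 'a \<Rightarrow> 'a" by (rule functional_pair)
  have "(\<Sum>j<k. g i (x j) * c j) = 0" if "i < k" for i
  proof -
    have "(\<Sum>j<k. g i (x j) * c j) = g i (\<Sum>j<k. scale (c j) (x j))"
      by (simp add: p.linear_sum[OF g[OF that]] p.linear_scale[OF g[OF that]] mult.commute)
    then show ?thesis using c p.linear_0[OF g[OF that]] by simp
  qed
  then show "c j = 0" using ndet_kernel[OF nz _ j, of c] by blast
qed

end

section \<open>Polynomial functions and specialization\<close>

text \<open>Polynomial dependence on one variable at a time is all that \<open>specialize\<close>
  asks for, so multivariate polynomials are avoided.\<close>

definition poly_fun :: "('a::comm_ring_1 \<Rightarrow> 'a) \<Rightarrow> bool" where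
  "poly_fun f \<longleftrightarrow> (\<exists>p. \<forall>x. f x = poly p x)"

named_theorems poly_fun_intros

lemma poly_fun_const [poly_fun_intros]: "poly_fun (\<lambda>x. c)"
  unfolding poly_fun_def by (rule exI[of _ "[:c:]"]) simp

lemma poly_fun_id [poly_fun_intros]: "poly_fun (\<lambda>x. x)"
  unfolding poly_fun_def by (rule exI[of _ "[:0, 1:]"]) simp

lemma poly_fun_add [poly_fun_intros]: "poly_fun f \<Longrightarrow> poly_fun g \<Longrightarrow> poly_fun (\<lambda>x. f x + g x)"
  unfolding poly_fun_def by (metis poly_add)

lemma poly_fun_mult [poly_fun_intros]: "poly_fun f \<Longrightarrow> poly_fun g \<Longrightarrow> poly_fun (\<lambda>x. f x * g x)"
  unfolding poly_fun_def by (metis poly_mult)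

lemma poly_fun_sum [poly_fun_intros]: "(\<And>i. i \<in> A \<Longrightarrow> poly_fun (f i)) \<Longrightarrow> poly_fun (\<lambda>x. \<Sum>i\<in>A. f i x)"
  by (induction A rule: infinite_finite_induct) (auto intro!: poly_fun_intros)

lemma poly_fun_prod [poly_fun_intros]: "(\<And>i. i \<in> A \<Longrightarrow> poly_fun (f i)) \<Longrightarrow> poly_fun (\<lambda>x. \<Prod>i\<in>A. f i x)"
  by (induction A rule: infinite_finite_induct) (auto intro!: poly_fun_intros)

lemma poly_fun_update [poly_fun_intros]: "poly_fun (\<lambda>x. (\<tau>(i := x)) j)"
  by (cases "i = j") (auto intro: poly_fun_intros)

lemma poly_fun_ndet [poly_fun_intros]:
  assumes "\<And>i j. i < k \<Longrightarrow> j < k \<Longrightarrow> poly_fun (\<lambda>x. G x i j)"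
  shows "poly_fun (\<lambda>x. ndet k (G x))"
proof -
  have "ndet k (G x) = (\<Sum>p | p permutes {0..<k}. of_int (sign p) * (\<Prod>i = 0..<k. G x i (p i)))" for x
    unfolding ndet_def det_def
    by (auto intro!: sum.cong prod.cong simp: permutes_in_image)
  moreover have "poly_fun (\<lambda>x. \<Sum>p | p permutes {0..<k}. of_int (sign p) * (\<Prod>i = 0..<k. G x i (p i)))"
    by (intro poly_fun_intros assms) (auto simp: permutes_in_image)
  ultimately show ?thesis by simp
qed

lemma poly_fun_nonzero:
  fixes f :: "'a::idom \<Rightarrow> 'a"
  assumes "poly_fun f" "f a \<noteq> 0" "infinite S"
  shows "\<exists>s\<in>S. f s \<noteq> 0"
proof -
  obtain p where p: "\<And>x. f x = poly p x" using assms(1) unfolding poly_fun_def by blast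
  then have "p \<noteq> 0" using assms(2) by auto
  then have "finite {x. poly p x = 0}" by (rule poly_roots_finite)
  then have "\<not> S \<subseteq> {x. poly p x = 0}" using assms(3) finite_subset by blast
  then show ?thesis using p by auto
qed

text \<open>The coordinates in \<open>I\<close> are replaced one after another: with the others
  frozen, a polynomial in one variable that is not identically zero has a nonroot in the infinite
  set \<open>S\<close>.\<close>

lemma specialize:
  fixes \<Phi> :: "('i \<Rightarrow> 'a::idom) \<Rightarrow> 'a"
  assumes "finite I" "\<And>i \<tau>. i \<in> I \<Longrightarrow> poly_fun (\<lambda>x. \<Phi> (\<tau>(i := x)))" "\<Phi> \<tau> \<noteq> 0" "infinite S"
  shows "\<exists>\<tau>'. (\<forall>i\<in>I. \<tau>' i \<in> S) \<and> \<Phi> \<tau>' \<noteq> 0"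
  using assms(1,2)
proof (induction I)
  case empty
  then show ?case using assms(3) by auto
next
  case (insert i I)
  then obtain \<tau>' where t: "\<forall>i\<in>I. \<tau>' i \<in> S" "\<Phi> \<tau>' \<noteq> 0" by auto
  obtain s where "s \<in> S" "\<Phi> (\<tau>'(i := s)) \<noteq> 0"
    using poly_fun_nonzero[of "\<lambda>x. \<Phi> (\<tau>'(i := x))" "\<tau>' i" S] insert.prems t(2) assms(4) by auto
  then have "\<forall>j\<in>insert i I. (\<tau>'(i := s)) j \<in> S" using t(1) by auto
  then show ?case using \<open>\<Phi> (\<tau>'(i := s)) \<noteq> 0\<close> by blast
qed

section \<open>Tuples and block maps\<close>

lemma sum_fun_apply: "(\<Sum>i\<in>A. f i) x = (\<Sum>i\<in>A. f i x)"
  by (induction A rule: infinite_finite_induct) auto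

lemma vector_space_fun_scale:
  assumes "vector_space s"
  shows "vector_space (fun_scale s :: 'a::field \<Rightarrow> ('i \<Rightarrow> 'b::ab_group_add) \<Rightarrow> 'i \<Rightarrow> 'b)"
proof -
  interpret vector_space s by (rule assms)
  show ?thesis
    by unfold_locales (auto simp: fun_scale_def fun_eq_iff scale_right_distrib scale_left_distrib)
qed

definition single :: "nat \<Rightarrow> 'v::zero \<Rightarrow> nat \<Rightarrow> 'v" where
  "single i v = (\<lambda>j. if j = i then v else 0)"

text \<open>An element of \<open>X \<otimes> M_r\<close> is an r by r matrix with entries in
  \<open>X\<close>; this is its action on tuples of length r.\<close>

definition block_map :: "nat \<Rightarrow> (nat \<Rightarrow> nat \<Rightarrow> 'v \<Rightarrow> 'w::comm_monoid_add) \<Rightarrow> (nat \<Rightarrow> 'v) \<Rightarrow> nat \<Rightarrow> 'w" where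
  "block_map r M x = (\<lambda>i. if i < r then \<Sum>j<r. M i j (x j) else 0)"

lemma tuple_space_mono: "U \<subseteq> V \<Longrightarrow> tuple_space r U \<subseteq> tuple_space r V"
  unfolding tuple_space_def by auto

lemma single_in_tuple_space: "v \<in> U \<Longrightarrow> 0 \<in> U \<Longrightarrow> i < r \<Longrightarrow> single i v \<in> tuple_space r U"
  unfolding tuple_space_def single_def by auto

lemma tuple_space_eq_sum_single:
  fixes x :: "nat \<Rightarrow> 'v::comm_monoid_add"
  assumes "x \<in> tuple_space r U"
  shows "x = (\<Sum>i<r. single i (x i))"
proof
  fix j
  have "(\<Sum>i<r. if j = i then x i else 0) = (if j < r then x j else 0)"
    by (simp add: sum.delta)
  then show "x j = (\<Sum>i<r. single i (x i)) j"
    using assms unfolding tuple_space_def by (auto simp: sum_fun_apply single_def)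
qed

context vector_space begin

lemma subspace_tuple_space:
  assumes "subspace U"
  shows "module.subspace (fun_scale scale) (tuple_space r U)"
proof -
  interpret t: vector_space "fun_scale scale :: _ \<Rightarrow> (nat \<Rightarrow> 'b) \<Rightarrow> _"
    by (rule vector_space_fun_scale[OF vector_space_axioms])
  show ?thesis
    by (rule t.subspaceI) (use assms in \<open>auto simp: tuple_space_def fun_scale_def subspace_0 subspace_add subspace_scale\<close>)
qed

lemma linear_single: "Vector_Spaces.linear scale (fun_scale scale) (single i)"
  unfolding Vector_Spaces.linear_iff
  by (auto simp: vector_space_axioms vector_space_fun_scale single_def fun_scale_def)

lemma linear_component: "Vector_Spaces.linear (fun_scale scale) scale (\<lambda>x. x (i::nat))"
  unfolding Vector_Spaces.linear_iff
  by (auto simp: vector_space_axioms vector_space_fun_scale fun_scale_def)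

lemma fin_dim_tuple_space:
  assumes "fin_dim scale U"
  shows "fin_dim (fun_scale scale) (tuple_space r U)"
proof -
  interpret t: vector_space "fun_scale scale :: _ \<Rightarrow> (nat \<Rightarrow> 'b) \<Rightarrow> _"
    by (rule vector_space_fun_scale[OF vector_space_axioms])
  interpret p: vector_space_pair scale "fun_scale scale :: _ \<Rightarrow> (nat \<Rightarrow> 'b) \<Rightarrow> _" ..
  obtain B where B: "finite B" "U \<subseteq> span B" using assms unfolding fin_dim_def by blast
  let ?C = "\<Union>i<r. single i ` B"
  have "tuple_space r U \<subseteq> t.span ?C"
  proof
    fix x assume x: "x \<in> tuple_space r U"
    have "single i (x i) \<in> t.span ?C" if "i < r" for i
    proof -
      have "x i \<in> span B" using x that B(2) unfolding tuple_space_def by auto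
      then have "single i (x i) \<in> t.span (single i ` B)"
        using p.linear_span_image[OF linear_single, of i B] by auto
      then show ?thesis using t.span_mono[of "single i ` B" ?C] that by auto
    qed
    then show "x \<in> t.span ?C"
      by (subst tuple_space_eq_sum_single[OF x]) (auto intro: t.span_sum)
  qed
  then show ?thesis unfolding fin_dim_def using B(1) by (intro exI[of _ ?C]) auto
qed

lemma dim_tuple_space:
  assumes U: "subspace U" "fin_dim scale U"
  shows "vector_space.dim (fun_scale scale) (tuple_space r U) = r * dim U"
proof (induction r)
  interpret t: vector_space "fun_scale scale :: _ \<Rightarrow> (nat \<Rightarrow> 'b) \<Rightarrow> _"
    by (rule vector_space_fun_scale[OF vector_space_axioms])
  {
    case 0
    have "tuple_space 0 U \<subseteq> t.span {}"
      unfolding tuple_space_def by (auto simp: fun_eq_iff)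
    then show ?case using t.dim_le_card[of "tuple_space 0 U" "{}"] by simp
  next
    case (Suc r)
    interpret p: vector_space_pair "fun_scale scale :: _ \<Rightarrow> (nat \<Rightarrow> 'b) \<Rightarrow> _" scale ..
    let ?T = "tuple_space (Suc r) U"
    have "(\<lambda>x. x r) ` ?T = U"
    proof (intro equalityI subsetI)
      fix u assume "u \<in> U"
      then have "single r u \<in> ?T" using subspace_0[OF U(1)] by (intro single_in_tuple_space) auto
      then have "single r u r \<in> (\<lambda>x. x r) ` ?T" by (rule imageI)
      then show "u \<in> (\<lambda>x. x r) ` ?T" by (simp add: single_def)
    qed (auto simp: tuple_space_def)
    moreover have "{x \<in> ?T. x r = 0} = tuple_space r U"
    proof (intro equalityI subsetI)
      fix x assume x: "x \<in> {x \<in> ?T. x r = 0}"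
      have "x i = 0" if "i \<ge> r" for i
        using x that unfolding tuple_space_def by (cases "i = r") auto
      then show "x \<in> tuple_space r U" using x unfolding tuple_space_def by auto
    next
      fix x assume x: "x \<in> tuple_space r U"
      have "x i \<in> U" if "i < Suc r" for i
        using x that subspace_0[OF U(1)] unfolding tuple_space_def by (cases "i = r") auto
      then show "x \<in> {x \<in> ?T. x r = 0}" using x unfolding tuple_space_def by auto
    qed
    moreover have "t.dim ?T = dim ((\<lambda>x. x r) ` ?T) + t.dim {x \<in> ?T. x r = 0}"
      by (rule p.rank_nullity[OF linear_component subspace_tuple_space[OF U(1)] fin_dim_tuple_space[OF U(2)]])
    ultimately show ?case using Suc.IH by simp
  }
qed

lemma indep_family_Suc:
  assumes "indep_family scale k x" "v \<notin> span (x ` {..<k})"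
  shows "indep_family scale (Suc k) (x(k := v))"
proof (rule indep_family_of_independent)
  have im: "(x(k := v)) ` {..<Suc k} = insert v (x ` {..<k})"
    by (auto simp: lessThan_Suc)
  show "independent ((x(k := v)) ` {..<Suc k})"
    unfolding im by (rule independent_insertI[OF assms(2) indep_family_independent[OF assms(1)]])
  have "v \<notin> x ` {..<k}" using assms(2) span_base[of v "x ` {..<k}"] by auto
  then have "inj_on (x(k := v)) {..<k}"
    by (rule inj_on_fun_updI[OF indep_family_inj_on[OF assms(1)]])
  moreover have "(x(k := v)) ` ({..<k} - {k}) = x ` {..<k}" by (rule image_cong) auto
  ultimately show "inj_on (x(k := v)) {..<Suc k}"
    using \<open>v \<notin> x ` {..<k}\<close> unfolding lessThan_Suc inj_on_insert by auto
qed

end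

context vector_space_pair begin

lemma tuple_pair: "vector_space_pair (fun_scale s1 :: _ \<Rightarrow> (nat \<Rightarrow> _) \<Rightarrow> _) (fun_scale s2 :: _ \<Rightarrow> (nat \<Rightarrow> _) \<Rightarrow> _)"
  unfolding vector_space_pair_def
  using vector_space_fun_scale[OF vs1.vector_space_axioms] vector_space_fun_scale[OF vs2.vector_space_axioms] by blast

lemma linear_block_map:
  assumes "\<And>i j. Vector_Spaces.linear s1 s2 (M i j)"
  shows "Vector_Spaces.linear (fun_scale s1) (fun_scale s2) (block_map r M)"
  unfolding Vector_Spaces.linear_iff
  by (auto simp: vector_space_fun_scale[OF vs1.vector_space_axioms] vector_space_fun_scale[OF vs2.vector_space_axioms]
      block_map_def fun_scale_def fun_eq_iff linear_add[OF assms] linear_scale[OF assms]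
      sum.distrib vs2.scale_sum_right)

text \<open>Under the perturbation \<open>A - t B\<close> the vector \<open>\<Sum>i\<le>k. t\<^sup>i x\<^sub>i\<close> is mapped
  to \<open>- t\<^sup>k\<^sup>+\<^sup>1 B x\<^sub>k\<close>, which is new compared to the image of \<open>A\<close>.\<close>

lemma rank_perturbation:
  assumes A: "Vector_Spaces.linear s1 s2 A" and B: "Vector_Spaces.linear s1 s2 B"
    and S: "vs1.subspace S" "fin_dim s1 S"
    and x: "\<And>i. i \<le> k \<Longrightarrow> x i \<in> S" "A (x 0) = 0" "\<And>i. i < k \<Longrightarrow> A (x (Suc i)) = B (x i)"
    and new: "B (x k) \<notin> A ` S"
    and inf: "infinite (UNIV :: 'a set)"
  shows "\<exists>t. vs2.dim (A ` S) < vs2.dim ((\<lambda>v. A v - s2 t (B v)) ` S)"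
proof -
  interpret d: vector_space_pair s2 "(*) :: 'a \<Rightarrow> 'a \<Rightarrow> 'a" by (rule vs2.functional_pair)
  define P where "P t v = A v - s2 t (B v)" for t v
  have P: "Vector_Spaces.linear s1 s2 (P t)" for t
    unfolding P_def using A B by (intro linear_compose_sub linear_compose_scale_right)
  have fA: "fin_dim s2 (A ` S)" using fin_dim_image[OF A S(2)] .
  let ?r = "vs2.dim (A ` S)"
  obtain y where y: "indep_family s2 ?r y" "\<forall>j<?r. y j \<in> A ` S"
    "A ` S \<subseteq> vs2.span (y ` {..<?r})"
    using vs2.indep_family_basis[OF fA] .
  have "\<forall>j. \<exists>z. j < ?r \<longrightarrow> z \<in> S \<and> y j = A z" using y(2) by auto
  then obtain z where z: "\<forall>j. j < ?r \<longrightarrow> z j \<in> S \<and> y j = A (z j)" by (rule choice[THEN exE])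
  \<comment> \<open>The first vectors move with the perturbation, while the last stays fixed, since
    it will turn out to lie in the image of \<open>P t\<close> for every nonzero \<open>t\<close>.
    At \<open>t = 0\<close> the family is a basis of the image of \<open>A\<close> extended by the
    new vector.\<close>
  define w where "w t = (\<lambda>j. P t (z j))(?r := B (x k))" for t
  have "vs2.span (y ` {..<?r}) \<subseteq> A ` S"
    by (rule vs2.span_minimal) (use y(2) linear_subspace_image[OF A S(1)] in auto)
  then have "indep_family s2 (Suc ?r) (y(?r := B (x k)))"
    using vs2.indep_family_Suc[OF y(1)] new by blast
  from vs2.indep_family_dual[OF this]
  obtain g where g': "\<forall>i. functional s2 (g i)" "\<forall>i<Suc ?r. \<forall>j<Suc ?r.
      g i ((y(?r := B (x k))) j) = (if i = j then 1 else 0)" .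
  have g: "functional s2 (g i)" for i using g'(1) by blast
  have "w 0 j = (y(?r := B (x k))) j" if "j < Suc ?r" for j
    using z that by (auto simp: w_def P_def)
  then have "ndet (Suc ?r) (\<lambda>i j. g i (w 0 j)) = ndet (Suc ?r) (\<lambda>i j. if i = j then 1 else 0)"
    using g'(2) by (intro ndet_cong) auto
  then have nz: "ndet (Suc ?r) (\<lambda>i j. g i (w 0 j)) \<noteq> 0" by (simp add: ndet_identity)
  have "poly_fun (\<lambda>t. g i (w t j))" for i j
  proof (cases "j = ?r")
    case True
    then have "g i (w t j) = g i (B (x k))" for t by (simp add: w_def)
    then show ?thesis by (simp only:) (rule poly_fun_const)
  next
    case False
    then have "g i (w t j) = g i (A (z j)) + t * (- g i (B (z j)))" for t
      by (simp add: w_def P_def d.linear_diff[OF g] d.linear_scale[OF g])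
    then show ?thesis by (simp only:) (intro poly_fun_intros)
  qed
  then have "poly_fun (\<lambda>t. ndet (Suc ?r) (\<lambda>i j. g i (w t j)))" by (rule poly_fun_ndet)
  \<comment> \<open>\<open>t = 0\<close> must be avoided: there \<open>B (x k)\<close> is outside
    the image, and below a power of \<open>t\<close> is inverted.\<close>
  moreover have "infinite (UNIV - {0::'a})" using inf by simp
  ultimately have "\<exists>t\<in>UNIV - {0}. ndet (Suc ?r) (\<lambda>i j. g i (w t j)) \<noteq> 0"
    by (rule poly_fun_nonzero[where f = "\<lambda>t. ndet (Suc ?r) (\<lambda>i j. g i (w t j))" and a = 0, OF _ nz])
  then obtain t where t: "t \<noteq> 0" "ndet (Suc ?r) (\<lambda>i j. g i (w t j)) \<noteq> 0" by auto
  have ind: "indep_family s2 (Suc ?r) (w t)"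
    by (rule vs2.indep_family_of_ndet[OF _ t(2)]) (rule g)
  have sub: "vs2.subspace (P t ` S)" using linear_subspace_image[OF P S(1)] .
  have tel: "(\<Sum>i\<le>m. s2 (t ^ i) (P t (x i))) = - s2 (t ^ Suc m) (B (x m))" if "m \<le> k" for m
    using that
  proof (induction m)
    case 0
    then show ?case using x(2) by (simp add: P_def)
  next
    case (Suc m)
    then have "(\<Sum>i\<le>Suc m. s2 (t ^ i) (P t (x i)))
      = - s2 (t ^ Suc m) (B (x m)) + s2 (t ^ Suc m) (P t (x (Suc m)))" by simp
    also have "\<dots> = - s2 (t ^ Suc (Suc m)) (B (x (Suc m)))"
      using x(3)[of m] Suc.prems by (simp add: P_def vs2.scale_right_diff_distrib mult.commute)
    finally show ?case .
  qed
  have "(\<Sum>i\<le>k. s2 (t ^ i) (P t (x i))) \<in> P t ` S"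
    using x(1) by (intro vs2.subspace_sum[OF sub] vs2.subspace_scale[OF sub]) auto
  then have "s2 (- inverse (t ^ Suc k)) (- s2 (t ^ Suc k) (B (x k))) \<in> P t ` S"
    unfolding tel[OF order_refl] by (rule vs2.subspace_scale[OF sub])
  moreover have "inverse (t ^ Suc k) * t ^ Suc k = 1" using t(1) by (intro left_inverse) simp
  ultimately have "B (x k) \<in> P t ` S" by (simp only: vs2.scale_minus_left vs2.scale_minus_right
      vs2.scale_scale mult_minus_left minus_minus vs2.scale_one)
  then have "w t j \<in> P t ` S" if "j < Suc ?r" for j
    using that z by (auto simp: w_def)
  then have "Suc ?r \<le> vs2.dim (P t ` S)"
    using vs2.indep_family_le_dim[OF ind] fin_dim_image[OF P S(2)] by blast
  then show ?thesis unfolding P_def by (intro exI[of _ t]) simp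
qed

end

section \<open>Blow-ups of a space of maps and the upper bound for their ranks\<close>

locale map_space = vector_space_pair s1 s2
  for s1 :: "'a::field \<Rightarrow> 'v \<Rightarrow> 'v::ab_group_add" and s2 :: "'a \<Rightarrow> 'w \<Rightarrow> 'w::ab_group_add" +
  fixes D :: "'v set" and X :: "('v \<Rightarrow> 'w) set"
  assumes subspace_D: "vs1.subspace D" and fin_dim_D: "fin_dim s1 D"
    and fin_dim_UNIV: "fin_dim s2 UNIV"
    and linear_X: "T \<in> X \<Longrightarrow> Vector_Spaces.linear s1 s2 T"
    and subspace_X: "module.subspace (fun_scale s2) X"
begin

sublocale tup: vector_space_pair
  "fun_scale s1 :: 'a \<Rightarrow> (nat \<Rightarrow> 'v) \<Rightarrow> nat \<Rightarrow> 'v" "fun_scale s2 :: 'a \<Rightarrow> (nat \<Rightarrow> 'w) \<Rightarrow> nat \<Rightarrow> 'w"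
  by (rule tuple_pair)

sublocale maps: vector_space "fun_scale s2 :: 'a \<Rightarrow> ('v \<Rightarrow> 'w) \<Rightarrow> 'v \<Rightarrow> 'w"
  by (rule vector_space_fun_scale[OF vs2.vector_space_axioms])

definition blocks :: "(nat \<Rightarrow> nat \<Rightarrow> 'v \<Rightarrow> 'w) \<Rightarrow> bool" where
  "blocks M \<longleftrightarrow> (\<forall>i j. M i j \<in> X)"

definition rk :: "nat \<Rightarrow> (nat \<Rightarrow> nat \<Rightarrow> 'v \<Rightarrow> 'w) \<Rightarrow> nat" where
  "rk r M = tup.vs2.dim (block_map r M ` tuple_space r D)"

definition action :: "'v set \<Rightarrow> 'w set" where
  "action U = vs2.span {T u |T u. T \<in> X \<and> u \<in> U}"

lemma zero_X: "(\<lambda>_. 0) \<in> X"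
  using maps.subspace_0[OF subspace_X] by (simp add: zero_fun_def)

lemma add_X: "S \<in> X \<Longrightarrow> T \<in> X \<Longrightarrow> (\<lambda>x. S x + T x) \<in> X"
  using maps.subspace_add[OF subspace_X, of S T] by (simp add: plus_fun_def)

lemma scale_X: "T \<in> X \<Longrightarrow> (\<lambda>x. s2 c (T x)) \<in> X"
  using maps.subspace_scale[OF subspace_X, of T c] by (simp add: fun_scale_def)

lemma linear_blocks: "blocks M \<Longrightarrow> Vector_Spaces.linear (fun_scale s1) (fun_scale s2) (block_map r M)"
  by (rule linear_block_map) (simp add: blocks_def linear_X)

text \<open>Block maps with entries in \<open>X\<close> form a subspace that contains each
  \<open>T \<otimes> B\<close>, and each is the sum of its entries tensored with matrix
  units.\<close>

lemma tensor_matrices_eq: "tensor_matrices s2 r X = {block_map r M |M. blocks M}" (is "_ = ?R")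
proof -
  interpret tm: vector_space "fun_scale (fun_scale s2) :: 'a \<Rightarrow> ((nat \<Rightarrow> 'v) \<Rightarrow> nat \<Rightarrow> 'w) \<Rightarrow> _"
    by (intro vector_space_fun_scale vs2.vector_space_axioms)
  have sub: "tm.subspace ?R"
  proof (rule tm.subspaceI)
    have "(0 :: (nat \<Rightarrow> 'v) \<Rightarrow> nat \<Rightarrow> 'w) = block_map r (\<lambda>i j _. 0)"
      by (auto simp: block_map_def fun_eq_iff)
    then show "0 \<in> ?R" using zero_X unfolding blocks_def by blast
  next
    fix f g assume "f \<in> ?R" "g \<in> ?R"
    then obtain M N where MN: "f = block_map r M" "g = block_map r N" "blocks M" "blocks N" by blast
    have "f + g = block_map r (\<lambda>i j x. M i j x + N i j x)"
      unfolding MN by (auto simp: block_map_def fun_eq_iff sum.distrib)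
    moreover have "blocks (\<lambda>i j x. M i j x + N i j x)" using MN add_X unfolding blocks_def by blast
    ultimately show "f + g \<in> ?R" by blast
  next
    fix c f assume "f \<in> ?R"
    then obtain M where M: "f = block_map r M" "blocks M" by blast
    have "fun_scale (fun_scale s2) c f = block_map r (\<lambda>i j x. s2 c (M i j x))"
      unfolding M by (auto simp: block_map_def fun_eq_iff fun_scale_def vs2.scale_sum_right)
    moreover have "blocks (\<lambda>i j x. s2 c (M i j x))" using M scale_X unfolding blocks_def by blast
    ultimately show "fun_scale (fun_scale s2) c f \<in> ?R" by blast
  qed
  show ?thesis
  proof
    show "tensor_matrices s2 r X \<subseteq> ?R"
      unfolding tensor_matrices_def
    proof (rule tm.span_minimal[OF _ sub], clarify)
      fix T B assume "T \<in> X"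
      then have "blocks (\<lambda>i j x. s2 (B i j) (T x))" using scale_X unfolding blocks_def by blast
      moreover have "tensor_map s2 r T B = block_map r (\<lambda>i j x. s2 (B i j) (T x))"
        by (simp add: tensor_map_def block_map_def fun_eq_iff)
      ultimately show "\<exists>M. tensor_map s2 r T B = block_map r M \<and> blocks M" by blast
    qed
    show "?R \<subseteq> tensor_matrices s2 r X"
    proof clarify
      fix M assume M: "blocks M"
      \<comment> \<open>The matrix unit with its 1 at position (i, j).\<close>
      define E where "E i j = (\<lambda>a b. if a = i \<and> b = j then 1 else (0::'a))" for i j :: nat
      have "block_map r M x a = (\<Sum>i<r. \<Sum>j<r. tensor_map s2 r (M i j) (E i j)) x a" for x a
      proof (cases "a < r")
        case True
        have "(\<Sum>i<r. \<Sum>j<r. tensor_map s2 r (M i j) (E i j)) x a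
          = (\<Sum>i<r. \<Sum>j<r. \<Sum>b<r. s2 (E i j a b) (M i j (x b)))"
          using True by (simp add: sum_fun_apply tensor_map_def)
        also have "\<dots> = (\<Sum>i<r. \<Sum>j<r. if i = a then M i j (x j) else 0)"
        proof (intro sum.cong refl)
          fix i j assume "j \<in> {..<r}"
          then have "(\<Sum>b<r. s2 (E i j a b) (M i j (x b))) = (\<Sum>b<r. if b = j then (if i = a then M i j (x j) else 0) else 0)"
            by (intro sum.cong) (auto simp: E_def)
          then show "(\<Sum>b<r. s2 (E i j a b) (M i j (x b))) = (if i = a then M i j (x j) else 0)"
            using \<open>j \<in> {..<r}\<close> by simp
        qed
        also have "\<dots> = (\<Sum>j<r. \<Sum>i<r. if i = a then M i j (x j) else 0)" by (rule sum.swap)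
        also have "\<dots> = (\<Sum>j<r. M a j (x j))" using True by simp
        finally show ?thesis using True by (simp add: block_map_def)
      qed (simp add: sum_fun_apply tensor_map_def block_map_def)
      then have "block_map r M = (\<Sum>i<r. \<Sum>j<r. tensor_map s2 r (M i j) (E i j))"
        by (simp add: fun_eq_iff)
      moreover have "(\<Sum>i<r. \<Sum>j<r. tensor_map s2 r (M i j) (E i j))
          \<in> tm.span {tensor_map s2 r T B |T B. T \<in> X}"
        using M by (intro tm.span_sum tm.span_base) (auto simp: blocks_def)
      ultimately show "block_map r M \<in> tensor_matrices s2 r X"
        unfolding tensor_matrices_def by simp
    qed
  qed
qed

lemma fin_dim_tuples: "fin_dim (fun_scale s1) (tuple_space r D)"
  by (rule vs1.fin_dim_tuple_space[OF fin_dim_D])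

lemma subspace_tuples: "tup.vs1.subspace (tuple_space r D)"
  by (rule vs1.subspace_tuple_space[OF subspace_D])

lemma fin_dim_cod: "fin_dim s2 W"
  using vs2.fin_dim_subset[OF fin_dim_UNIV] by blast

lemma block_map_in_action:
  assumes "blocks M" "x \<in> tuple_space r U"
  shows "block_map r M x \<in> tuple_space r (action U)"
proof -
  have "M i j (x j) \<in> action U" if "j < r" for i j
    using assms that unfolding action_def blocks_def tuple_space_def by (blast intro: vs2.span_base)
  then show ?thesis
    unfolding tuple_space_def block_map_def action_def
    by (auto intro!: vs2.span_sum)
qed

text \<open>A block map sends \<open>U\<close>-tuples to tuples in \<open>action U\<close>, so it
  has rank at most \<open>r * dim (action U)\<close> there; passing from \<open>U\<close> to
  \<open>D\<close> adds at most \<open>r * (dim D - dim U)\<close>. The inequality is written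
  without subtraction.\<close>

lemma rk_le:
  assumes M: "blocks M" and U: "vs1.subspace U" "U \<subseteq> D"
  shows "rk r M + r * vs1.dim U \<le> r * vs1.dim D + r * vs2.dim (action U)"
proof -
  have fU: "fin_dim s1 U" using vs1.fin_dim_subset[OF fin_dim_D U(2)] .
  have sA: "vs2.subspace (action U)" unfolding action_def by (rule vs2.subspace_span)
  have "rk r M + tup.vs1.dim (tuple_space r U)
    \<le> tup.vs1.dim (tuple_space r D) + tup.vs2.dim (block_map r M ` tuple_space r U)"
    unfolding rk_def
    by (rule tup.dim_image_le_of_subspace[OF linear_blocks[OF M] subspace_tuples fin_dim_tuples
          vs1.subspace_tuple_space[OF U(1)] tuple_space_mono[OF U(2)]])
  moreover have "tup.vs2.dim (block_map r M ` tuple_space r U) \<le> tup.vs2.dim (tuple_space r (action U))"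
    by (rule tup.vs2.dim_le_of_subset)
      (use block_map_in_action[OF M] vs2.fin_dim_tuple_space[OF fin_dim_cod] in auto)
  ultimately show ?thesis
    using vs1.dim_tuple_space[OF U(1) fU] vs1.dim_tuple_space[OF subspace_D fin_dim_D]
      vs2.dim_tuple_space[OF sA fin_dim_cod] by simp
qed

end

section \<open>Escaping Wong sequences increase the rank of a blow-up\<close>

text \<open>A tuple of length \<open>d * s\<close> is viewed as s consecutive tuples of length d,
  and \<open>unflat d c\<close> extracts the one with number c. \<open>flat\<close> is the reverse
  regrouping.\<close>

definition unflat :: "nat \<Rightarrow> nat \<Rightarrow> (nat \<Rightarrow> 'v::zero) \<Rightarrow> nat \<Rightarrow> 'v" where
  "unflat d c x = (\<lambda>b. if b < d then x (c * d + b) else 0)"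

definition flat :: "nat \<Rightarrow> (nat \<Rightarrow> nat \<Rightarrow> 'v) \<Rightarrow> nat \<Rightarrow> 'v" where
  "flat d y = (\<lambda>i. y (i div d) (i mod d))"

definition diag_blocks :: "nat \<Rightarrow> (nat \<Rightarrow> nat \<Rightarrow> 'v \<Rightarrow> 'w::zero) \<Rightarrow> nat \<Rightarrow> nat \<Rightarrow> 'v \<Rightarrow> 'w" where
  "diag_blocks d M = (\<lambda>i j. if i div d = j div d then M (i mod d) (j mod d) else (\<lambda>_. 0))"

text \<open>A block matrix with \<open>N c\<close> in block position (c + 1, c): it carries block c
  to block c + 1. Its companion \<open>diag_blocks\<close> is \<open>M \<otimes> I\<close>.\<close>

definition subdiag_blocks :: "nat \<Rightarrow> (nat \<Rightarrow> nat \<Rightarrow> nat \<Rightarrow> 'v \<Rightarrow> 'w::zero) \<Rightarrow> nat \<Rightarrow> nat \<Rightarrow> 'v \<Rightarrow> 'w" where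
  "subdiag_blocks d N = (\<lambda>i j. if i div d = Suc (j div d) then N (j div d) (i mod d) (j mod d) else (\<lambda>_. 0))"

lemma sum_div_eq:
  fixes F :: "nat \<Rightarrow> 'w::comm_monoid_add"
  assumes "0 < d" "c < s"
  shows "(\<Sum>j<d * s. if c = j div d then F j else 0) = (\<Sum>b<d. F (c * d + b))"
proof -
  have "(\<Sum>j<d * s. if c = j div d then F j else 0) = (\<Sum>j\<in>(\<lambda>b. c * d + b) ` {..<d}. F j)"
  proof (rule sum.mono_neutral_cong_right)
    show "(\<lambda>b. c * d + b) ` {..<d} \<subseteq> {..<d * s}"
    proof clarify
      fix b assume "b < d"
      then have "c * d + b < Suc c * d" by simp
      also have "\<dots> \<le> s * d" using assms by (intro mult_le_mono1) simp
      finally show "c * d + b < d * s" by (simp add: mult.commute)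
    qed
    show "\<forall>j\<in>{..<d * s} - (\<lambda>b. c * d + b) ` {..<d}. (if c = j div d then F j else 0) = 0"
    proof clarify
      fix j assume j: "j \<notin> (\<lambda>b. c * d + b) ` {..<d}"
      have "j = (j div d) * d + j mod d" "j mod d < d" using assms by auto
      then have "c \<noteq> j div d" using j by (metis imageI lessThan_iff)
      then show "(if c = j div d then F j else 0) = 0" by simp
    qed
  qed (use assms in auto)
  also have "\<dots> = (\<Sum>b<d. F (c * d + b))" by (subst sum.reindex) (auto simp: inj_on_def)
  finally show ?thesis .
qed

lemma unflat_block_map_diag:
  assumes "0 < d" "c < s"
  shows "unflat d c (block_map (d * s) (diag_blocks d M) x) = block_map d M (unflat d c x)"
proof
  fix a
  show "unflat d c (block_map (d * s) (diag_blocks d M) x) a = block_map d M (unflat d c x) a"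
  proof (cases "a < d")
    case True
    have "c * d + a < Suc c * d" using True by simp
    also have "\<dots> \<le> s * d" using assms by (intro mult_le_mono1) simp
    finally have lt: "c * d + a < d * s" by (simp add: mult.commute)
    have "unflat d c (block_map (d * s) (diag_blocks d M) x) a
      = (\<Sum>j<d * s. if c = j div d then M a (j mod d) (x j) else 0)"
      using True lt assms by (auto simp: unflat_def block_map_def diag_blocks_def intro!: sum.cong)
    also have "\<dots> = (\<Sum>b<d. M a ((c * d + b) mod d) (x (c * d + b)))" by (rule sum_div_eq[OF assms])
    also have "\<dots> = block_map d M (unflat d c x) a"
      using True by (auto simp: block_map_def unflat_def intro!: sum.cong)
    finally show ?thesis .
  qed (simp add: unflat_def block_map_def)
qed

lemma unflat_block_map_subdiag:
  assumes "0 < d" "c < s"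
  shows "unflat d c (block_map (d * s) (subdiag_blocks d N) x)
    = (if c = 0 then (\<lambda>_. 0) else block_map d (N (c - 1)) (unflat d (c - 1) x))"
proof
  fix a
  show "unflat d c (block_map (d * s) (subdiag_blocks d N) x) a
    = (if c = 0 then (\<lambda>_. 0) else block_map d (N (c - 1)) (unflat d (c - 1) x)) a"
  proof (cases "a < d")
    case True
    have "c * d + a < Suc c * d" using True by simp
    also have "\<dots> \<le> s * d" using assms by (intro mult_le_mono1) simp
    finally have lt: "c * d + a < d * s" by (simp add: mult.commute)
    obtain i where i: "i = c * d + a" "i div d = c" "i mod d = a" "i < d * s" using True lt by auto
    have "unflat d c (block_map (d * s) (subdiag_blocks d N) x) a = block_map (d * s) (subdiag_blocks d N) x i"
      using True i(1) by (simp add: unflat_def)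
    then have *: "unflat d c (block_map (d * s) (subdiag_blocks d N) x) a
      = (\<Sum>j<d * s. if c = Suc (j div d) then N (j div d) a (j mod d) (x j) else 0)"
      using i(2-4) by (simp add: block_map_def subdiag_blocks_def if_distrib[of "\<lambda>f. f _"] cong: if_cong)
    show ?thesis
    proof (cases c)
      case 0
      then show ?thesis using * by simp
    next
      case (Suc c')
      have "(\<Sum>j<d * s. if c = Suc (j div d) then N (j div d) a (j mod d) (x j) else 0)
        = (\<Sum>j<d * s. if c' = j div d then N c' a (j mod d) (x j) else 0)"
        unfolding Suc by (intro sum.cong) auto
      also have "\<dots> = (\<Sum>b<d. N c' a ((c' * d + b) mod d) (x (c' * d + b)))"
        using assms Suc by (intro sum_div_eq) auto
      also have "\<dots> = block_map d (N c') (unflat d c' x) a"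
        using True by (auto simp: block_map_def unflat_def intro!: sum.cong)
      finally show ?thesis using * Suc by simp
    qed
  qed (auto simp: unflat_def block_map_def)
qed

lemma unflat_flat:
  assumes "0 < d" "y c \<in> tuple_space d U"
  shows "unflat d c (flat d y) = y c"
  using assms by (auto simp: unflat_def flat_def tuple_space_def)

lemma flat_in_tuple_space:
  assumes "0 < d" "y \<in> tuple_space s (tuple_space d U)"
  shows "flat d y \<in> tuple_space (d * s) U"
proof -
  have "flat d y i \<in> U" if "i < d * s" for i
  proof -
    have "i div d < s" using that by (simp add: less_mult_imp_div_less mult.commute)
    then show ?thesis using assms unfolding flat_def tuple_space_def by auto
  qed
  moreover have "flat d y i = 0" if "i \<ge> d * s" for i
  proof -
    have "s \<le> i div d" using that assms(1) by (simp add: less_eq_div_iff_mult_less_eq mult.commute)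
    then show ?thesis using assms(2) unfolding flat_def tuple_space_def by auto
  qed
  ultimately show ?thesis unfolding tuple_space_def by auto
qed

lemma tuple_space_eqI:
  assumes "0 < d" "x \<in> tuple_space (d * s) U" "y \<in> tuple_space (d * s) V"
    and "\<And>c. c < s \<Longrightarrow> unflat d c x = unflat d c y"
  shows "x = y"
proof
  fix i
  show "x i = y i"
  proof (cases "i < d * s")
    case True
    then have "i div d < s" by (simp add: less_mult_imp_div_less mult.commute)
    then have "unflat d (i div d) x (i mod d) = unflat d (i div d) y (i mod d)" using assms(4) by simp
    then show ?thesis using assms(1) by (simp add: unflat_def)
  next
    case False
    then show ?thesis using assms(2,3) by (simp add: tuple_space_def)
  qed
qed

lemma block_map_in_tuple_space: "block_map r M x \<in> tuple_space r UNIV"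
  by (simp add: block_map_def tuple_space_def)

context map_space begin

lemma block_map_zero: "blocks M \<Longrightarrow> block_map r M (\<lambda>_. 0) = (\<lambda>_. 0)"
  using tup.linear_0[OF linear_blocks] by (simp add: zero_fun_def)

lemma blocks_diag: "blocks M \<Longrightarrow> blocks (diag_blocks d M)"
  unfolding blocks_def diag_blocks_def using zero_X by auto

lemma blocks_subdiag: "(\<And>c. blocks (N c)) \<Longrightarrow> blocks (subdiag_blocks d N)"
  unfolding blocks_def subdiag_blocks_def using zero_X by auto

text \<open>The image of \<open>M \<otimes> I_s\<close> contains s independent copies of the image
  of \<open>M\<close>, one in each block.\<close>

lemma rk_diag_blocks:
  assumes d: "0 < d" and M: "blocks M"
  shows "s * rk d M \<le> rk (d * s) (diag_blocks d M)"
proof -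
  interpret tt: vector_space "fun_scale (fun_scale s2) :: 'a \<Rightarrow> (nat \<Rightarrow> nat \<Rightarrow> 'w) \<Rightarrow> _"
    by (intro vector_space_fun_scale vs2.vector_space_axioms)
  interpret p: vector_space_pair "fun_scale (fun_scale s2) :: 'a \<Rightarrow> (nat \<Rightarrow> nat \<Rightarrow> 'w) \<Rightarrow> _"
    "fun_scale s2 :: 'a \<Rightarrow> (nat \<Rightarrow> 'w) \<Rightarrow> _" ..
  let ?I = "block_map d M ` tuple_space d D" and ?B = "block_map (d * s) (diag_blocks d M)"
  have sI: "tup.vs2.subspace ?I" by (rule tup.linear_subspace_image[OF linear_blocks[OF M] subspace_tuples])
  have fI: "fin_dim (fun_scale s2) ?I" by (rule tup.fin_dim_image[OF linear_blocks[OF M] fin_dim_tuples])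
  have I: "?I \<subseteq> tuple_space d UNIV" using block_map_in_tuple_space by auto
  have lin: "Vector_Spaces.linear (fun_scale (fun_scale s2)) (fun_scale s2) (flat d :: (nat \<Rightarrow> nat \<Rightarrow> 'w) \<Rightarrow> _)"
    unfolding Vector_Spaces.linear_iff
    by (auto simp: tt.vector_space_axioms tup.vs2.vector_space_axioms flat_def fun_scale_def)
  have "flat d ` tuple_space s ?I \<subseteq> ?B ` tuple_space (d * s) D"
  proof clarify
    fix y assume y: "y \<in> tuple_space s ?I"
    have "\<forall>c. \<exists>x. c < s \<longrightarrow> x \<in> tuple_space d D \<and> y c = block_map d M x"
      using y unfolding tuple_space_def[of s] by auto
    then obtain x where x: "\<forall>c. c < s \<longrightarrow> x c \<in> tuple_space d D \<and> y c = block_map d M (x c)"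
      by (rule choice[THEN exE])
    define x' where "x' c = (if c < s then x c else 0)" for c
    have x': "x' \<in> tuple_space s (tuple_space d D)" using x by (auto simp: x'_def tuple_space_def[of s])
    have "flat d y = ?B (flat d x')"
    proof (rule tuple_space_eqI[OF d _ block_map_in_tuple_space])
      show "flat d y \<in> tuple_space (d * s) UNIV"
        using flat_in_tuple_space[OF d] y tuple_space_mono[OF I] by blast
      fix c assume c: "c < s"
      have "y c \<in> tuple_space d UNIV" using y c I unfolding tuple_space_def[of s] by auto
      then show "unflat d c (flat d y) = unflat d c (?B (flat d x'))"
        using c x unflat_flat[OF d, of x' c D] unflat_flat[OF d, of y c UNIV]
        by (simp add: unflat_block_map_diag[OF d c] x'_def)
    qed
    then show "flat d y \<in> ?B ` tuple_space (d * s) D" using flat_in_tuple_space[OF d x'] by blast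
  qed
  then have "tup.vs2.dim (flat d ` tuple_space s ?I) \<le> rk (d * s) (diag_blocks d M)"
    unfolding rk_def
    by (rule tup.vs2.dim_le_of_subset)
      (rule tup.fin_dim_image[OF linear_blocks[OF blocks_diag[OF M]] fin_dim_tuples])
  moreover have "tup.vs2.dim (flat d ` tuple_space s ?I) = tt.dim (tuple_space s ?I)"
  proof (rule p.dim_image_eq_of_inj_on[OF lin])
    show "tt.subspace (tuple_space s ?I)" by (rule tup.vs2.subspace_tuple_space[OF sI])
    show "fin_dim (fun_scale (fun_scale s2)) (tuple_space s ?I)" by (rule tup.vs2.fin_dim_tuple_space[OF fI])
    show "inj_on (flat d) (tuple_space s ?I)"
    proof (rule inj_onI)
      fix y z assume yz: "y \<in> tuple_space s ?I" "z \<in> tuple_space s ?I" "flat d y = flat d z"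
      show "y = z"
      proof
        fix c
        show "y c = z c"
        proof (cases "c < s")
          case True
          then have "y c \<in> tuple_space d UNIV" "z c \<in> tuple_space d UNIV"
            using yz I unfolding tuple_space_def[of s] by auto
          then show ?thesis using unflat_flat[OF d] yz(3) by metis
        next
          case False
          then show ?thesis using yz unfolding tuple_space_def[of s] by simp
        qed
      qed
    qed
  qed
  ultimately show ?thesis using tup.vs2.dim_tuple_space[OF sI fI] unfolding rk_def by simp
qed

text \<open>The perturbation lemma wants a single map \<open>B\<close>, but here each step has its
  own \<open>N i\<close>. Placing \<open>x i\<close> in block i cures this:
  \<open>subdiag_blocks\<close> applies \<open>N i\<close> exactly on block i and moves the result
  to block i + 1, where \<open>x (Suc i)\<close> waits.\<close>

lemma chain_increases_rank:
  assumes d: "0 < d" and M: "blocks M" and N: "\<And>c. blocks (N c)"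
    and x: "\<And>i. i \<le> k \<Longrightarrow> x i \<in> tuple_space d D" "block_map d M (x 0) = (\<lambda>_. 0)"
      "\<And>i. i < k \<Longrightarrow> block_map d M (x (Suc i)) = block_map d (N i) (x i)"
    and new: "block_map d (N k) (x k) \<notin> block_map d M ` tuple_space d D"
    and inf: "infinite (UNIV :: 'a set)"
  shows "\<exists>M'. blocks M' \<and> (k + 2) * rk d M < rk (d * (k + 2)) M'"
proof -
  \<comment> \<open>The chain occupies blocks 0 to k, and the escaping vector lands in block k +
    1.\<close>
  let ?s = "k + 2"
  let ?A = "block_map (d * ?s) (diag_blocks d M)" and ?B = "block_map (d * ?s) (subdiag_blocks d N)"
  let ?S = "tuple_space (d * ?s) D"
  have D0: "0 \<in> D" by (rule vs1.subspace_0[OF subspace_D])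
  define e :: "nat \<Rightarrow> (nat \<Rightarrow> 'v) \<Rightarrow> nat \<Rightarrow> 'v" where "e c y = flat d (single c y)" for c y
  have S0: "0 \<in> tuple_space d D" using D0 by (simp add: tuple_space_def)
  have e_in: "e c y \<in> ?S" if "c < ?s" "y \<in> tuple_space d D" for c y
    unfolding e_def by (rule flat_in_tuple_space[OF d single_in_tuple_space[OF that(2) S0 that(1)]])
  have e_un: "unflat d c (e c' y) = (if c = c' then y else (\<lambda>_. 0))"
    if "y \<in> tuple_space d D" for c c' y
  proof -
    have "single c' y c \<in> tuple_space d D" using that S0 by (simp add: single_def)
    then have "unflat d c (e c' y) = single c' y c" unfolding e_def by (rule unflat_flat[OF d])
    then show ?thesis by (simp add: single_def zero_fun_def)
  qed
  have unA: "unflat d c (?A (e c' y)) = (if c = c' then block_map d M y else (\<lambda>_. 0))"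
    if "y \<in> tuple_space d D" "c < ?s" for c c' y
    unfolding unflat_block_map_diag[OF d that(2)] e_un[OF that(1)] using block_map_zero[OF M] by simp
  have unB: "unflat d c (?B (e c' y)) = (if c = Suc c' then block_map d (N c') y else (\<lambda>_. 0))"
    if "y \<in> tuple_space d D" "c < ?s" for c c' y
    unfolding unflat_block_map_subdiag[OF d that(2)] e_un[OF that(1)] using block_map_zero[OF N] by auto
  have "\<exists>t. tup.vs2.dim (?A ` ?S) < tup.vs2.dim ((\<lambda>v. ?A v - fun_scale s2 t (?B v)) ` ?S)"
  proof (rule tup.rank_perturbation[OF linear_blocks[OF blocks_diag[OF M]] linear_blocks[OF blocks_subdiag]
        subspace_tuples fin_dim_tuples _ _ _ _ inf])
    show "blocks (N c)" for c by (rule N)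
    show "e i (x i) \<in> ?S" if "i \<le> k" for i using that by (intro e_in x(1)) auto
    show "?A (e 0 (x 0)) = 0"
    proof (rule tuple_space_eqI[OF d block_map_in_tuple_space])
      show "0 \<in> tuple_space (d * ?s) UNIV" by (simp add: tuple_space_def)
      fix c assume "c < ?s"
      then show "unflat d c (?A (e 0 (x 0))) = unflat d c 0"
        using unA[of "x 0" c 0] x(1)[of 0] x(2) by (simp add: unflat_def zero_fun_def)
    qed
    show "?A (e (Suc i) (x (Suc i))) = ?B (e i (x i))" if "i < k" for i
    proof (rule tuple_space_eqI[OF d block_map_in_tuple_space block_map_in_tuple_space])
      fix c assume "c < ?s"
      then show "unflat d c (?A (e (Suc i) (x (Suc i)))) = unflat d c (?B (e i (x i)))"
        using unA[of "x (Suc i)" c "Suc i"] unB[of "x i" c i] x(1)[of i] x(1)[of "Suc i"] x(3)[OF that] that by simp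
    qed
    show "?B (e k (x k)) \<notin> ?A ` ?S"
    proof
      assume "?B (e k (x k)) \<in> ?A ` ?S"
      then obtain z where z: "z \<in> ?S" "?B (e k (x k)) = ?A z" by blast
      \<comment> \<open>Reading off block k + 1 turns a preimage of the escaping vector under
        \<open>?A\<close> into one under \<open>block_map d M\<close>.\<close>
      have "block_map d (N k) (x k) = unflat d (Suc k) (?A z)"
        using unB[of "x k" "Suc k" k] x(1)[of k] z(2) by simp
      also have "\<dots> = block_map d M (unflat d (Suc k) z)" by (rule unflat_block_map_diag[OF d]) simp
      finally have "block_map d (N k) (x k) = block_map d M (unflat d (Suc k) z)" .
      moreover have "unflat d (Suc k) z \<in> tuple_space d D"
      proof -
        have "z i \<in> D" for i using z(1) D0 unfolding tuple_space_def by (cases "i < d * ?s") auto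
        then show ?thesis by (simp add: unflat_def tuple_space_def)
      qed
      ultimately show False using new by blast
    qed
  qed
  then obtain t where t: "tup.vs2.dim (?A ` ?S) < tup.vs2.dim ((\<lambda>v. ?A v - fun_scale s2 t (?B v)) ` ?S)" ..
  define M' where "M' = (\<lambda>i j v. diag_blocks d M i j v + s2 (- t) (subdiag_blocks d N i j v))"
  have eq: "(\<lambda>v. ?A v - fun_scale s2 t (?B v)) = block_map (d * ?s) M'"
    by (auto simp: fun_eq_iff block_map_def fun_scale_def M'_def sum_subtractf vs2.scale_sum_right)
  have "rk (d * ?s) (diag_blocks d M) < rk (d * ?s) M'" using t unfolding rk_def eq .
  moreover have "blocks M'"
    using blocks_diag[OF M] blocks_subdiag[of N, OF N] add_X scale_X unfolding blocks_def M'_def by blast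
  ultimately show ?thesis using rk_diag_blocks[OF d M, of ?s] by (meson le_less_trans)
qed

text \<open>Members of the Wong sequence that come with one explicit chain of preimages. Linear
  combinations are added only in \<open>shrunk_subspace\<close>, where the span is taken; a single
  chain is what \<open>chain_increases_rank\<close> consumes.\<close>

inductive reach :: "nat \<Rightarrow> (nat \<Rightarrow> nat \<Rightarrow> 'v \<Rightarrow> 'w) \<Rightarrow> (nat \<Rightarrow> 'v) \<Rightarrow> bool" for d M where
  kernel: "x \<in> tuple_space d D \<Longrightarrow> block_map d M x = (\<lambda>_. 0) \<Longrightarrow> reach d M x"
| step: "reach d M x \<Longrightarrow> blocks N \<Longrightarrow> z \<in> tuple_space d D \<Longrightarrow> block_map d M z = block_map d N x \<Longrightarrow> reach d M z"

lemma reach_in_tuple_space: "reach d M x \<Longrightarrow> x \<in> tuple_space d D"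
  by (induction rule: reach.induct) auto

lemma reach_chain:
  "reach d M z \<Longrightarrow> \<exists>k x N. (\<forall>c. blocks (N c)) \<and> (\<forall>i\<le>k. x i \<in> tuple_space d D) \<and>
    block_map d M (x 0) = (\<lambda>_. 0) \<and>
    (\<forall>i<k. block_map d M (x (Suc i)) = block_map d (N i) (x i)) \<and> x k = z"
proof (induction rule: reach.induct)
  case (kernel x)
  have "blocks (\<lambda>_ _ _. 0)" using zero_X by (simp add: blocks_def)
  then show ?case using kernel
    by (intro exI[of _ 0] exI[of _ "\<lambda>_. x"] exI[of _ "\<lambda>_ _ _ _. 0"]) simp
next
  case (step y N0 z)
  then obtain k x N where c: "\<forall>c. blocks (N c)" "\<forall>i\<le>k. x i \<in> tuple_space d D"
    "block_map d M (x 0) = (\<lambda>_. 0)"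
    "\<forall>i<k. block_map d M (x (Suc i)) = block_map d (N i) (x i)" "x k = y" by blast
  show ?case
  proof (intro exI conjI allI impI)
    show "blocks ((N(k := N0)) c)" for c using c(1) step.hyps by simp
    show "(x(Suc k := z)) i \<in> tuple_space d D" if "i \<le> Suc k" for i
      using c(2) step.hyps that by (auto simp: le_Suc_eq)
    show "block_map d M ((x(Suc k := z)) 0) = (\<lambda>_. 0)" using c(3) by simp
    show "block_map d M ((x(Suc k := z)) (Suc i)) = block_map d ((N(k := N0)) i) ((x(Suc k := z)) i)"
      if "i < Suc k" for i
    proof (cases "i = k")
      case True
      then show ?thesis using step.hyps c(5) by simp
    next
      case False
      then show ?thesis using c(4) that by simp
    qed
    show "(x(Suc k := z)) (Suc k) = z" by simp
  qed
qed

text \<open>Otherwise the chain leading to \<open>x\<close>, continued by \<open>N\<close>, would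
  produce a block map of degree \<open>d * (k + 2)\<close> whose rank exceeds
  \<open>(k + 2) * rk d M\<close>, against \<open>max\<close>.\<close>

lemma block_map_reach_in_image:
  assumes d: "0 < d" and M: "blocks M" and max: "\<And>s M'. blocks M' \<Longrightarrow> rk (d * s) M' \<le> s * rk d M"
    and inf: "infinite (UNIV :: 'a set)" and x: "reach d M x" and N: "blocks N"
  shows "block_map d N x \<in> block_map d M ` tuple_space d D"
proof (rule ccontr)
  assume new: "block_map d N x \<notin> block_map d M ` tuple_space d D"
  obtain k y N' where c: "\<forall>c. blocks (N' c)" "\<forall>i\<le>k. y i \<in> tuple_space d D"
    "block_map d M (y 0) = (\<lambda>_. 0)"
    "\<forall>i<k. block_map d M (y (Suc i)) = block_map d (N' i) (y i)" "y k = x"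
    using reach_chain[OF x] by blast
  have "\<exists>M'. blocks M' \<and> (k + 2) * rk d M < rk (d * (k + 2)) M'"
    by (rule chain_increases_rank[OF d M, of "N'(k := N)" k y]) (use c N new inf in auto)
  then show False using max leD by blast
qed

text \<open>The span of the reachable tuples is mapped by every block map into its image under \<open>M\<close>; hence
  the span of their components is a shrunk subspace.\<close>

theorem shrunk_subspace:
  assumes d: "0 < d" and M: "blocks M" and max: "\<And>s M'. blocks M' \<Longrightarrow> rk (d * s) M' \<le> s * rk d M"
    and inf: "infinite (UNIV :: 'a set)"
  shows "\<exists>U. vs1.subspace U \<and> U \<subseteq> D \<and> d * vs1.dim D + d * vs2.dim (action U) \<le> rk d M + d * vs1.dim U"
proof -
  let ?A = "block_map d M" and ?S = "tuple_space d D"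
  let ?N = "tup.vs1.span {x. reach d M x}"
  let ?U = "vs1.span {x a |x a. reach d M x \<and> a < d}"
  note lA = linear_blocks[OF M, of d]
  have sub_AN: "tup.vs2.subspace (?A ` ?N)" by (rule tup.linear_subspace_image[OF lA tup.vs1.subspace_span])
  have NS: "?N \<subseteq> ?S" by (rule tup.vs1.span_minimal[OF _ subspace_tuples]) (use reach_in_tuple_space in auto)
  have UD: "?U \<subseteq> D"
  proof (rule vs1.span_minimal[OF _ subspace_D], clarify)
    fix x a assume "reach d M x" "a < d"
    then show "x a \<in> D" using reach_in_tuple_space[of d M x] unfolding tuple_space_def by simp
  qed
  have NU: "?N \<subseteq> tuple_space d ?U"
  proof (rule tup.vs1.span_minimal[OF _ vs1.subspace_tuple_space[OF vs1.subspace_span]], clarify)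
    fix x assume x: "reach d M x"
    have "x a \<in> ?U" if "a < d" for a using x that by (intro vs1.span_base) blast
    then show "x \<in> tuple_space d ?U"
      using reach_in_tuple_space[OF x] unfolding tuple_space_def by simp
  qed
  \<comment> \<open>The image lies in that of \<open>?N\<close> and not merely of \<open>?S\<close>:
    a preimage of \<open>block_map d N x\<close> is itself reachable.\<close>
  have img: "block_map d N x \<in> ?A ` ?N" if x: "reach d M x" and N: "blocks N" for x N
  proof -
    obtain z where z: "z \<in> ?S" "block_map d N x = ?A z"
      using block_map_reach_in_image[OF d M max inf x N] by blast
    have "reach d M z" by (rule reach.step[OF x N z(1)]) (use z(2) in simp)
    then have "z \<in> ?N" by (intro tup.vs1.span_base) simp
    then show ?thesis using z(2) by simp
  qed
  have act: "single i w \<in> ?A ` ?N" if w: "w \<in> action ?U" and i: "i < d" for i w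
  proof -
    have sW: "vs2.subspace {w. single i w \<in> ?A ` ?N}"
    proof -
      interpret p: vector_space_pair s2 "fun_scale s2 :: 'a \<Rightarrow> (nat \<Rightarrow> 'w) \<Rightarrow> _" ..
      show ?thesis using p.linear_subspace_vimage[OF vs2.linear_single sub_AN] by (simp add: vimage_def)
    qed
    have "{T u |T u. T \<in> X \<and> u \<in> ?U} \<subseteq> {w. single i w \<in> ?A ` ?N}"
    proof clarify
      fix T u assume T: "T \<in> X" and u: "u \<in> ?U"
      have sT: "vs1.subspace {u. T u \<in> {w. single i w \<in> ?A ` ?N}}"
        using linear_subspace_vimage[OF linear_X[OF T] sW] by (simp add: vimage_def)
      have "?U \<subseteq> {u. T u \<in> {w. single i w \<in> ?A ` ?N}}"
      proof (rule vs1.span_minimal[OF _ sT], clarify)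
        fix x a assume x: "reach d M x" and a: "a < d"
        \<comment> \<open>The block map \<open>T \<otimes> E_ia\<close> isolates component a of a
          reachable tuple and puts its image in slot i. This passes from tuples to the components
          spanning \<open>?U\<close>.\<close>
        let ?E = "\<lambda>i' j. if i' = i \<and> j = a then T else (\<lambda>_. 0)"
        have "block_map d ?E x = single i (T (x a))"
        proof
          fix i'
          have "(\<Sum>j<d. ?E i' j (x j)) = (\<Sum>j<d. if j = a then (if i' = i then T (x a) else 0) else 0)"
            by (intro sum.cong) auto
          also have "\<dots> = (if i' = i then T (x a) else 0)" using a by simp
          finally show "block_map d ?E x i' = single i (T (x a)) i'"
            unfolding block_map_def single_def using i by (cases "i' < d") auto
        qed
        moreover have "blocks ?E" using T zero_X by (simp add: blocks_def)
        ultimately show "single i (T (x a)) \<in> ?A ` ?N" using img[OF x] by metis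
      qed
      then show "single i (T u) \<in> ?A ` ?N" using u by blast
    qed
    then have "action ?U \<subseteq> {w. single i w \<in> ?A ` ?N}"
      unfolding action_def by (rule vs2.span_minimal[OF _ sW])
    then show ?thesis using w by blast
  qed
  have "tuple_space d (action ?U) \<subseteq> ?A ` ?N"
  proof
    fix y assume y: "y \<in> tuple_space d (action ?U)"
    have "(\<Sum>i<d. single i (y i)) \<in> ?A ` ?N"
      by (rule tup.vs2.subspace_sum[OF sub_AN]) (use y act in \<open>auto simp: tuple_space_def\<close>)
    then show "y \<in> ?A ` ?N" using tuple_space_eq_sum_single[OF y] by simp
  qed
  moreover have fN: "fin_dim (fun_scale s1) ?N" by (rule tup.vs1.fin_dim_subset[OF fin_dim_tuples NS])
  ultimately have 1: "tup.vs2.dim (tuple_space d (action ?U)) \<le> tup.vs2.dim (?A ` ?N)"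
    by (intro tup.vs2.dim_le_of_subset tup.fin_dim_image[OF lA])
  have fU: "fin_dim s1 ?U" by (rule vs1.fin_dim_subset[OF fin_dim_D UD])
  have 2: "tup.vs1.dim ?N \<le> tup.vs1.dim (tuple_space d ?U)"
    by (rule tup.vs1.dim_le_of_subset[OF NU vs1.fin_dim_tuple_space[OF fU]])
  \<comment> \<open>The whole kernel of \<open>?A\<close> is reachable, so restricting to
    \<open>?N\<close> loses none of it.\<close>
  have "{x \<in> ?S. ?A x = 0} \<subseteq> {x \<in> ?N. ?A x = 0}"
    using reach.kernel[of _ d M] by (auto intro!: tup.vs1.span_base simp: zero_fun_def)
  then have 3: "tup.vs1.dim {x \<in> ?S. ?A x = 0} \<le> tup.vs1.dim {x \<in> ?N. ?A x = 0}"
    by (rule tup.vs1.dim_le_of_subset) (rule tup.vs1.fin_dim_subset[OF fN], auto)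
  have sA: "vs2.subspace (action ?U)" unfolding action_def by (rule vs2.subspace_span)
  \<comment> \<open>Rank-nullity on \<open>?N\<close> bounds \<open>d * dim (action ?U)\<close> by
    \<open>dim ?N - dim ker\<close>; here \<open>dim ?N\<close> is at most
    \<open>d * dim ?U\<close>, and \<open>dim ker\<close> is at least
    \<open>d * dim D - rk d M\<close> by rank-nullity on \<open>?S\<close>.\<close>
  have "d * vs1.dim D + d * vs2.dim (action ?U) \<le> rk d M + d * vs1.dim ?U"
    using 1 2 3 tup.rank_nullity[OF lA subspace_tuples[of d] fin_dim_tuples]
      tup.rank_nullity[OF lA tup.vs1.subspace_span fN]
      vs1.dim_tuple_space[OF vs1.subspace_span fU, of d] vs1.dim_tuple_space[OF subspace_D fin_dim_D, of d]
      vs2.dim_tuple_space[OF sA fin_dim_cod, of d]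
    unfolding rk_def by linarith
  then show ?thesis using UD vs1.subspace_span by blast
qed

end

section \<open>Matrices over a cyclic algebra\<close>

text \<open>\<open>cyc w \<sigma>\<close> is the \<open>\<sigma>\<close>-semilinear cyclic shift on \<open>L\<^sup>d\<close> whose \<open>d\<close>-th power multiplies by \<open>w\<close> when
  \<open>\<sigma>\<close> has order \<open>d\<close>.\<close>

definition cyc :: "nat \<Rightarrow> 'l::field \<Rightarrow> ('l \<Rightarrow> 'l) \<Rightarrow> (nat \<Rightarrow> 'l) \<Rightarrow> nat \<Rightarrow> 'l" where
  "cyc d w \<sigma> x = (\<lambda>i. if i < d then (if i = 0 then w * \<sigma> (x (d - 1)) else \<sigma> (x (i - 1))) else 0)"

lemma cyc_in_tuple_space: "cyc d w \<sigma> x \<in> tuple_space d UNIV"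
  by (simp add: cyc_def tuple_space_def)

text \<open>For \<open>j \<le> d\<close> an entry wraps around at most once, so at most one factor w
  appears. The lemma serves the semilinear shift as well as the linear one, where \<sigma> is the
  identity.\<close>

lemma cyc_funpow:
  assumes w: "\<And>y. \<sigma> (w * y) = w * \<sigma> y" and x: "x \<in> tuple_space d UNIV" and "j \<le> d"
  shows "(cyc d w \<sigma> ^^ j) x i =
    (if i < d then (if j \<le> i then (\<sigma> ^^ j) (x (i - j)) else w * (\<sigma> ^^ j) (x (i + d - j))) else 0)"
  using \<open>j \<le> d\<close>
proof (induction j arbitrary: i)
  case 0
  then show ?case using x by (auto simp: tuple_space_def)
next
  case (Suc j)
  then have IH: "(cyc d w \<sigma> ^^ j) x i =
    (if i < d then (if j \<le> i then (\<sigma> ^^ j) (x (i - j)) else w * (\<sigma> ^^ j) (x (i + d - j))) else 0)" for i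
    by simp
  consider "i \<ge> d" | "i = 0" "0 < d" | i' where "i = Suc i'" "i < d" using not0_implies_Suc by fastforce
  then show ?case
  proof cases
    case 2
    then have "(cyc d w \<sigma> ^^ Suc j) x i = w * \<sigma> ((cyc d w \<sigma> ^^ j) x (d - 1))" by (simp add: cyc_def)
    moreover have "j \<le> d - 1" using Suc.prems by simp
    ultimately show ?thesis using 2 Suc.prems by (simp add: IH)
  next
    case 3
    then have "(cyc d w \<sigma> ^^ Suc j) x i = \<sigma> ((cyc d w \<sigma> ^^ j) x i')" by (simp add: cyc_def)
    moreover have "i' + d - j = i + d - Suc j" using 3 by simp
    ultimately show ?thesis using 3 Suc.prems w by (simp add: IH)
  qed (simp add: cyc_def)
qed

text \<open>In the model, \<open>ord\<close> is the order in w, \<zeta> is a primitive d-th root of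
  unity and u is an eigenvector of \<sigma>. Primitivity enters as \<open>orthogonality\<close>, the
  form in which discrete Fourier inversion uses it.\<close>

locale cyclic_algebra =
  fixes \<sigma> :: "'l::field \<Rightarrow> 'l" and ord :: "'l \<Rightarrow> int" and w u \<zeta> :: 'l and d :: nat
  assumes d: "0 < d"
    and \<sigma>_add: "\<sigma> (x + y) = \<sigma> x + \<sigma> y" and \<sigma>_mult: "\<sigma> (x * y) = \<sigma> x * \<sigma> y"
    and \<sigma>_eq_0: "\<sigma> x = 0 \<longleftrightarrow> x = 0" and ord_\<sigma>: "ord (\<sigma> x) = ord x"
    and ord_mult: "x \<noteq> 0 \<Longrightarrow> y \<noteq> 0 \<Longrightarrow> ord (x * y) = ord x + ord y"
    and ord_add: "x + y \<noteq> 0 \<Longrightarrow> min (ord x) (ord y) \<le> ord (x + y)"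
    and ord_minus: "ord (- x) = ord x"
    and w: "w \<noteq> 0" "ord w = 1" "\<sigma> w = w"
    and u: "u \<noteq> 0" "\<sigma> u = \<zeta> * u"
    and \<zeta>: "\<zeta> \<noteq> 0" "\<sigma> \<zeta> = \<zeta>" "\<zeta> ^ d = 1"
    and orthogonality: "\<And>a b. a < d \<Longrightarrow> b < d \<Longrightarrow>
      (\<Sum>g<d. \<zeta> ^ (a * g) * inverse (\<zeta> ^ (b * g))) = (if a = b then of_nat d else 0)"
    and of_nat_d: "of_nat d \<noteq> (0::'l)"
begin

interpretation L1: vector_space "fun_scale (*) :: 'l \<Rightarrow> (nat \<Rightarrow> 'l) \<Rightarrow> nat \<Rightarrow> 'l"
  by (intro vector_space_fun_scale vector_space_over_itself.vector_space_axioms)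

interpretation L2: vector_space "fun_scale (fun_scale (*)) :: 'l \<Rightarrow> (nat \<Rightarrow> nat \<Rightarrow> 'l) \<Rightarrow> nat \<Rightarrow> nat \<Rightarrow> 'l"
  by (intro vector_space_fun_scale vector_space_over_itself.vector_space_axioms)

abbreviation S :: "(nat \<Rightarrow> 'l) set" where "S \<equiv> tuple_space d UNIV"
abbreviation \<tau> :: "(nat \<Rightarrow> 'l) \<Rightarrow> nat \<Rightarrow> 'l" where "\<tau> \<equiv> cyc d w \<sigma>"

lemma \<sigma>_0: "\<sigma> 0 = 0"
  using \<sigma>_eq_0 by simp

lemma \<sigma>_power: "\<sigma> (x ^ n) = \<sigma> x ^ n"
proof (induction n)
  case 0
  have "\<sigma> 1 * \<sigma> 1 = \<sigma> 1 * 1" using \<sigma>_mult[of 1 1] by simp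
  then show ?case using \<sigma>_eq_0[of 1] by simp
qed (simp add: \<sigma>_mult)

lemma \<sigma>_funpow_eq_0: "(\<sigma> ^^ j) x = 0 \<longleftrightarrow> x = 0"
  by (induction j) (auto simp: \<sigma>_eq_0)

lemma ord_\<sigma>_funpow: "ord ((\<sigma> ^^ j) x) = ord x"
  by (induction j) (auto simp: ord_\<sigma>)

text \<open>The other terms sum to zero or to an element of strictly larger order, so they cannot
  cancel \<open>t i\<close>. The order of 0 is unspecified, which explains the case
  distinctions.\<close>

lemma sum_nonzero_of_unique_ord_min:
  assumes "finite J" "i \<in> J" "t i \<noteq> 0" "\<And>j. j \<in> J \<Longrightarrow> j \<noteq> i \<Longrightarrow> t j \<noteq> 0 \<Longrightarrow> ord (t i) < ord (t j)"
  shows "(\<Sum>j\<in>J. t j) \<noteq> 0"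
proof
  assume 0: "(\<Sum>j\<in>J. t j) = 0"
  have "(\<Sum>j\<in>J'. t j) = 0 \<or> ord (t i) < ord (\<Sum>j\<in>J'. t j)" if "finite J'" "J' \<subseteq> J - {i}" for J'
    using that
  proof (induction J')
    case (insert j J')
    then have j: "t j = 0 \<or> ord (t i) < ord (t j)" using assms(4) by auto
    let ?s = "\<Sum>j\<in>J'. t j"
    have s: "?s = 0 \<or> ord (t i) < ord ?s" using insert by auto
    have "ord (t i) < ord (t j + ?s)" if "t j + ?s \<noteq> 0"
      using s j that ord_add[OF that] by (cases "t j = 0"; cases "?s = 0") auto
    then show ?case using insert.hyps by auto
  qed simp
  then have "(\<Sum>j\<in>J - {i}. t j) = 0 \<or> ord (t i) < ord (\<Sum>j\<in>J - {i}. t j)" using assms(1) by blast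
  moreover have "(\<Sum>j\<in>J - {i}. t j) = - t i" using 0 sum.remove[OF assms(1,2), of t] by (simp add: eq_neg_iff_add_eq_0 add.commute)
  ultimately show False using assms(3) ord_minus[of "t i"] by simp
qed

text \<open>The exponents \<open>d * ord (x i) + i\<close> are pairwise distinct, so no cancellation can occur in a suitable
  coordinate of a linear combination of the shifts of \<open>x\<close>.\<close>

lemma shifts_independent:
  assumes x: "x \<in> S" "x \<noteq> 0"
  shows "indep_family (fun_scale (*)) d (\<lambda>j. (\<tau> ^^ j) x)"
  unfolding indep_family_def
proof (intro allI impI, rule ccontr)
  fix c j0 assume c: "(\<Sum>j<d. fun_scale (*) (c j) ((\<tau> ^^ j) x)) = 0" and j0: "j0 < d" "c j0 \<noteq> 0"
  \<comment> \<open>The order scaled by d, as if the shift had order 1/d. The value at i is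
    congruent to i modulo d, so the minimum over nonzero entries is unique.\<close>
  define v where "v y = (\<lambda>i. int d * ord (y i) + int i)" for y :: "nat \<Rightarrow> 'l"
  have ex: "\<exists>i<d. y i \<noteq> 0 \<and> (\<forall>k<d. y k \<noteq> 0 \<longrightarrow> k \<noteq> i \<longrightarrow> v y i < v y k)"
    if "k < d" "y k \<noteq> 0" for y k
  proof -
    let ?I = "{i. i < d \<and> y i \<noteq> 0}"
    have fin: "finite ?I" "?I \<noteq> {}" using that by auto
    define i where "i = arg_min_on (v y) ?I"
    have i: "i \<in> ?I" unfolding i_def by (rule arg_min_if_finite(1)[OF fin])
    have le: "v y i \<le> v y k" if "k \<in> ?I" for k unfolding i_def by (rule arg_min_least[OF fin that])
    have "v y i \<noteq> v y k" if "k \<in> ?I" "k \<noteq> i" for k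
    proof
      assume "v y i = v y k"
      then have "v y i mod int d = v y k mod int d" by simp
      then have "int i mod int d = int k mod int d" by (simp add: v_def)
      then show False using that i by simp
    qed
    then show ?thesis using i le by (metis (mono_tags, lifting) mem_Collect_eq order_le_less)
  qed
  obtain m where m: "m < d" "c m \<noteq> 0" "\<forall>j<d. c j \<noteq> 0 \<longrightarrow> j \<noteq> m \<longrightarrow> v c m < v c j"
    using ex[of j0 c, OF j0] by blast
  obtain k0 where "x k0 \<noteq> 0" using x(2) by (auto simp: fun_eq_iff)
  then have k0: "k0 < d" "x k0 \<noteq> 0" using x(1) by (auto simp: tuple_space_def not_less[symmetric])
  obtain n where n: "n < d" "x n \<noteq> 0" "\<forall>j<d. x j \<noteq> 0 \<longrightarrow> j \<noteq> n \<longrightarrow> v x n < v x j"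
    using ex[of k0 x, OF k0] by blast
  \<comment> \<open>The m-th shift moves entry n to this coordinate, so the minimal entries of
    \<open>c\<close> and of \<open>x\<close> meet here.\<close>
  define i where "i = (n + m) mod d"
  have i: "i < d" using d by (simp add: i_def)
  define k where "k j = (if j \<le> i then i - j else i + d - j)" for j
  define t where "t j = c j * (\<tau> ^^ j) x i" for j
  have pw: "(\<tau> ^^ j) x i = (if j \<le> i then (\<sigma> ^^ j) (x (k j)) else w * (\<sigma> ^^ j) (x (k j)))" if "j < d" for j
    using cyc_funpow[of \<sigma> w x d j i] x(1) that i \<sigma>_mult w(3) by (simp add: k_def)
  have t0: "t j = 0 \<longleftrightarrow> c j = 0 \<or> x (k j) = 0" if "j < d" for j
    using pw[OF that] w(1) by (simp add: t_def \<sigma>_funpow_eq_0)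
  \<comment> \<open>Without wrapping the two indices add up to i; with wrapping they add up to i +
    d, and the excess d is the contribution of \<open>ord w = 1\<close>. Hence terms are compared by
    \<open>v c j + v x (k j)\<close>.\<close>
  have tv: "int d * ord (t j) + int i = v c j + v x (k j)" if "j < d" "t j \<noteq> 0" for j
  proof (cases "j \<le> i")
    case True
    then show ?thesis using pw[OF that(1)] that t0[OF that(1)]
      by (simp add: t_def ord_mult ord_\<sigma>_funpow \<sigma>_funpow_eq_0 v_def k_def algebra_simps of_nat_diff)
  next
    case False
    then show ?thesis using pw[OF that(1)] that t0[OF that(1)] i w
      by (simp add: t_def ord_mult ord_\<sigma>_funpow \<sigma>_funpow_eq_0 v_def k_def algebra_simps of_nat_diff)
  qed
  have km: "k m = n"
  proof (cases "n + m < d")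
    case True
    then show ?thesis by (simp add: i_def k_def)
  next
    case False
    then have "i = n + m - d" using n(1) m(1) unfolding i_def by (simp add: mod_if)
    then show ?thesis using False n(1) m(1) by (simp add: k_def)
  qed
  have kd: "k j < d" if "j < d" for j using that i by (auto simp: k_def)
  have "(\<Sum>j<d. t j) \<noteq> 0"
  proof (rule sum_nonzero_of_unique_ord_min[of _ m])
    show "t m \<noteq> 0" using t0[OF m(1)] m(2) km n(2) by simp
    fix j assume j: "j \<in> {..<d}" "j \<noteq> m" "t j \<noteq> 0"
    have "v c m < v c j" using m(3) j t0[of j] by auto
    moreover have "v x (k m) \<le> v x (k j)"
      using n(3) kd[of j] j t0[of j] unfolding km by (cases "k j = n") auto
    ultimately have "int d * ord (t m) < int d * ord (t j)"
      using tv[of m, OF m(1) \<open>t m \<noteq> 0\<close>] tv[of j, OF _ j(3)] j(1)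
      unfolding lessThan_iff by linarith
    then show "ord (t m) < ord (t j)" using d by simp
  qed (use m in auto)
  moreover have "(\<Sum>j<d. t j) = 0"
    using fun_cong[OF c, of i] by (simp add: sum_fun_apply fun_scale_def t_def)
  ultimately show False by simp
qed

lemma L_fin_dim: "fin_dim ((*) :: 'l \<Rightarrow> 'l \<Rightarrow> 'l) A"
  unfolding fin_dim_def
proof (intro exI conjI)
  show "A \<subseteq> vector_space_over_itself.span {1}"
    using vector_space_over_itself.span_scale[OF vector_space_over_itself.span_base[of 1 "{1}"]] by auto
qed simp

lemma L_dim: "vector_space_over_itself.dim UNIV = 1"
proof (rule vector_space_over_itself.dim_unique[of "{1}"])
  show "UNIV \<subseteq> vector_space_over_itself.span {1}"
    using vector_space_over_itself.span_scale[OF vector_space_over_itself.span_base[of 1 "{1}"]] by auto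
qed auto

lemma S_fin_dim: "fin_dim (fun_scale (*)) S" and S_subspace: "L1.subspace S" and S_dim: "L1.dim S = d"
  using vector_space_over_itself.fin_dim_tuple_space[OF L_fin_dim] vector_space_over_itself.subspace_tuple_space[OF vector_space_over_itself.subspace_UNIV]
    vector_space_over_itself.dim_tuple_space[OF vector_space_over_itself.subspace_UNIV L_fin_dim] L_dim by auto

text \<open>A nonzero vector of \<open>N\<close> brings along its d shifts, which are independent
  and already fill the d-dimensional space \<open>S\<close>.\<close>

lemma invariant_subspace_dim:
  assumes N: "L1.subspace N" "N \<subseteq> S" "\<And>x. x \<in> N \<Longrightarrow> \<tau> x \<in> N"
  shows "L1.dim N = 0 \<or> L1.dim N = d"
proof (cases "N \<subseteq> {0}")
  case True
  then show ?thesis using L1.dim_le_card[of N "{}"] by auto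
next
  case False
  then obtain x where x: "x \<in> N" "x \<noteq> 0" by blast
  have "(\<tau> ^^ j) x \<in> N" for j by (induction j) (auto simp: x N(3))
  then have "d \<le> L1.dim N"
    using L1.indep_family_le_dim[OF shifts_independent[of x]] x N(2) L1.fin_dim_subset[OF S_fin_dim N(2)] by blast
  moreover have "L1.dim N \<le> d" using L1.dim_le_of_subset[OF N(2) S_fin_dim] S_dim by simp
  ultimately show ?thesis by simp
qed

text \<open>Projecting to the last coordinate splits \<open>N\<close> into an invariant subspace of
  \<open>S\<close> and an invariant kernel with one coordinate fewer; dimensions add by
  rank-nullity.\<close>

lemma dvd_dim_invariant_subspace:
  assumes "L2.subspace N" "N \<subseteq> tuple_space q S" "\<And>y. y \<in> N \<Longrightarrow> (\<lambda>j. \<tau> (y j)) \<in> N"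
  shows "d dvd L2.dim N"
  using assms
proof (induction q arbitrary: N)
  case 0
  then have "N \<subseteq> {0}" by (auto simp: tuple_space_def fun_eq_iff)
  then show ?case using L2.dim_le_card[of N "{}"] by auto
next
  case (Suc q)
  interpret p: vector_space_pair "fun_scale (fun_scale (*)) :: 'l \<Rightarrow> (nat \<Rightarrow> nat \<Rightarrow> 'l) \<Rightarrow> nat \<Rightarrow> nat \<Rightarrow> 'l"
    "fun_scale (*) :: 'l \<Rightarrow> (nat \<Rightarrow> 'l) \<Rightarrow> nat \<Rightarrow> 'l" ..
  let ?f = "\<lambda>y :: nat \<Rightarrow> nat \<Rightarrow> 'l. y q"
  have f: "Vector_Spaces.linear (fun_scale (fun_scale (*))) (fun_scale (*)) ?f" by (rule L1.linear_component)
  have fd: "fin_dim (fun_scale (fun_scale (*))) N"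
    by (rule L2.fin_dim_subset[OF L1.fin_dim_tuple_space[OF S_fin_dim] Suc.prems(2)])
  let ?K = "{y \<in> N. y q = 0}"
  have "d dvd L2.dim ?K"
  proof (rule Suc.IH)
    show "L2.subspace ?K"
      using L2.subspace_inter[OF Suc.prems(1) p.linear_subspace_kernel[OF f]] by (simp add: Int_def)
    show "?K \<subseteq> tuple_space q S"
    proof clarify
      fix y assume y: "y \<in> N" "y q = 0"
      then have "y \<in> tuple_space (Suc q) S" using Suc.prems(2) by blast
      then have "y i = 0" if "q \<le> i" for i
        using that y(2) unfolding tuple_space_def[of "Suc q"] by (cases "i = q") auto
      then show "y \<in> tuple_space q S"
        using \<open>y \<in> tuple_space (Suc q) S\<close> unfolding tuple_space_def[of "Suc q"] tuple_space_def[of q] by auto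
    qed
    have "\<tau> 0 = 0" by (auto simp: cyc_def \<sigma>_0 fun_eq_iff)
    then show "(\<lambda>j. \<tau> (y j)) \<in> ?K" if "y \<in> ?K" for y using that Suc.prems(3) by simp
  qed
  moreover have "d dvd L1.dim (?f ` N)"
  proof -
    have "L1.dim (?f ` N) = 0 \<or> L1.dim (?f ` N) = d"
    proof (rule invariant_subspace_dim)
      show "L1.subspace (?f ` N)" by (rule p.linear_subspace_image[OF f Suc.prems(1)])
      show "?f ` N \<subseteq> S" using Suc.prems(2) unfolding tuple_space_def[of "Suc q"] by auto
      show "\<tau> x \<in> ?f ` N" if "x \<in> ?f ` N" for x using that Suc.prems(3) by force
    qed
    then show ?thesis by auto
  qed
  ultimately show ?case using p.rank_nullity[OF f Suc.prems(1) fd] by simp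
qed

text \<open>The entries of the basis \<open>diag (\<sigma>\<^sup>a u\<^sup>g) S\<^sub>w\<^sup>h\<close> of the cyclic algebra.\<close>

definition basis_mat :: "nat \<Rightarrow> nat \<Rightarrow> nat \<Rightarrow> nat \<Rightarrow> 'l" where
  "basis_mat g h a c = \<zeta> ^ (a * g) * u ^ g * (if c + h = a then 1 else if c + h = a + d then w else 0)"

definition alg_mat :: "(nat \<Rightarrow> nat \<Rightarrow> 'l) \<Rightarrow> nat \<Rightarrow> nat \<Rightarrow> 'l" where
  "alg_mat t a c = (\<Sum>g<d. \<Sum>h<d. t g h * basis_mat g h a c)"

text \<open>The index h selects a cyclic diagonal. Along it the matrices with varying g have entries
  \<open>\<zeta> ^ (a * g) * u ^ g\<close>, so finding coefficients is a discrete Fourier inversion.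
  The coefficients range over all of L here.\<close>

lemma alg_mat_surj: "\<exists>t. \<forall>a<d. \<forall>c<d. alg_mat t a c = T a c"
proof -
  \<comment> \<open>Row a of the h-th cyclic diagonal of \<open>T\<close>, with the factor w of
    wrapped positions removed.\<close>
  define R where "R h a = (if h \<le> a then T a (a - h) else T a (a + d - h) * inverse w)" for h a
  define t where "t g h = inverse (of_nat d) * inverse (u ^ g) * (\<Sum>b<d. inverse (\<zeta> ^ (b * g)) * R h b)" for g h
  have "alg_mat t a c = T a c" if ac: "a < d" "c < d" for a c
  proof -
    define h0 where "h0 = (if c \<le> a then a - c else a + d - c)"
    have h0: "h0 < d" using ac by (auto simp: h0_def)
    have uniq: "h = h0" if "h < d" "c + h = a \<or> c + h = a + d" for h
      using that ac by (auto simp: h0_def)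
    let ?e = "if c + h0 = a then 1 else w"
    have eq: "c + h0 = a \<or> c + h0 = a + d" using ac by (auto simp: h0_def)
    have Re: "R h0 a * ?e = T a c" using ac w(1) by (auto simp: R_def h0_def)
    have "alg_mat t a c = (\<Sum>g<d. \<Sum>h<d. if h = h0 then t g h0 * (\<zeta> ^ (a * g) * u ^ g * ?e) else 0)"
      unfolding alg_mat_def
    proof (intro sum.cong refl)
      fix g h assume h: "h \<in> {..<d}"
      show "t g h * basis_mat g h a c = (if h = h0 then t g h0 * (\<zeta> ^ (a * g) * u ^ g * ?e) else 0)"
      proof (cases "h = h0")
        case True
        have "basis_mat g h0 a c = \<zeta> ^ (a * g) * u ^ g * ?e" using eq unfolding basis_mat_def by presburger
        then show ?thesis using True by simp
      next
        case False
        then have "c + h \<noteq> a" "c + h \<noteq> a + d" using uniq[of h] h by blast+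
        then show ?thesis using False by (simp add: basis_mat_def)
      qed
    qed
    also have "\<dots> = (\<Sum>g<d. t g h0 * (\<zeta> ^ (a * g) * u ^ g * ?e))" using h0 by simp
    also have "\<dots> = (\<Sum>g<d. \<Sum>b<d. (inverse (of_nat d) * ?e * R h0 b) * (\<zeta> ^ (a * g) * inverse (\<zeta> ^ (b * g))))"
    proof (rule sum.cong[OF refl])
      fix g
      have "t g h0 * (\<zeta> ^ (a * g) * u ^ g * ?e)
        = (inverse (u ^ g) * u ^ g) * (inverse (of_nat d) * ?e * \<zeta> ^ (a * g)) * (\<Sum>b<d. inverse (\<zeta> ^ (b * g)) * R h0 b)"
        unfolding t_def by (simp only: mult_ac)
      also have "inverse (u ^ g) * u ^ g = 1" using u(1) by simp
      finally show "t g h0 * (\<zeta> ^ (a * g) * u ^ g * ?e)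
        = (\<Sum>b<d. (inverse (of_nat d) * ?e * R h0 b) * (\<zeta> ^ (a * g) * inverse (\<zeta> ^ (b * g))))"
        by (simp only: mult_1_left sum_distrib_left mult_ac)
    qed
    also have "\<dots> = (\<Sum>b<d. (inverse (of_nat d) * ?e * R h0 b) * (\<Sum>g<d. \<zeta> ^ (a * g) * inverse (\<zeta> ^ (b * g))))"
      by (subst sum.swap) (simp only: sum_distrib_left)
    also have "\<dots> = (\<Sum>b<d. if b = a then (inverse (of_nat d) * ?e * R h0 a) * of_nat d else 0)"
      using orthogonality[OF ac(1)] by (intro sum.cong) auto
    also have "\<dots> = (inverse (of_nat d) * ?e * R h0 a) * of_nat d" using ac by simp
    also have "\<dots> = (inverse (of_nat d) * of_nat d) * (R h0 a * ?e)" by (simp only: mult_ac)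
    also have "\<dots> = T a c" using of_nat_d Re by simp
    finally show ?thesis .
  qed
  then show ?thesis by blast
qed

definition mat_op :: "(nat \<Rightarrow> nat \<Rightarrow> 'l) \<Rightarrow> (nat \<Rightarrow> 'l) \<Rightarrow> nat \<Rightarrow> 'l" where
  "mat_op B x = (\<lambda>a. if a < d then \<Sum>c<d. B a c * x c else 0)"

lemma mat_op_basis_mat:
  assumes x: "x \<in> S" and h: "h < d"
  shows "mat_op (basis_mat g h) x
    = (\<lambda>a. if a < d then \<zeta> ^ (a * g) * u ^ g * (cyc d w (\<lambda>y. y) ^^ h) x a else 0)"
proof
  fix a
  have pw: "((\<lambda>y. y :: 'l) ^^ h) = (\<lambda>y. y)" by (induction h) auto
  show "mat_op (basis_mat g h) x a
    = (if a < d then \<zeta> ^ (a * g) * u ^ g * (cyc d w (\<lambda>y. y) ^^ h) x a else 0)"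
  proof (cases "a < d")
    case True
    define c0 where "c0 = (if h \<le> a then a - h else a + d - h)"
    have c0: "c0 < d" using True h by (auto simp: c0_def)
    have "mat_op (basis_mat g h) x a
      = (\<Sum>c<d. if c = c0 then \<zeta> ^ (a * g) * u ^ g * (if h \<le> a then 1 else w) * x c0 else 0)"
    proof -
      have "basis_mat g h a c * x c = (if c = c0 then \<zeta> ^ (a * g) * u ^ g * (if h \<le> a then 1 else w) * x c0 else 0)"
        if "c < d" for c
        using True h that by (auto simp: basis_mat_def c0_def)
      then show ?thesis unfolding mat_op_def using True by simp
    qed
    also have "\<dots> = \<zeta> ^ (a * g) * u ^ g * (if h \<le> a then 1 else w) * x c0" using c0 by simp
    also have "\<dots> = \<zeta> ^ (a * g) * u ^ g * (cyc d w (\<lambda>y. y) ^^ h) x a"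
      using cyc_funpow[of "\<lambda>y. y" w x d h a] x h True by (simp add: c0_def pw)
    finally show ?thesis using True by simp
  qed (simp add: mat_op_def)
qed

lemma \<tau>_shift: "\<tau> (cyc d w (\<lambda>y. y) x) = cyc d w (\<lambda>y. y) (\<tau> x)"
  by (auto simp: cyc_def fun_eq_iff \<sigma>_mult w \<sigma>_0)

lemma \<tau>_shift_funpow: "\<tau> ((cyc d w (\<lambda>y. y) ^^ h) x) = (cyc d w (\<lambda>y. y) ^^ h) (\<tau> x)"
  by (induction h) (auto simp: \<tau>_shift)

text \<open>Applying \<sigma> to the diagonal entry \<open>\<zeta> ^ (b * g) * u ^ g\<close> gives
  the entry one row further down, which is where \<tau> puts it; at the wrap
  \<open>\<zeta> ^ (d * g) = 1\<close> closes the cycle. The linear shift commutes with \<tau>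
  because \<sigma> fixes w.\<close>

lemma \<tau>_mat_op_basis_mat:
  assumes x: "x \<in> S" and h: "h < d"
  shows "\<tau> (mat_op (basis_mat g h) x) = mat_op (basis_mat g h) (\<tau> x)"
proof
  fix a
  define y where "y = (cyc d w (\<lambda>y. y) ^^ h) x"
  have 1: "mat_op (basis_mat g h) x = (\<lambda>a. if a < d then \<zeta> ^ (a * g) * u ^ g * y a else 0)"
    unfolding y_def by (rule mat_op_basis_mat[OF x h])
  have 2: "mat_op (basis_mat g h) (\<tau> x) = (\<lambda>a. if a < d then \<zeta> ^ (a * g) * u ^ g * \<tau> y a else 0)"
    unfolding y_def \<tau>_shift_funpow by (rule mat_op_basis_mat[OF cyc_in_tuple_space h])
  consider "a \<ge> d" | "a = 0" | b where "a = Suc b" "a < d" using not0_implies_Suc by fastforce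
  then show "\<tau> (mat_op (basis_mat g h) x) a = mat_op (basis_mat g h) (\<tau> x) a"
  proof cases
    case 2
    have "\<zeta> ^ ((d - 1) * g) * \<zeta> ^ g = \<zeta> ^ ((d - 1) * g + g)" by (simp only: power_add)
    also have "(d - 1) * g + g = d * g" using d by (cases d) auto
    also have "\<zeta> ^ (d * g) = 1" using \<zeta>(3) by (simp add: power_mult)
    finally have "\<zeta> ^ ((d - 1) * g) * (\<zeta> * u) ^ g = u ^ g"
      by (simp add: power_mult_distrib mult.assoc[symmetric])
    then have "\<sigma> (\<zeta> ^ ((d - 1) * g) * u ^ g * y (d - 1)) = u ^ g * \<sigma> (y (d - 1))"
      by (simp only: \<sigma>_mult \<sigma>_power \<zeta>(2) u(2))
    then show ?thesis
      using 2 d unfolding 1 \<open>mat_op (basis_mat g h) (\<tau> x) = _\<close> by (simp add: cyc_def)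
  next
    case 3
    have "\<zeta> ^ (b * g) * (\<zeta> * u) ^ g = \<zeta> ^ (Suc b * g) * u ^ g"
      by (simp add: power_mult_distrib power_add)
    then have "\<sigma> (\<zeta> ^ (b * g) * u ^ g * y b) = \<zeta> ^ (Suc b * g) * u ^ g * \<sigma> (y b)"
      by (simp only: \<sigma>_mult \<sigma>_power \<zeta>(2) u(2))
    then show ?thesis using 3 unfolding 1 2 by (simp add: cyc_def)
  qed (simp add: cyc_def mat_op_def)
qed

end

section \<open>The rank of a blow-up can be rounded up to a multiple of its degree\<close>

definition blow ::
  "nat \<Rightarrow> nat \<Rightarrow> nat \<Rightarrow> (nat \<Rightarrow> nat \<Rightarrow> nat \<Rightarrow> 'l::field) \<Rightarrow> (nat \<Rightarrow> nat \<Rightarrow> nat \<Rightarrow> 'l)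
    \<Rightarrow> (nat \<Rightarrow> nat \<Rightarrow> 'l) \<Rightarrow> nat \<Rightarrow> nat \<Rightarrow> 'l" where
  "blow q m d A T x i a = (\<Sum>j<q. \<Sum>c<d. (\<Sum>l<m. A l i j * T l a c) * x j c)"

text \<open>The numbers \<open>y_\<alpha> (\<Sum> A_l \<otimes> T_l) x_\<beta>\<close> in
  coordinates. A nonzero k by k determinant certifies rank at least k, and the formula is polynomial
  in the entries of T, x and y, so it makes sense over both fields.\<close>

definition gram ::
  "nat \<Rightarrow> nat \<Rightarrow> nat \<Rightarrow> nat \<Rightarrow> (nat \<Rightarrow> nat \<Rightarrow> nat \<Rightarrow> 'l::field) \<Rightarrow> (nat \<Rightarrow> nat \<Rightarrow> nat \<Rightarrow> 'l)
    \<Rightarrow> (nat \<Rightarrow> nat \<Rightarrow> nat \<Rightarrow> 'l) \<Rightarrow> (nat \<Rightarrow> nat \<Rightarrow> nat \<Rightarrow> 'l) \<Rightarrow> nat \<Rightarrow> nat \<Rightarrow> 'l" where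
  "gram p q m d A T x y \<alpha> \<beta> = (\<Sum>i<p. \<Sum>a<d. y \<alpha> i a * blow q m d A T (x \<beta>) i a)"

lemma ndet_gram_cong:
  assumes "\<And>l a c. l < m \<Longrightarrow> a < d \<Longrightarrow> c < d \<Longrightarrow> T l a c = T' l a c"
    and "\<And>\<beta> j c. \<beta> < k \<Longrightarrow> j < q \<Longrightarrow> c < d \<Longrightarrow> x \<beta> j c = x' \<beta> j c"
    and "\<And>\<alpha> i a. \<alpha> < k \<Longrightarrow> i < p \<Longrightarrow> a < d \<Longrightarrow> y \<alpha> i a = y' \<alpha> i a"
  shows "ndet k (gram p q m d A T x y) = ndet k (gram p q m d A T' x' y')"
  unfolding gram_def blow_def
  by (intro ndet_cong sum.cong refl arg_cong2[of _ _ _ _ "(*)"]) (use assms in auto)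

lemma hom_ndet_gram:
  fixes A :: "nat \<Rightarrow> nat \<Rightarrow> nat \<Rightarrow> 'f::field"
  assumes "comm_ring_hom (\<iota> :: 'f \<Rightarrow> 'l::field)"
  shows "\<iota> (ndet k (gram p q m d A T x y)) = ndet k (gram p q m d (\<lambda>l i j. \<iota> (A l i j))
    (\<lambda>l a c. \<iota> (T l a c)) (\<lambda>\<beta> j c. \<iota> (x \<beta> j c)) (\<lambda>\<alpha> i a. \<iota> (y \<alpha> i a)))"
proof -
  interpret i: comm_ring_hom \<iota> by (rule assms)
  show ?thesis
    unfolding i.hom_ndet gram_def blow_def by (simp add: i.hom_sum i.hom_mult)
qed

section \<open>Rounding up over L and descent to the ground field\<close>

context cyclic_algebra begin

interpretation L1: vector_space "fun_scale (*) :: 'l \<Rightarrow> (nat \<Rightarrow> 'l) \<Rightarrow> nat \<Rightarrow> 'l"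
  by (intro vector_space_fun_scale vector_space_over_itself.vector_space_axioms)

interpretation L2: vector_space "fun_scale (fun_scale (*)) :: 'l \<Rightarrow> (nat \<Rightarrow> nat \<Rightarrow> 'l) \<Rightarrow> nat \<Rightarrow> nat \<Rightarrow> 'l"
  by (intro vector_space_fun_scale vector_space_over_itself.vector_space_axioms)

interpretation P: vector_space_pair "fun_scale (fun_scale (*)) :: 'l \<Rightarrow> (nat \<Rightarrow> nat \<Rightarrow> 'l) \<Rightarrow> nat \<Rightarrow> nat \<Rightarrow> 'l"
  "fun_scale (fun_scale (*)) :: 'l \<Rightarrow> (nat \<Rightarrow> nat \<Rightarrow> 'l) \<Rightarrow> nat \<Rightarrow> nat \<Rightarrow> 'l" ..

lemma \<tau>_zero: "\<tau> 0 = 0"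
  by (auto simp: cyc_def fun_eq_iff \<sigma>_0)

lemma \<tau>_add: "\<tau> (x + y) = \<tau> x + \<tau> y"
  by (auto simp: cyc_def fun_eq_iff \<sigma>_add algebra_simps)

lemma \<tau>_sum: "\<tau> (\<Sum>k\<in>K. f k) = (\<Sum>k\<in>K. \<tau> (f k))"
  by (induction K rule: infinite_finite_induct) (simp_all only: sum.infinite sum.empty sum.insert \<tau>_zero \<tau>_add not_False_eq_True)

text \<open>The commutant of \<tau>. As \<tau> is only semilinear, closure under scalars is shown
  just for those fixed by \<sigma>.\<close>

definition twisted :: "(nat \<Rightarrow> nat \<Rightarrow> 'l) \<Rightarrow> bool" where
  "twisted B \<longleftrightarrow> (\<forall>x\<in>S. \<tau> (mat_op B x) = mat_op B (\<tau> x))"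

lemma twisted_basis_mat: "h < d \<Longrightarrow> twisted (basis_mat g h)"
  unfolding twisted_def using \<tau>_mat_op_basis_mat by blast

lemma twisted_sum:
  assumes "\<And>k. k \<in> K \<Longrightarrow> twisted (B k)"
  shows "twisted (\<lambda>a c. \<Sum>k\<in>K. B k a c)"
proof -
  have eq: "mat_op (\<lambda>a c. \<Sum>k\<in>K. B k a c) x = (\<Sum>k\<in>K. mat_op (B k) x)" for x
    by (auto simp: mat_op_def fun_eq_iff sum_fun_apply sum_distrib_right intro: sum.swap)
  show ?thesis unfolding twisted_def eq \<tau>_sum
    using assms by (auto simp: twisted_def intro!: sum.cong)
qed

lemma twisted_mult:
  assumes "\<sigma> s = s" "twisted B"
  shows "twisted (\<lambda>a c. s * B a c)"
proof -
  have eq: "mat_op (\<lambda>a c. s * B a c) x = (\<lambda>a. s * mat_op B x a)" for x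
    by (auto simp: mat_op_def fun_eq_iff sum_distrib_left mult.assoc)
  have "\<tau> (\<lambda>a. s * z a) = (\<lambda>a. s * \<tau> z a)" for z
    using assms(1) by (auto simp: cyc_def fun_eq_iff \<sigma>_mult)
  then show ?thesis using assms(2) unfolding twisted_def eq by simp
qed

lemma twisted_alg_mat:
  assumes "\<And>g h. \<sigma> (t g h) = t g h"
  shows "twisted (alg_mat t)"
  unfolding alg_mat_def by (intro twisted_sum twisted_mult twisted_basis_mat assms) simp

text \<open>The kernel is \<tau>-invariant, so d divides its dimension; d also divides the dimension
  \<open>q * d\<close> of the domain and therefore the rank. A rank above \<open>d * r\<close> is
  thus at least \<open>d * Suc r\<close>.\<close>

lemma gram_round_up:
  fixes A :: "nat \<Rightarrow> nat \<Rightarrow> nat \<Rightarrow> 'l"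
  assumes A: "\<And>l i j. \<sigma> (A l i j) = A l i j" and T: "\<And>l. twisted (T l)"
    and nz: "ndet k (gram p q m d A T x y) \<noteq> 0" and k: "d * r < k"
  shows "\<exists>x y. ndet (d * Suc r) (gram p q m d A T x y) \<noteq> 0"
proof -
  define op :: "(nat \<Rightarrow> nat \<Rightarrow> 'l) \<Rightarrow> nat \<Rightarrow> nat \<Rightarrow> 'l"
    where "op z = (\<lambda>i a. if i < p \<and> a < d then blow q m d A T z i a else 0)" for z
  let ?D = "tuple_space q S"
  have op: "Vector_Spaces.linear (fun_scale (fun_scale (*))) (fun_scale (fun_scale (*))) op"
    unfolding Vector_Spaces.linear_iff
    by (auto simp: L2.vector_space_axioms op_def fun_scale_def fun_eq_iff blow_def
        sum.distrib[symmetric] sum_distrib_left algebra_simps intro!: sum.cong)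
  have sD: "L2.subspace ?D" by (rule L1.subspace_tuple_space[OF S_subspace])
  have fD: "fin_dim (fun_scale (fun_scale (*))) ?D" by (rule L1.fin_dim_tuple_space[OF S_fin_dim])
  have op_\<tau>: "op (\<lambda>j. \<tau> (z j)) = (\<lambda>i. \<tau> (op z i))" if z: "z \<in> ?D" for z
  proof
    fix i
    define B where "B j a c = (\<Sum>l<m. A l i j * T l a c)" for j a c
    have B: "twisted (B j)" for j unfolding B_def by (intro twisted_sum twisted_mult A T)
    show "op (\<lambda>j. \<tau> (z j)) i = \<tau> (op z i)"
    proof (cases "i < p")
      case True
      have eq: "op z' i = (\<Sum>j<q. mat_op (B j) (z' j))" for z'
        using True by (auto simp: op_def blow_def B_def mat_op_def fun_eq_iff sum_fun_apply)
      have "\<tau> (op z i) = (\<Sum>j<q. \<tau> (mat_op (B j) (z j)))" unfolding eq \<tau>_sum ..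
      also have "\<dots> = (\<Sum>j<q. mat_op (B j) (\<tau> (z j)))"
        using B z by (intro sum.cong refl) (auto simp: twisted_def tuple_space_def[of q])
      also have "\<dots> = op (\<lambda>j. \<tau> (z j)) i" unfolding eq ..
      finally show ?thesis by simp
    next
      case False
      then show ?thesis using \<tau>_zero by (simp add: op_def zero_fun_def)
    qed
  qed
  let ?N = "{z \<in> ?D. op z = 0}"
  have dN: "d dvd L2.dim ?N"
  proof (rule dvd_dim_invariant_subspace)
    show "L2.subspace ?N"
      using L2.subspace_inter[OF sD P.linear_subspace_kernel[OF op]] by (simp add: Int_def)
    show "?N \<subseteq> ?D" by blast
    fix z assume z: "z \<in> ?N"
    then have "(\<lambda>j. \<tau> (z j)) \<in> ?D"
      using cyc_in_tuple_space \<tau>_zero by (auto simp: tuple_space_def[of q])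
    moreover have "op (\<lambda>j. \<tau> (z j)) = 0"
    proof
      fix i
      have "op z i = 0" using z by simp
      then show "op (\<lambda>j. \<tau> (z j)) i = 0 i" using op_\<tau>[of z] z \<tau>_zero by simp
    qed
    ultimately show "(\<lambda>j. \<tau> (z j)) \<in> ?N" by simp
  qed
  have "L2.dim ?D = q * d" using L1.dim_tuple_space[OF S_subspace S_fin_dim] S_dim by simp
  then have "d dvd L2.dim (op ` ?D) + L2.dim ?N"
    unfolding P.rank_nullity[OF op sD fD] by (simp only: dvd_triv_right)
  then have "d dvd L2.dim (op ` ?D)" unfolding dvd_add_left_iff[OF dN] .
  moreover have "k \<le> L2.dim (op ` ?D)"
  proof -
    define x' where "x' \<beta> = (\<lambda>j c. if j < q \<and> c < d then x \<beta> j c else 0)" for \<beta>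
    define g where "g \<alpha> z = (\<Sum>i<p. \<Sum>a<d. y \<alpha> i a * z i a)" for \<alpha> and z :: "nat \<Rightarrow> nat \<Rightarrow> 'l"
    have "functional (fun_scale (fun_scale (*))) (g \<alpha>)" for \<alpha>
      unfolding Vector_Spaces.linear_iff
      by (simp add: L2.vector_space_axioms vector_space_over_itself.vector_space_axioms g_def fun_scale_def
          sum.distrib sum_distrib_left distrib_left mult.left_commute)
    moreover have "gram p q m d A T x y \<alpha> \<beta> = g \<alpha> (op (x' \<beta>))" for \<alpha> \<beta>
      unfolding gram_def g_def op_def blow_def x'_def by simp
    ultimately have "indep_family (fun_scale (fun_scale (*))) k (\<lambda>\<beta>. op (x' \<beta>))"
      using nz by (intro L2.indep_family_of_ndet[where g = g]) (auto cong: ndet_cong)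
    moreover have "x' \<beta> \<in> ?D" for \<beta> by (auto simp: x'_def tuple_space_def fun_eq_iff)
    ultimately show ?thesis
      by (intro L2.indep_family_le_dim[of k "\<lambda>\<beta>. op (x' \<beta>)"] P.fin_dim_image[OF op fD]) auto
  qed
  ultimately have ge: "d * Suc r \<le> L2.dim (op ` ?D)"
  proof -
    assume "d dvd L2.dim (op ` ?D)" "k \<le> L2.dim (op ` ?D)"
    then obtain e where e: "L2.dim (op ` ?D) = d * e" by (auto elim: dvdE)
    then have "d * r < d * e" using k \<open>k \<le> L2.dim (op ` ?D)\<close> by linarith
    then have "Suc r \<le> e" using d by simp
    then show ?thesis unfolding e by (rule mult_le_mono2)
  qed
  obtain z where z: "indep_family (fun_scale (fun_scale (*))) (L2.dim (op ` ?D)) z"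
    "\<forall>j<L2.dim (op ` ?D). z j \<in> op ` ?D" "op ` ?D \<subseteq> L2.span (z ` {..<L2.dim (op ` ?D)})"
    using L2.indep_family_basis[OF P.fin_dim_image[OF op fD]] .
  let ?k = "d * Suc r"
  have "\<forall>\<beta>. \<exists>x. \<beta> < ?k \<longrightarrow> z \<beta> = op x" using z(2) ge by (metis imageE less_le_trans)
  then obtain x' where x': "\<forall>\<beta>. \<beta> < ?k \<longrightarrow> z \<beta> = op (x' \<beta>)" by (rule choice[THEN exE])
  obtain g where g: "\<forall>\<alpha>. functional (fun_scale (fun_scale (*))) (g \<alpha>)"
    "\<forall>\<alpha><?k. \<forall>\<beta><?k. g \<alpha> (z \<beta>) = (if \<alpha> = \<beta> then 1 else 0)"
    using L2.indep_family_dual[OF L2.indep_family_mono[OF z(1) ge]] .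
  interpret G: vector_space_pair "fun_scale (fun_scale (*)) :: 'l \<Rightarrow> (nat \<Rightarrow> nat \<Rightarrow> 'l) \<Rightarrow> nat \<Rightarrow> nat \<Rightarrow> 'l"
    "(*) :: 'l \<Rightarrow> 'l \<Rightarrow> 'l" by (rule L2.functional_pair)
  \<comment> \<open>The values of the dual functionals on unit vectors are the coordinates that turn
    them into rows for \<open>gram\<close>.\<close>
  define y' where "y' \<alpha> i a = g \<alpha> (single i (single a 1))" for \<alpha> i a
  have "gram p q m d A T x' y' \<alpha> \<beta> = g \<alpha> (op (x' \<beta>))" for \<alpha> \<beta>
  proof -
    let ?v = "op (x' \<beta>)"
    have "?v = (\<Sum>i<p. \<Sum>a<d. fun_scale (fun_scale (*)) (?v i a) (single i (single a 1)))"
    proof (intro ext)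
      fix i a
      have "(\<Sum>i'<p. \<Sum>a'<d. fun_scale (fun_scale (*)) (?v i' a') (single i' (single a' 1))) i a
        = (\<Sum>i'<p. if i' = i then (\<Sum>a'<d. if a' = a then ?v i a else 0) else 0)"
      proof -
        have "(\<Sum>a'<d. fun_scale (fun_scale (*)) (?v i' a') (single i' (single a' 1)) i a)
          = (if i' = i then (\<Sum>a'<d. if a' = a then ?v i a else 0) else 0)" for i'
        proof (cases "i' = i")
          case True
          have "(\<Sum>a'<d. fun_scale (fun_scale (*)) (?v i' a') (single i' (single a' 1)) i a)
            = (\<Sum>a'<d. if a' = a then ?v i a else 0)"
            by (rule sum.cong) (auto simp: True fun_scale_def single_def)
          then show ?thesis using True by simp
        qed (simp add: fun_scale_def single_def)
        then show ?thesis by (simp only: sum_fun_apply)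
      qed
      also have "\<dots> = ?v i a" by (simp add: op_def)
      finally show "?v i a = (\<Sum>i<p. \<Sum>a<d. fun_scale (fun_scale (*)) (?v i a) (single i (single a 1))) i a"
        by simp
    qed
    then have "g \<alpha> ?v = g \<alpha> (\<Sum>i<p. \<Sum>a<d. fun_scale (fun_scale (*)) (?v i a) (single i (single a 1)))" by simp
    also have "\<dots> = (\<Sum>i<p. \<Sum>a<d. ?v i a * y' \<alpha> i a)"
      using g(1) by (simp add: G.linear_sum G.linear_scale y'_def)
    also have "\<dots> = gram p q m d A T x' y' \<alpha> \<beta>"
      unfolding gram_def by (auto simp: op_def mult.commute intro!: sum.cong)
    finally show ?thesis by simp
  qed
  then have "ndet ?k (gram p q m d A T x' y') = ndet ?k (\<lambda>\<alpha> \<beta>. if \<alpha> = \<beta> then 1 else 0)"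
    using g(2) x' by (intro ndet_cong) auto
  then have "ndet ?k (gram p q m d A T x' y') \<noteq> 0" by (simp add: ndet_identity)
  then show ?thesis by blast
qed

text \<open>Matrices over the ground field are written in the basis of the cyclic algebra, at the
  price of coefficients in L. Moving these coefficients into the constants makes the matrices
  \<open>twisted\<close>, which permits rounding up; the result is then moved back
  entrywise.\<close>

theorem gram_regularity:
  fixes \<iota> :: "'f::field \<Rightarrow> 'l" and A :: "nat \<Rightarrow> nat \<Rightarrow> nat \<Rightarrow> 'f"
  assumes hom: "comm_ring_hom \<iota>" and fixed: "\<And>c. \<sigma> (\<iota> c) = \<iota> c" and inf: "infinite (range \<iota>)"
    and nz: "ndet k (gram p q m d A T x y) \<noteq> 0" and k: "d * r < k"
    and inj: "inj \<iota>"
  shows "\<exists>T x y. ndet (d * Suc r) (gram p q m d A T x y) \<noteq> 0"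
proof -
  interpret i: comm_ring_hom \<iota> by (rule hom)
  define B where "B = (\<lambda>l i j. \<iota> (A l i j))"
  define x1 where "x1 = (\<lambda>\<beta> j c. \<iota> (x \<beta> j c))"
  define y1 where "y1 = (\<lambda>\<alpha> i a. \<iota> (y \<alpha> i a))"
  let ?K = "d * Suc r"
  note pf = poly_fun_intros
  have "\<iota> (ndet k (gram p q m d A T x y)) \<noteq> 0" using nz inj by (metis i.hom_zero injD)
  then have 0: "ndet k (gram p q m d B (\<lambda>l a c. \<iota> (T l a c)) x1 y1) \<noteq> 0"
    unfolding hom_ndet_gram[OF hom] B_def x1_def y1_def .
  have "\<forall>l. \<exists>t. \<forall>a<d. \<forall>c<d. alg_mat t a c = \<iota> (T l a c)" by (intro allI alg_mat_surj)
  then obtain s where s: "\<forall>l. \<forall>a<d. \<forall>c<d. alg_mat (s l) a c = \<iota> (T l a c)" by (rule choice[THEN exE])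
  \<comment> \<open>The determinant as a function of the algebra coefficients. It is nonzero at the
    coefficients of the given \<open>T\<close>, hence also at some in \<open>range \<iota>\<close>,
    where \<sigma> acts trivially.\<close>
  define \<Phi> where "\<Phi> \<tau> = ndet k (gram p q m d B (\<lambda>l. alg_mat (\<lambda>g h. \<tau> (l, g, h))) x1 y1)"
    for \<tau> :: "nat \<times> nat \<times> nat \<Rightarrow> 'l"
  have "\<Phi> (\<lambda>(l, g, h). s l g h) = ndet k (gram p q m d B (\<lambda>l a c. \<iota> (T l a c)) x1 y1)"
    unfolding \<Phi>_def using s by (intro ndet_gram_cong) auto
  then have \<Phi>0: "\<Phi> (\<lambda>(l, g, h). s l g h) \<noteq> 0" using 0 by simp
  have pf\<Phi>: "poly_fun (\<lambda>z. \<Phi> (\<tau>(i := z)))" for i \<tau>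
    unfolding \<Phi>_def by (rule poly_fun_ndet) (unfold gram_def blow_def alg_mat_def, intro pf)
  have "\<exists>\<tau>'. (\<forall>i\<in>{..<m} \<times> {..<d} \<times> {..<d}. \<tau>' i \<in> range \<iota>) \<and> \<Phi> \<tau>' \<noteq> 0"
    by (rule specialize[where \<Phi> = \<Phi>, OF _ pf\<Phi> \<Phi>0 inf]) simp
  then obtain \<tau>' where \<tau>': "\<forall>i\<in>{..<m} \<times> {..<d} \<times> {..<d}. \<tau>' i \<in> range \<iota>" "\<Phi> \<tau>' \<noteq> 0" by blast
  \<comment> \<open>Only coefficients in the index box are known to be constants; the default 0
    makes all of them fixed by \<sigma>.\<close>
  define t where "t l g h = (if l < m \<and> g < d \<and> h < d then \<tau>' (l, g, h) else 0)" for l g h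
  define T2 where "T2 = (\<lambda>l. alg_mat (t l))"
  have "\<sigma> z = z" if "z \<in> range \<iota>" for z using that fixed by auto
  then have "\<sigma> (t l g h) = t l g h" for l g h
    using \<tau>'(1) \<sigma>_0 by (simp add: t_def)
  then have T2: "twisted (T2 l)" for l unfolding T2_def by (intro twisted_alg_mat)
  have "\<Phi> \<tau>' = ndet k (gram p q m d B T2 x1 y1)"
    unfolding \<Phi>_def T2_def by (intro ndet_gram_cong) (auto simp: alg_mat_def t_def)
  then have "ndet k (gram p q m d B T2 x1 y1) \<noteq> 0" using \<tau>'(2) by simp
  moreover have "\<sigma> (B l i j) = B l i j" for l i j by (simp add: B_def fixed)
  ultimately have "\<exists>x y. ndet ?K (gram p q m d B T2 x y) \<noteq> 0"
    using T2 k by (intro gram_round_up)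
  then obtain x3 y3 where 3: "ndet ?K (gram p q m d B T2 x3 y3) \<noteq> 0" by blast
  \<comment> \<open>The twisted matrices and the rounded-up vectors still have entries in L. The
    entries of T, x and y are specialised in turn, with the other two held fixed.\<close>
  have "\<exists>\<tau>'. (\<forall>i\<in>{..<m} \<times> {..<d} \<times> {..<d}. \<tau>' i \<in> range \<iota>) \<and>
    ndet ?K (gram p q m d B (\<lambda>l a c. \<tau>' (l, a, c)) x3 y3) \<noteq> 0"
  proof (rule specialize[where \<Phi> = "\<lambda>\<tau>. ndet ?K (gram p q m d B (\<lambda>l a c. \<tau> (l, a, c)) x3 y3)"
      and \<tau> = "\<lambda>(l, a, c). T2 l a c"])
    show "poly_fun (\<lambda>z. ndet ?K (gram p q m d B (\<lambda>l a c. (\<tau>(i := z)) (l, a, c)) x3 y3))" for i \<tau>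
      by (rule poly_fun_ndet) (unfold gram_def blow_def, intro pf)
  qed (use 3 inf in auto)
  then obtain T4 where T4: "\<forall>i\<in>{..<m} \<times> {..<d} \<times> {..<d}. T4 i \<in> range \<iota>"
    "ndet ?K (gram p q m d B (\<lambda>l a c. T4 (l, a, c)) x3 y3) \<noteq> 0" by blast
  have "\<exists>\<tau>'. (\<forall>i\<in>{..<?K} \<times> {..<q} \<times> {..<d}. \<tau>' i \<in> range \<iota>) \<and>
    ndet ?K (gram p q m d B (\<lambda>l a c. T4 (l, a, c)) (\<lambda>\<beta> j c. \<tau>' (\<beta>, j, c)) y3) \<noteq> 0"
  proof (rule specialize[where \<Phi> = "\<lambda>\<tau>. ndet ?K (gram p q m d B (\<lambda>l a c. T4 (l, a, c)) (\<lambda>\<beta> j c. \<tau> (\<beta>, j, c)) y3)"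
      and \<tau> = "\<lambda>(\<beta>, j, c). x3 \<beta> j c"])
    show "poly_fun (\<lambda>z. ndet ?K (gram p q m d B (\<lambda>l a c. T4 (l, a, c)) (\<lambda>\<beta> j c. (\<tau>(i := z)) (\<beta>, j, c)) y3))" for i \<tau>
      by (rule poly_fun_ndet) (unfold gram_def blow_def, intro pf)
  qed (use T4 inf in auto)
  then obtain x4 where x4: "\<forall>i\<in>{..<?K} \<times> {..<q} \<times> {..<d}. x4 i \<in> range \<iota>"
    "ndet ?K (gram p q m d B (\<lambda>l a c. T4 (l, a, c)) (\<lambda>\<beta> j c. x4 (\<beta>, j, c)) y3) \<noteq> 0" by blast
  have "\<exists>\<tau>'. (\<forall>i\<in>{..<?K} \<times> {..<p} \<times> {..<d}. \<tau>' i \<in> range \<iota>) \<and>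
    ndet ?K (gram p q m d B (\<lambda>l a c. T4 (l, a, c)) (\<lambda>\<beta> j c. x4 (\<beta>, j, c)) (\<lambda>\<alpha> i a. \<tau>' (\<alpha>, i, a))) \<noteq> 0"
  proof (rule specialize[where \<Phi> = "\<lambda>\<tau>. ndet ?K (gram p q m d B (\<lambda>l a c. T4 (l, a, c)) (\<lambda>\<beta> j c. x4 (\<beta>, j, c)) (\<lambda>\<alpha> i a. \<tau> (\<alpha>, i, a)))"
      and \<tau> = "\<lambda>(\<alpha>, i, a). y3 \<alpha> i a"])
    show "poly_fun (\<lambda>z. ndet ?K (gram p q m d B (\<lambda>l a c. T4 (l, a, c)) (\<lambda>\<beta> j c. x4 (\<beta>, j, c)) (\<lambda>\<alpha> i a. (\<tau>(i' := z)) (\<alpha>, i, a))))" for i' \<tau>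
      by (rule poly_fun_ndet) (unfold gram_def blow_def, intro pf)
  qed (use x4 inf in auto)
  then obtain y4 where y4: "\<forall>i\<in>{..<?K} \<times> {..<p} \<times> {..<d}. y4 i \<in> range \<iota>"
    "ndet ?K (gram p q m d B (\<lambda>l a c. T4 (l, a, c)) (\<lambda>\<beta> j c. x4 (\<beta>, j, c)) (\<lambda>\<alpha> i a. y4 (\<alpha>, i, a))) \<noteq> 0"
    by blast
  define T5 where "T5 l a c = inv_into UNIV \<iota> (T4 (l, a, c))" for l a c
  define x5 where "x5 \<beta> j c = inv_into UNIV \<iota> (x4 (\<beta>, j, c))" for \<beta> j c
  define y5 where "y5 \<alpha> i a = inv_into UNIV \<iota> (y4 (\<alpha>, i, a))" for \<alpha> i a
  have "\<iota> (ndet ?K (gram p q m d A T5 x5 y5))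
    = ndet ?K (gram p q m d B (\<lambda>l a c. T4 (l, a, c)) (\<lambda>\<beta> j c. x4 (\<beta>, j, c)) (\<lambda>\<alpha> i a. y4 (\<alpha>, i, a)))"
    unfolding hom_ndet_gram[OF hom] B_def T5_def x5_def y5_def
    by (rule ndet_gram_cong; rule f_inv_into_f) (use T4(1) x4(1) y4(1) in auto)
  then have "ndet ?K (gram p q m d A T5 x5 y5) \<noteq> 0" using y4(2) by (metis i.hom_zero)
  then show ?thesis by blast
qed

end

section \<open>The cyclic algebra over iterated Laurent series\<close>

definition fls_trans :: "(int \<Rightarrow> 'a::zero \<Rightarrow> 'b::zero) \<Rightarrow> 'a fls \<Rightarrow> 'b fls" where
  "fls_trans \<phi> f = Abs_fls (\<lambda>n. \<phi> n (fls_nth f n))"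

text \<open>A coefficientwise map that may depend on the exponent. The grading condition
  \<open>mult\<close> makes it multiplicative; this covers both the substitution of a multiple of
  the variable and the action of an automorphism on coefficients.\<close>

locale fls_transform =
  fixes \<phi> :: "int \<Rightarrow> 'a::field \<Rightarrow> 'a"
  assumes add: "\<phi> n (x + y) = \<phi> n x + \<phi> n y"
    and mult: "\<phi> (i + j) (x * y) = \<phi> i x * \<phi> j y"
    and eq_0: "\<phi> n x = 0 \<longleftrightarrow> x = 0"
begin

lemma nth: "fls_nth (fls_trans \<phi> f) n = \<phi> n (fls_nth f n)"
  unfolding fls_trans_def
  by (rule nth_Abs_fls_lower_bound[of "fls_subdegree f", THEN fun_cong]
      nth_Abs_fls_lower_bound[of "fls_subdegree f"]) (simp add: eq_0)

lemma trans_add: "fls_trans \<phi> (f + g) = fls_trans \<phi> f + fls_trans \<phi> g"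
  by (rule fls_eqI) (simp add: nth add)

lemma trans_eq_0: "fls_trans \<phi> f = 0 \<longleftrightarrow> f = 0"
  by (auto simp: fls_eq_iff nth eq_0)

lemma trans_subdegree: "fls_subdegree (fls_trans \<phi> f) = fls_subdegree f"
proof (cases "f = 0")
  case False
  then show ?thesis by (intro fls_subdegree_eqI) (auto simp: nth eq_0)
qed (metis trans_eq_0)

lemma sum: "\<phi> n (\<Sum>i\<in>A. h i) = (\<Sum>i\<in>A. \<phi> n (h i))"
  by (induction A rule: infinite_finite_induct) (auto simp: eq_0 add)

lemma trans_mult: "fls_trans \<phi> (f * g) = fls_trans \<phi> f * fls_trans \<phi> g"
proof (rule fls_eqI)
  fix n
  have "\<phi> n (fls_nth f i * fls_nth g (n - i)) = \<phi> i (fls_nth f i) * \<phi> (n - i) (fls_nth g (n - i))" for i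
    using mult[of i "n - i"] by simp
  then show "fls_nth (fls_trans \<phi> (f * g)) n = fls_nth (fls_trans \<phi> f * fls_trans \<phi> g) n"
    unfolding nth fls_times_nth(2) trans_subdegree sum by simp
qed

lemma trans_1: "fls_trans \<phi> 1 = 1"
  using trans_mult[of 1 1] trans_eq_0[of 1] by simp

end

lemma roots_of_unity_orthogonality:
  assumes "a < d" "b < d"
  shows "(\<Sum>g<d. cis (2 * pi / real d) ^ (a * g) * inverse (cis (2 * pi / real d) ^ (b * g)))
    = (if a = b then of_nat d else 0)"
proof -
  let ?\<omega> = "cis (2 * pi / real d)"
  have pw: "?\<omega> ^ k = cis (2 * pi * real k / real d)" for k unfolding Complex.DeMoivre by (simp add: mult_ac)
  define z where "z = ?\<omega> ^ a * inverse (?\<omega> ^ b)"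
  have "?\<omega> ^ (a * g) * inverse (?\<omega> ^ (b * g)) = z ^ g" for g
    by (simp add: z_def power_mult power_mult_distrib power_inverse)
  then have eq: "(\<Sum>g<d. ?\<omega> ^ (a * g) * inverse (?\<omega> ^ (b * g))) = (\<Sum>g<d. z ^ g)" by simp
  show ?thesis
  proof (cases "a = b")
    case True
    then have "z = 1" by (simp add: z_def)
    then show ?thesis using True eq by simp
  next
    case False
    have "inj_on (\<lambda>k. cis (2 * pi * real k / real d)) {..<d}"
      using Complex.bij_betw_roots_unity[of d] assms by (auto simp: bij_betw_def)
    then have "?\<omega> ^ a \<noteq> ?\<omega> ^ b" using False assms unfolding pw by (auto dest: inj_onD)
    then have z1: "z \<noteq> 1" by (auto simp: z_def field_simps)
    have "?\<omega> ^ d = 1" using assms unfolding pw by simp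
    then have "z ^ d = 1"
      by (simp add: z_def power_mult_distrib power_inverse) (simp add: power_mult[symmetric] mult.commute[of _ d], simp add: power_mult)
    then show ?thesis using z1 eq False by (simp add: sum_gp_strict)
  qed
qed

definition emb :: "complex \<Rightarrow> complex fls fls" where
  "emb c = fls_const (fls_const c)"

lemma emb_hom: "comm_ring_hom emb"
  by unfold_locales (auto simp: emb_def fls_plus_const fls_const_mult_const)

lemma inj_emb: "inj emb"
proof (rule injI)
  fix x y assume "emb x = emb y"
  then have "fls_nth (fls_nth (emb x) 0) 0 = fls_nth (fls_nth (emb y) 0) 0" by simp
  then show "x = y" by (simp add: emb_def)
qed

lemma inverse_emb: "c \<noteq> 0 \<Longrightarrow> inverse (emb c) = emb (inverse c)"
  by (rule inverse_unique) (simp add: emb_def fls_const_mult_const)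

text \<open>The inner variable is u and the outer one is w. The automorphism rescales u by the root
  of unity inside each coefficient and leaves the w-exponents alone, so it preserves the order in
  w.\<close>

lemma cyclic_algebra_exists:
  assumes d: "0 < d"
  shows "\<exists>\<sigma> ord w u \<zeta>. cyclic_algebra \<sigma> ord (w :: complex fls fls) u \<zeta> d \<and> (\<forall>c. \<sigma> (emb c) = emb c)"
proof -
  let ?\<omega> = "cis (2 * pi / real d)"
  interpret e: comm_ring_hom emb by (rule emb_hom)
  interpret in0: fls_transform "\<lambda>n x. ?\<omega> powi n * x"
    by unfold_locales (auto simp: algebra_simps power_int_add)
  \<comment> \<open>The substitution of \<omega>u for u on \<complex>((u)).\<close>
  define \<sigma>0 where "\<sigma>0 = fls_trans (\<lambda>n x. ?\<omega> powi n * x)"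
  interpret out: fls_transform "\<lambda>_. \<sigma>0"
    by unfold_locales (auto simp: \<sigma>0_def in0.trans_add in0.trans_mult in0.trans_eq_0)
  define \<sigma> where "\<sigma> = fls_trans (\<lambda>_. \<sigma>0)"
  have \<sigma>0_const: "\<sigma>0 (fls_const c) = fls_const c" for c
    by (rule fls_eqI) (simp add: \<sigma>0_def in0.nth)
  have \<sigma>_const: "\<sigma> (fls_const f) = fls_const (\<sigma>0 f)" for f
    using out.eq_0[of 0] by (intro fls_eqI) (simp add: \<sigma>_def out.nth)
  have \<sigma>0_1: "\<sigma>0 1 = 1" by (simp add: \<sigma>0_def in0.trans_1)
  have \<omega>d: "?\<omega> ^ d = 1" using d unfolding Complex.DeMoivre by simp
  have emb_fixed: "\<sigma> (emb c) = emb c" for c by (simp add: emb_def \<sigma>_const \<sigma>0_const)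
  have "cyclic_algebra \<sigma> fls_subdegree fls_X (fls_const fls_X) (emb ?\<omega>) d"
  proof
    show "\<sigma> (x + y) = \<sigma> x + \<sigma> y" "\<sigma> (x * y) = \<sigma> x * \<sigma> y" "\<sigma> x = 0 \<longleftrightarrow> x = 0"
      "fls_subdegree (\<sigma> x) = fls_subdegree x" for x y
      by (simp_all add: \<sigma>_def out.trans_add out.trans_mult out.trans_eq_0 out.trans_subdegree)
    show "\<sigma> fls_X = fls_X" by (rule fls_eqI) (simp add: \<sigma>_def out.nth \<sigma>0_1 out.eq_0)
    have "\<sigma>0 fls_X = fls_const ?\<omega> * fls_X"
      by (rule fls_eqI) (auto simp: \<sigma>0_def in0.nth)
    then show "\<sigma> (fls_const fls_X) = emb ?\<omega> * fls_const fls_X"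
      by (simp add: \<sigma>_const emb_def fls_const_mult_const)
    show "(\<Sum>g<d. emb ?\<omega> ^ (a * g) * inverse (emb ?\<omega> ^ (b * g))) = (if a = b then of_nat d else 0)"
      if "a < d" "b < d" for a b
    proof -
      have "(\<Sum>g<d. emb ?\<omega> ^ (a * g) * inverse (emb ?\<omega> ^ (b * g)))
        = emb (\<Sum>g<d. ?\<omega> ^ (a * g) * inverse (?\<omega> ^ (b * g)))"
        by (simp add: e.hom_sum e.hom_mult e.hom_power[symmetric] inverse_emb del: power_mult)
      also have "\<dots> = (if a = b then of_nat d else 0)"
        unfolding roots_of_unity_orthogonality[OF that] by (simp add: e.hom_of_nat)
      finally show ?thesis .
    qed
    show "emb ?\<omega> \<noteq> 0" using inj_emb by (metis cis_neq_zero e.hom_zero injD)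
    show "emb ?\<omega> ^ d = 1" using \<omega>d by (simp add: e.hom_power[symmetric])
    have "emb (of_nat d) \<noteq> 0" using d inj_emb by (metis e.hom_zero injD of_nat_eq_0_iff less_irrefl)
    then show "of_nat d \<noteq> (0 :: complex fls fls)" by (simp add: e.hom_of_nat)
    show "min (fls_subdegree x) (fls_subdegree y) \<le> fls_subdegree (x + y)" if "x + y \<noteq> 0" for x y :: "complex fls fls"
      using fls_plus_subdegree[OF that] .
  qed (use d emb_fixed in \<open>auto simp: fls_const_nonzero\<close>)
  then show ?thesis using emb_fixed by blast
qed

section \<open>The noncommutative rank is attained\<close>

context map_space begin

text \<open>In coordinates of \<open>D\<close> and of the codomain, \<open>M\<close> becomes
  \<open>\<Sum> B_l \<otimes> T_l\<close> with entries over the ground field. Rounding changes only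
  the matrices \<open>T_l\<close>, so the result is again a block map with entries in
  \<open>X\<close>.\<close>

lemma rk_regular:
  fixes \<iota> :: "'a \<Rightarrow> complex"
  assumes hom: "comm_ring_hom \<iota>" and inj: "inj \<iota>" and inf: "infinite (UNIV :: 'a set)"
    and d: "0 < d" and M: "blocks M" and r: "d * r < rk d M"
  shows "\<exists>M'. blocks M' \<and> d * Suc r \<le> rk d M'"
proof -
  interpret i: comm_ring_hom \<iota> by (rule hom)
  interpret F2: vector_space_pair s2 "(*) :: 'a \<Rightarrow> 'a \<Rightarrow> 'a" by (rule vs2.functional_pair)
  interpret G: vector_space_pair "fun_scale s2 :: 'a \<Rightarrow> (nat \<Rightarrow> 'w) \<Rightarrow> _" "(*) :: 'a \<Rightarrow> 'a \<Rightarrow> 'a"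
    by (rule tup.vs2.functional_pair)
  define q where "q = vs1.dim D"
  define p where "p = vs2.dim UNIV"
  \<comment> \<open>One map \<open>B l\<close> for each of the \<open>d * d\<close> entries of
    \<open>M\<close>.\<close>
  define m where "m = d * d"
  obtain b where b: "indep_family s1 q b" "\<forall>j<q. b j \<in> D" "D \<subseteq> vs1.span (b ` {..<q})"
    unfolding q_def using vs1.indep_family_basis[OF fin_dim_D] .
  obtain e where e: "indep_family s2 p e" "\<forall>j<p. e j \<in> UNIV" "UNIV \<subseteq> vs2.span (e ` {..<p})"
    unfolding p_def using vs2.indep_family_basis[OF fin_dim_UNIV] .
  obtain f where f: "\<forall>i. functional s2 (f i)" "\<forall>i<p. \<forall>j<p. f i (e j) = (if i = j then 1 else 0)"
    using vs2.indep_family_dual[OF e(1)] .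
  have f_lin: "functional s2 (f i)" for i using f(1) by blast
  have expand: "v = (\<Sum>i<p. s2 (f i v) (e i))" for v
  proof -
    have "v \<in> vs2.span (e ` {..<p})" using e(3) by blast
    then obtain c where c: "v = (\<Sum>i<p. s2 (c i) (e i))" by (rule vs2.span_image_lessThanE)
    have "f i v = c i" if "i < p" for i
    proof -
      have "f i v = (\<Sum>j<p. c j * f i (e j))"
        unfolding c by (simp add: F2.linear_sum[OF f_lin] F2.linear_scale[OF f_lin])
      also have "\<dots> = (\<Sum>j<p. if j = i then c i else 0)" using f(2) that by (intro sum.cong) auto
      finally show ?thesis using that by simp
    qed
    then show ?thesis by (subst c) (auto intro!: sum.cong)
  qed
  define B where "B l = M (l div d) (l mod d)" for l
  have B: "B l \<in> X" for l using M by (simp add: B_def blocks_def)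
  define A where "A l i j = f i (B l (b j))" for l i j
  define N where "N T a c v = (\<Sum>l<m. s2 (T l a c) (B l v))" for T :: "nat \<Rightarrow> nat \<Rightarrow> nat \<Rightarrow> 'a" and a c v
  define z where "z x \<beta> c = (if c < d then \<Sum>j<q. s1 (x \<beta> j c) (b j) else 0)"
    for x :: "nat \<Rightarrow> nat \<Rightarrow> nat \<Rightarrow> 'a" and \<beta> c :: nat
  define h where "h y \<alpha> v = (\<Sum>i<p. \<Sum>a<d. y \<alpha> i a * f i (v a))"
    for y :: "nat \<Rightarrow> nat \<Rightarrow> nat \<Rightarrow> 'a" and \<alpha> :: nat and v :: "nat \<Rightarrow> 'w"
  have N: "blocks (N T)" for T
  proof -
    have "(\<lambda>v. \<Sum>l\<in>K. s2 (T l a c) (B l v)) \<in> X" if "finite K" for K a c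
      using that
    proof (induction K)
      case empty
      then show ?case using zero_X by simp
    next
      case (insert l K)
      then show ?case using add_X[OF scale_X[OF B]] by simp
    qed
    then show ?thesis unfolding blocks_def N_def by simp
  qed
  have z: "z x \<beta> \<in> tuple_space d D" for x \<beta>
    using b(2) unfolding tuple_space_def z_def
    by (auto intro!: vs1.subspace_sum[OF subspace_D] vs1.subspace_scale[OF subspace_D])
  have h_lin: "functional (fun_scale s2) (h y \<alpha>)" for y \<alpha>
    unfolding Vector_Spaces.linear_iff
    by (simp add: tup.vs2.vector_space_axioms vector_space_over_itself.vector_space_axioms h_def fun_scale_def
        F2.linear_add[OF f_lin] F2.linear_scale[OF f_lin] sum.distrib sum_distrib_left distrib_left mult.left_commute)
  have gram: "gram p q m d A T x y \<alpha> \<beta> = h y \<alpha> (block_map d (N T) (z x \<beta>))" for T x y \<alpha> \<beta>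
  proof -
    have "f i (block_map d (N T) (z x \<beta>) a) = blow q m d A T (x \<beta>) i a" if "a < d" for i a
    proof -
      have "f i (block_map d (N T) (z x \<beta>) a) = (\<Sum>c<d. \<Sum>l<m. T l a c * (\<Sum>j<q. x \<beta> j c * A l i j))"
        using that by (simp add: block_map_def N_def z_def A_def F2.linear_sum[OF f_lin] F2.linear_scale[OF f_lin]
            linear_sum[OF linear_X[OF B]] linear_scale[OF linear_X[OF B]])
      also have "\<dots> = (\<Sum>c<d. \<Sum>l<m. \<Sum>j<q. A l i j * T l a c * x \<beta> j c)"
        by (simp add: sum_distrib_left mult_ac)
      also have "\<dots> = (\<Sum>c<d. \<Sum>j<q. \<Sum>l<m. A l i j * T l a c * x \<beta> j c)"
        by (intro sum.cong refl sum.swap)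
      also have "\<dots> = (\<Sum>j<q. \<Sum>c<d. \<Sum>l<m. A l i j * T l a c * x \<beta> j c)" by (rule sum.swap)
      also have "\<dots> = blow q m d A T (x \<beta>) i a" by (simp add: blow_def sum_distrib_right)
      finally show ?thesis .
    qed
    then show ?thesis by (simp add: gram_def h_def)
  qed
  let ?k = "rk d M"
  obtain w where w: "indep_family (fun_scale s2) ?k w" "\<forall>j<?k. w j \<in> block_map d M ` tuple_space d D"
    "block_map d M ` tuple_space d D \<subseteq> tup.vs2.span (w ` {..<?k})"
    unfolding rk_def using tup.vs2.indep_family_basis[OF tup.fin_dim_image[OF linear_blocks[OF M] fin_dim_tuples]] .
  obtain g where g: "\<forall>\<alpha>. functional (fun_scale s2) (g \<alpha>)"
    "\<forall>\<alpha><?k. \<forall>\<beta><?k. g \<alpha> (w \<beta>) = (if \<alpha> = \<beta> then 1 else 0)"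
    using tup.vs2.indep_family_dual[OF w(1)] .
  have "\<forall>\<beta>. \<exists>v. \<beta> < ?k \<longrightarrow> v \<in> tuple_space d D \<and> w \<beta> = block_map d M v" using w(2) by auto
  then obtain v where v: "\<forall>\<beta>. \<beta> < ?k \<longrightarrow> v \<beta> \<in> tuple_space d D \<and> w \<beta> = block_map d M (v \<beta>)"
    by (rule choice[THEN exE])
  have "\<exists>x. \<beta> < ?k \<and> c < d \<longrightarrow> v \<beta> c = (\<Sum>j<q. s1 (x j) (b j))" for \<beta> c
  proof (cases "\<beta> < ?k \<and> c < d")
    case True
    then have "v \<beta> c \<in> vs1.span (b ` {..<q})" using v b(3) unfolding tuple_space_def by blast
    then show ?thesis by (rule vs1.span_image_lessThanE) blast
  qed blast
  then obtain x0 where x0: "\<forall>\<beta> c. \<beta> < ?k \<and> c < d \<longrightarrow> v \<beta> c = (\<Sum>j<q. s1 (x0 \<beta> c j) (b j))" by metis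
  define x where "x \<beta> j c = x0 \<beta> c j" for \<beta> j c
  define y where "y \<alpha> i a = g \<alpha> (single a (e i))" for \<alpha> i a
  \<comment> \<open>Matrix units, with which \<open>N T\<close> gives back \<open>M\<close>.\<close>
  define T where "T l a c = (if l = a * d + c then 1 else 0 :: 'a)" for l a c
  have zv: "z x \<beta> = v \<beta>" if "\<beta> < ?k" for \<beta>
    using x0 v that unfolding z_def x_def tuple_space_def by (auto simp: fun_eq_iff)
  have NM: "N T a c = M a c" if "a < d" "c < d" for a c
  proof
    fix u
    have lt: "a * d + c < m"
    proof -
      have "a * d + c < Suc a * d" using that by simp
      also have "\<dots> \<le> d * d" using that by (intro mult_le_mono1) simp
      finally show ?thesis by (simp add: m_def)
    qed
    have "N T a c u = (\<Sum>l<m. if l = a * d + c then B (a * d + c) u else 0)"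
      unfolding N_def T_def by (intro sum.cong) auto
    also have "\<dots> = M a c u" using lt that by (simp add: B_def)
    finally show "N T a c u = M a c u" .
  qed
  have block: "block_map d (N T) = block_map d M" using NM by (auto simp: block_map_def fun_eq_iff)
  \<comment> \<open>The coefficients \<open>y\<close> are the values of \<open>g\<close> on the
    basis of unit tuples, so \<open>h y\<close> and \<open>g\<close> agree on tuples of length
    d.\<close>
  have hg: "h y \<alpha> u = g \<alpha> u" if u: "u \<in> tuple_space d UNIV" for u \<alpha>
  proof -
    have g_lin: "functional (fun_scale s2) (g \<alpha>)" using g(1) by blast
    interpret S: vector_space_pair s2 "fun_scale s2 :: 'a \<Rightarrow> (nat \<Rightarrow> 'w) \<Rightarrow> _" ..
    have "u = (\<Sum>a<d. single a (u a))" by (rule tuple_space_eq_sum_single[OF u])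
    also have "\<dots> = (\<Sum>a<d. \<Sum>i<p. fun_scale s2 (f i (u a)) (single a (e i)))"
    proof (rule sum.cong[OF refl])
      fix a
      have "single a (u a) = single a (\<Sum>i<p. s2 (f i (u a)) (e i))" by (simp only: expand[symmetric])
      then show "single a (u a) = (\<Sum>i<p. fun_scale s2 (f i (u a)) (single a (e i)))"
        by (simp only: S.linear_sum[OF vs2.linear_single] S.linear_scale[OF vs2.linear_single])
    qed
    finally have "g \<alpha> u = g \<alpha> (\<Sum>a<d. \<Sum>i<p. fun_scale s2 (f i (u a)) (single a (e i)))" by simp
    also have "\<dots> = (\<Sum>a<d. \<Sum>i<p. f i (u a) * y \<alpha> i a)"
      by (simp only: G.linear_sum[OF g_lin] G.linear_scale[OF g_lin] y_def)
    also have "\<dots> = h y \<alpha> u" unfolding h_def by (subst sum.swap) (simp add: mult.commute)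
    finally show ?thesis by simp
  qed
  have "gram p q m d A T x y \<alpha> \<beta> = (if \<alpha> = \<beta> then 1 else 0)" if "\<alpha> < ?k" "\<beta> < ?k" for \<alpha> \<beta>
  proof -
    have "w \<beta> = block_map d M (v \<beta>)" using v that(2) by blast
    then have "gram p q m d A T x y \<alpha> \<beta> = g \<alpha> (w \<beta>)"
      using hg[OF block_map_in_tuple_space] that(2) by (simp add: gram block zv)
    then show ?thesis using g(2) that by simp
  qed
  then have "ndet ?k (gram p q m d A T x y) = ndet ?k (\<lambda>\<alpha> \<beta>. if \<alpha> = \<beta> then 1 else 0)"
    by (intro ndet_cong)
  then have nz: "ndet ?k (gram p q m d A T x y) \<noteq> 0" by (simp add: ndet_identity)
  obtain \<sigma> ord w u \<zeta> where ca: "cyclic_algebra \<sigma> ord (w :: complex fls fls) u \<zeta> d" "\<forall>c. \<sigma> (emb c) = emb c"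
    using cyclic_algebra_exists[OF d] by blast
  interpret ca: cyclic_algebra \<sigma> ord w u \<zeta> d by (rule ca(1))
  interpret e: comm_ring_hom emb by (rule emb_hom)
  define \<kappa> where "\<kappa> c = emb (\<iota> c)" for c
  have inj\<kappa>: "inj \<kappa>" using inj inj_emb by (auto simp: \<kappa>_def inj_def)
  have "\<exists>T x y. ndet (d * Suc r) (gram p q m d A T x y) \<noteq> 0"
  proof (rule ca.gram_regularity[OF _ _ _ nz r inj\<kappa>])
    show "comm_ring_hom \<kappa>"
      by unfold_locales (auto simp: \<kappa>_def e.hom_add e.hom_mult i.hom_add i.hom_mult)
    show "\<sigma> (\<kappa> c) = \<kappa> c" for c using ca(2) by (simp add: \<kappa>_def)
    show "infinite (range \<kappa>)" using inj\<kappa> inf finite_imageD by blast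
  qed
  then obtain T' x' y' where nz': "ndet (d * Suc r) (gram p q m d A T' x' y') \<noteq> 0" by blast
  have "gram p q m d A T' x' y' = (\<lambda>\<alpha> \<beta>. h y' \<alpha> (block_map d (N T') (z x' \<beta>)))"
    by (intro ext gram)
  then have "indep_family (fun_scale s2) (d * Suc r) (\<lambda>\<beta>. block_map d (N T') (z x' \<beta>))"
    using nz' h_lin by (intro tup.vs2.indep_family_of_ndet[where g = "h y'"]) simp_all
  then have "d * Suc r \<le> rk d (N T')"
    unfolding rk_def
    by (rule tup.vs2.indep_family_le_dim) (use z tup.fin_dim_image[OF linear_blocks[OF N] fin_dim_tuples] in auto)
  then show ?thesis using N by blast
qed

lemma rk_le_dim: "blocks M \<Longrightarrow> rk r M \<le> r * vs1.dim D"
  unfolding rk_def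
  using tup.dim_image_le[OF linear_blocks subspace_tuples fin_dim_tuples] vs1.dim_tuple_space[OF subspace_D fin_dim_D]
  by metis

text \<open>Only integer lower bounds on normalised ranks are compared: they are at most
  \<open>dim D\<close>, so there is a greatest one, \<rho>. A blow-up with normalised rank above
  \<rho> would round up to \<rho> + 1, so a block map reaching \<rho> is optimal among all multiples
  of its degree.\<close>

theorem optimal_shrunk_subspace:
  fixes \<iota> :: "'a \<Rightarrow> complex"
  assumes hom: "comm_ring_hom \<iota>" and inj: "inj \<iota>" and inf: "infinite (UNIV :: 'a set)"
  shows "\<exists>U d M. vs1.subspace U \<and> U \<subseteq> D \<and> 0 < d \<and> blocks M \<and>
    d * vs1.dim D + d * vs2.dim (action U) \<le> rk d M + d * vs1.dim U"
proof -
  define P where "P e \<longleftrightarrow> (\<exists>d M. 0 < d \<and> blocks M \<and> d * e \<le> rk d M)" for e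
  have "blocks (\<lambda>_ _ _. 0)" using zero_X by (simp add: blocks_def)
  then have P0: "P 0" unfolding P_def by (intro exI[of _ 1] exI[of _ "\<lambda>_ _ _. 0"]) simp
  have bound: "e \<le> vs1.dim D" if e: "P e" for e
  proof -
    obtain d M where "0 < d" "blocks M" "d * e \<le> rk d M" using e unfolding P_def by blast
    then have "d * e \<le> d * vs1.dim D" using order.trans[OF _ rk_le_dim[of M d]] by blast
    then show ?thesis using \<open>0 < d\<close> by simp
  qed
  define \<rho> where "\<rho> = Greatest P"
  have "P \<rho>" unfolding \<rho>_def by (rule GreatestI_nat[where P = P, OF P0]) (rule bound)
  have \<rho>: "e \<le> \<rho>" if "P e" for e
    unfolding \<rho>_def by (rule Greatest_le_nat[where P = P, OF that]) (rule bound)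
  from \<open>P \<rho>\<close> obtain d M where dM: "0 < d" "blocks M" "d * \<rho> \<le> rk d M" unfolding P_def by blast
  have max: "rk (d * s) M' \<le> s * rk d M" if "blocks M'" for s M'
  proof (cases "s = 0")
    case True
    then show ?thesis using rk_le_dim[OF that, of "d * s"] by simp
  next
    case False
    have "rk (d * s) M' \<le> d * s * \<rho>"
    proof (rule ccontr)
      assume "\<not> rk (d * s) M' \<le> d * s * \<rho>"
      then have "\<exists>M''. blocks M'' \<and> d * s * Suc \<rho> \<le> rk (d * s) M''"
        using False dM(1) that by (intro rk_regular[OF hom inj inf]) auto
      then have "P (Suc \<rho>)" using False dM(1) unfolding P_def by (intro exI[of _ "d * s"]) auto
      then show False using \<rho> by fastforce
    qed
    also have "d * s * \<rho> = s * (d * \<rho>)" by simp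
    also have "\<dots> \<le> s * rk d M" using dM(3) by simp
    finally show ?thesis .
  qed
  show ?thesis using shrunk_subspace[OF dM(1,2) max inf] dM(1,2) by blast
qed

end

section \<open>The noncommutative rank as a minimum over subspaces\<close>

context map_space begin

lemma max_rank_eq: "max_rank (fun_scale s2) (tuple_space r D) (tensor_matrices s2 r X) = Max {rk r M |M. blocks M}"
  unfolding max_rank_def tensor_matrices_eq rk_def by (rule arg_cong[of _ _ Max]) blast

lemma finite_rk: "finite {rk r M |M. blocks M}"
  by (rule finite_subset[of _ "{..r * vs1.dim D}"]) (use rk_le_dim in auto)

lemma rk_le_max_rank: "blocks M \<Longrightarrow> rk r M \<le> max_rank (fun_scale s2) (tuple_space r D) (tensor_matrices s2 r X)"
  unfolding max_rank_eq by (rule Max_ge[OF finite_rk]) blast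

lemma max_rank_in: "\<exists>M. blocks M \<and> max_rank (fun_scale s2) (tuple_space r D) (tensor_matrices s2 r X) = rk r M"
proof -
  have "{rk r M |M. blocks M} \<noteq> {}" using zero_X by (auto simp: blocks_def intro!: exI[of _ "\<lambda>_ _ _. 0"])
  from Max_in[OF finite_rk this] show ?thesis unfolding max_rank_eq by auto
qed

lemma scaled_max_rank_le:
  assumes U: "vs1.subspace U" "U \<subseteq> D" and r: "1 \<le> r"
  shows "1 / real r * real (max_rank (fun_scale s2) (tuple_space r D) (tensor_matrices s2 r X))
    \<le> real (vs1.dim D) + real (vs2.dim (action U)) - real (vs1.dim U)"
proof -
  obtain M where M: "blocks M" "max_rank (fun_scale s2) (tuple_space r D) (tensor_matrices s2 r X) = rk r M"
    using max_rank_in by blast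
  have "real (rk r M + r * vs1.dim U) \<le> real (r * vs1.dim D + r * vs2.dim (action U))"
    using rk_le[OF M(1) U, of r] by (simp only: of_nat_le_iff)
  then have "real (rk r M) \<le> real r * (real (vs1.dim D) + real (vs2.dim (action U)) - real (vs1.dim U))"
    by (simp add: algebra_simps)
  then show ?thesis using r unfolding M(2) by (simp add: field_simps)
qed

lemma nc_rank_le:
  assumes "vs1.subspace U" "U \<subseteq> D"
  shows "nc_rank s2 D X \<le> real (vs1.dim D) + real (vs2.dim (action U)) - real (vs1.dim U)"
  unfolding nc_rank_def by (rule cSUP_least) (use scaled_max_rank_le[OF assms] in auto)

theorem nc_rank_ge:
  fixes \<iota> :: "'a \<Rightarrow> complex"
  assumes "comm_ring_hom \<iota>" "inj \<iota>" "infinite (UNIV :: 'a set)"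
  shows "\<exists>U. vs1.subspace U \<and> U \<subseteq> D \<and>
    real (vs1.dim D) + real (vs2.dim (action U)) - real (vs1.dim U) \<le> nc_rank s2 D X"
proof -
  let ?f = "\<lambda>r. 1 / real r * real (max_rank (fun_scale s2) (tuple_space r D) (tensor_matrices s2 r X))"
  obtain U d M where U: "vs1.subspace U" "U \<subseteq> D" "0 < d" "blocks M"
    "d * vs1.dim D + d * vs2.dim (action U) \<le> rk d M + d * vs1.dim U"
    using optimal_shrunk_subspace[OF assms] by blast
  have "real (d * vs1.dim D + d * vs2.dim (action U)) \<le> real (rk d M + d * vs1.dim U)"
    using U(5) by (simp only: of_nat_le_iff)
  then have "real d * (real (vs1.dim D) + real (vs2.dim (action U)) - real (vs1.dim U)) \<le> real (rk d M)"
    by (simp add: algebra_simps)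
  also have "\<dots> \<le> real (max_rank (fun_scale s2) (tuple_space d D) (tensor_matrices s2 d X))"
    using rk_le_max_rank[OF U(4)] by simp
  finally have "real (vs1.dim D) + real (vs2.dim (action U)) - real (vs1.dim U) \<le> ?f d"
    using U(3) by (simp add: field_simps)
  also have "?f d \<le> nc_rank s2 D X"
    unfolding nc_rank_def
  proof (rule cSUP_upper)
    show "bdd_above (?f ` {1..})"
      using scaled_max_rank_le[OF U(1,2)] by (intro bdd_aboveI2) auto
  qed (use U(3) in simp)
  finally show ?thesis using U(1,2) by blast
qed

text \<open>For fixed \<open>u\<close>, the maps sending \<open>u\<close> into \<open>W\<close> form
  a subspace, so generators suffice.\<close>

lemma action_subset_of_span:
  assumes "X = maps.span G" "vs2.subspace W" "\<And>T u. T \<in> G \<Longrightarrow> u \<in> U \<Longrightarrow> T u \<in> W"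
  shows "action U \<subseteq> W"
  unfolding action_def
proof (rule vs2.span_minimal[OF _ assms(2)], clarify)
  fix T u assume T: "T \<in> X" and u: "u \<in> U"
  have "maps.span G \<subseteq> {T. T u \<in> W}"
  proof (rule maps.span_minimal)
    show "maps.subspace {T. T u \<in> W}"
      by (rule maps.subspaceI)
        (auto simp: fun_scale_def vs2.subspace_0[OF assms(2)] vs2.subspace_add[OF assms(2)] vs2.subspace_scale[OF assms(2)])
  qed (use assms(3) u in auto)
  then show "T u \<in> W" using T assms(1) by auto
qed

lemma in_action: "T \<in> X \<Longrightarrow> u \<in> U \<Longrightarrow> T u \<in> action U"
  unfolding action_def by (intro vs2.span_base) blast

end

section \<open>Orthogonal complements\<close>

lemma std_inner_add: "std_inner (v + v') w = std_inner v w + std_inner v' w"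
  by (simp add: std_inner_def algebra_simps sum.distrib)

lemma std_inner_scale: "std_inner (c *s v) w = c * std_inner v w"
  by (simp add: std_inner_def sum_distrib_left mult.assoc)

lemma std_inner_swap: "std_inner w v = conjugate (std_inner v w)"
  by (simp add: std_inner_def sum_conjugate conjugate_dist_mul mult.commute)

lemma std_inner_zero: "std_inner 0 w = 0" "std_inner v 0 = 0"
  by (simp_all add: std_inner_def)

lemma std_inner_definite:
  fixes v :: "'a::conjugatable_ordered_field ^ 'n"
  assumes "std_inner v v = 0"
  shows "v = 0"
proof -
  have "\<forall>i\<in>UNIV. vec_nth v i * conjugate (vec_nth v i) = 0"
    using assms unfolding std_inner_def
    by (subst (asm) sum_nonneg_eq_0_iff) (auto simp: conjugate_square_positive)
  then show ?thesis by (simp add: Finite_Cartesian_Product.vec_eq_iff)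
qed

lemma fin_dim_vec: "fin_dim (*s) (S :: ('a::field ^ 'n) set)"
  unfolding fin_dim_def using finite_cart_basis span_cart_basis by blast

lemma subspace_orth_compl: "vec.subspace (orth_compl G)"
  by (rule vec.subspaceI) (auto simp: orth_compl_def std_inner_add std_inner_scale std_inner_zero)

lemma orth_compl_antimono: "G \<subseteq> H \<Longrightarrow> orth_compl H \<subseteq> orth_compl G"
  by (auto simp: orth_compl_def)

lemma subset_orth_compl_orth_compl: "G \<subseteq> orth_compl (orth_compl G)"
proof
  fix v assume "v \<in> G"
  then have "std_inner w v = 0" if "w \<in> orth_compl G" for w using that by (simp add: orth_compl_def)
  then show "v \<in> orth_compl (orth_compl G)"
    by (auto simp: orth_compl_def) (metis std_inner_swap conjugate_zero)
qed

text \<open>The complement is the kernel of taking inner products with a basis of \<open>G\<close>,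
  a map of rank at most \<open>dim G\<close>; this bounds its dimension from below. Definiteness
  makes the sum direct, which bounds it from above.\<close>

lemma orth_compl_decomposition:
  fixes G :: "('a::conjugatable_ordered_field ^ 'n) set"
  assumes G: "vec.subspace G"
  shows "vec.dim G + vec.dim (orth_compl G) = CARD('n)"
    and "\<exists>w\<in>G. v - w \<in> orth_compl G"
    and "G \<inter> orth_compl G = {0}"
proof -
  interpret t: vector_space "fun_scale (*) :: 'a \<Rightarrow> (nat \<Rightarrow> 'a) \<Rightarrow> _"
    by (intro vector_space_fun_scale vector_space_over_itself.vector_space_axioms)
  interpret p: vector_space_pair "(*s) :: 'a \<Rightarrow> 'a ^ 'n \<Rightarrow> _" "fun_scale (*) :: 'a \<Rightarrow> (nat \<Rightarrow> 'a) \<Rightarrow> _" ..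
  let ?k = "vec.dim G"
  obtain b where b: "indep_family (*s) ?k b" "\<forall>j<?k. b j \<in> G" "G \<subseteq> vec.span (b ` {..<?k})"
    using vec.indep_family_basis[OF fin_dim_vec] .
  define \<phi> where "\<phi> v = (\<lambda>i. if i < ?k then std_inner v (b i) else 0)" for v
  have \<phi>: "Vector_Spaces.linear (*s) (fun_scale (*)) \<phi>"
    unfolding Vector_Spaces.linear_iff
    by (auto simp: vec.vector_space_axioms t.vector_space_axioms \<phi>_def fun_scale_def fun_eq_iff
        std_inner_add std_inner_scale)
  have f1: "fin_dim (*) (UNIV :: 'a set)"
    unfolding fin_dim_def
    using vector_space_over_itself.span_scale[OF vector_space_over_itself.span_base[of "1 :: 'a" "{1}"]]
    by (intro exI[of _ "{1}"]) auto
  have d1: "vector_space_over_itself.dim (UNIV :: 'a set) = 1"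
    by simp
  have "t.dim (range \<phi>) \<le> t.dim (tuple_space ?k UNIV)"
    by (rule t.dim_le_of_subset[OF _ vector_space_over_itself.fin_dim_tuple_space[OF f1]])
      (auto simp: \<phi>_def tuple_space_def)
  then have "t.dim (range \<phi>) \<le> ?k"
    using vector_space_over_itself.dim_tuple_space[OF vector_space_over_itself.subspace_UNIV f1, of ?k] d1 by simp
  moreover have ker: "{v \<in> UNIV. \<phi> v = 0} = orth_compl G"
  proof (intro equalityI subsetI)
    fix v assume v: "v \<in> {v \<in> UNIV. \<phi> v = 0}"
    have "std_inner v (b i) = 0" if "i < ?k" for i
    proof -
      have "\<phi> v = 0" using v by simp
      then have "\<phi> v i = 0" by simp
      then show ?thesis using that by (simp add: \<phi>_def)
    qed
    \<comment> \<open>\<open>std_inner\<close> is linear only in the first argument, so the roles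
      are swapped before passing to the span.\<close>
    then have "b i \<in> orth_compl {v}" if "i < ?k" for i
      using that std_inner_swap[of "b i" v] by (simp add: orth_compl_def)
    then have "vec.span (b ` {..<?k}) \<subseteq> orth_compl {v}"
      by (intro vec.span_minimal subspace_orth_compl) auto
    then have "G \<subseteq> orth_compl {v}" using b(3) by blast
    then show "v \<in> orth_compl G"
      using subset_orth_compl_orth_compl[of "{v}"] orth_compl_antimono[of G "orth_compl {v}"] by blast
  next
    fix v assume "v \<in> orth_compl G"
    then show "v \<in> {v \<in> UNIV. \<phi> v = 0}" using b(2) by (auto simp: orth_compl_def \<phi>_def fun_eq_iff)
  qed
  moreover have "vec.dim (UNIV :: ('a ^ 'n) set) = t.dim (range \<phi>) + vec.dim {v \<in> UNIV. \<phi> v = 0}"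
    by (rule p.rank_nullity[OF \<phi> vec.subspace_UNIV fin_dim_vec])
  ultimately have ge: "CARD('n) \<le> ?k + vec.dim (orth_compl G)"
    unfolding vec_dim_card ker by linarith
  show int: "G \<inter> orth_compl G = {0}"
    using vec.subspace_0[OF G] vec.subspace_0[OF subspace_orth_compl[of G]] std_inner_definite
    by (auto simp: orth_compl_def)
  let ?S = "{x + y |x y. x \<in> G \<and> y \<in> orth_compl G}"
  have sum: "vec.dim ?S = ?k + vec.dim (orth_compl G)"
    using vec.dim_sums_Int[OF G subspace_orth_compl[of G]] unfolding int by simp
  moreover have "vec.dim ?S \<le> CARD('n)" using vec.dim_subset_UNIV[of ?S] by (simp add: vec.dimension_def card_cart_basis)
  ultimately show dim: "?k + vec.dim (orth_compl G) = CARD('n)" using ge by simp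
  have "?S = UNIV"
    by (rule vec.subspace_dim_equal[OF vec.subspace_sums[OF G subspace_orth_compl] vec.subspace_UNIV])
      (use sum dim in \<open>auto simp: card_cart_basis\<close>)
  then have "v \<in> ?S" by blast
  then obtain w y where wy: "v = w + y" "w \<in> G" "y \<in> orth_compl G" by blast
  then have "v - w = y" by simp
  then show "\<exists>w\<in>G. v - w \<in> orth_compl G" using wy by (intro bexI[of _ w]) auto
qed

lemma orth_compl_orth_compl:
  fixes G :: "('a::conjugatable_ordered_field ^ 'n) set"
  assumes G: "vec.subspace G"
  shows "orth_compl (orth_compl G) = G"
proof -
  have "vec.dim (orth_compl (orth_compl G)) = vec.dim G"
    using orth_compl_decomposition(1)[OF G] orth_compl_decomposition(1)[OF subspace_orth_compl[of G]] by simp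
  then show ?thesis
    using vec.subspace_dim_equal[OF G subspace_orth_compl subset_orth_compl_orth_compl] by simp
qed

lemma orth_proj_eqI:
  fixes G :: "('a::conjugatable_ordered_field ^ 'n) set"
  assumes G: "vec.subspace G" and w: "w \<in> G" "v - w \<in> orth_compl G"
  shows "orth_proj G v = w"
  unfolding orth_proj_def
proof (rule the_equality)
  fix w' assume w': "w' \<in> G \<and> v - w' \<in> orth_compl G"
  have "(v - w) - (v - w') \<in> orth_compl G"
    using vec.subspace_diff[OF subspace_orth_compl w(2)] w' by blast
  then have "w' - w \<in> orth_compl G" by simp
  moreover have "w' - w \<in> G" using w w' by (intro vec.subspace_diff[OF G]) auto
  ultimately have "w' - w = 0" using orth_compl_decomposition(3)[OF G] by blast
  then show "w' = w" by simp
qed (use w in simp)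

lemma orth_proj:
  fixes G :: "('a::conjugatable_ordered_field ^ 'n) set"
  assumes G: "vec.subspace G"
  shows "orth_proj G v \<in> G" "v - orth_proj G v \<in> orth_compl G"
  using orth_compl_decomposition(2)[OF G, of v] orth_proj_eqI[OF G] by metis+

lemma orth_proj_eq_0_iff:
  fixes G :: "('a::conjugatable_ordered_field ^ 'n) set"
  assumes G: "vec.subspace G"
  shows "orth_proj G v = 0 \<longleftrightarrow> v \<in> orth_compl G"
  using orth_proj(2)[OF G, of v] orth_proj_eqI[OF G vec.subspace_0[OF G], of v] by auto

lemma linear_orth_proj:
  fixes G :: "('a::conjugatable_ordered_field ^ 'n) set"
  assumes G: "vec.subspace G"
  shows "Vector_Spaces.linear (*s) (*s) (orth_proj G)"
  unfolding Vector_Spaces.linear_iff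
proof (intro conjI allI vec.vector_space_axioms)
  fix x y c
  have "(x + y) - (orth_proj G x + orth_proj G y) = (x - orth_proj G x) + (y - orth_proj G y)" by simp
  also have "\<dots> \<in> orth_compl G" by (intro vec.subspace_add[OF subspace_orth_compl] orth_proj(2)[OF G])
  finally show "orth_proj G (x + y) = orth_proj G x + orth_proj G y"
    by (intro orth_proj_eqI[OF G] vec.subspace_add[OF G] orth_proj(1)[OF G])
  have "c *s x - c *s orth_proj G x = c *s (x - orth_proj G x)" by (simp add: vec.scale_right_diff_distrib)
  also have "\<dots> \<in> orth_compl G" by (intro vec.subspace_scale[OF subspace_orth_compl] orth_proj(2)[OF G])
  finally show "orth_proj G (c *s x) = c *s orth_proj G x"
    by (intro orth_proj_eqI[OF G] vec.subspace_scale[OF G] orth_proj(1)[OF G])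
qed

section \<open>Separators as shrunk subspaces\<close>

lemma pair_scale_eq: "pair_scale c = (\<lambda>(v :: 'a::field ^ 'n, e :: 'a ^ 'n). (c *s v, c *s e))"
proof -
  have m: "module_prod ((*s) :: 'a \<Rightarrow> 'a ^ 'n \<Rightarrow> _) ((*s) :: 'a \<Rightarrow> 'a ^ 'n \<Rightarrow> _)"
    by (simp add: module_prod_def module_pair_def vec.module_axioms)
  show ?thesis by (auto simp: fun_eq_iff module_prod.scale_def[OF m])
qed

lemma vector_space_pair_scale: "vector_space (pair_scale :: 'a::field \<Rightarrow> ('a ^ 'n) \<times> ('a ^ 'n) \<Rightarrow> _)"
  by unfold_locales (auto simp: pair_scale_eq vec.scale_right_distrib vec.scale_left_distrib)

lemma MPC_map_space:
  fixes V :: "('a::conjugatable_ordered_field ^ 'n ^ 'n) set"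
  assumes E: "vec.subspace E" and F: "vec.subspace F"
  shows "map_space pair_scale pair_scale (UNIV \<times> E) (MPC_space V F)"
proof -
  interpret pr: vector_space "pair_scale :: 'a \<Rightarrow> ('a ^ 'n) \<times> ('a ^ 'n) \<Rightarrow> _" by (rule vector_space_pair_scale)
  interpret pp: vector_space_pair "pair_scale :: 'a \<Rightarrow> ('a ^ 'n) \<times> ('a ^ 'n) \<Rightarrow> _"
    "pair_scale :: 'a \<Rightarrow> ('a ^ 'n) \<times> ('a ^ 'n) \<Rightarrow> _" ..
  interpret mp: vector_space "fun_scale pair_scale :: 'a \<Rightarrow> (('a ^ 'n) \<times> ('a ^ 'n) \<Rightarrow> ('a ^ 'n) \<times> ('a ^ 'n)) \<Rightarrow> _"
    by (rule vector_space_fun_scale[OF vector_space_pair_scale])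
  have fin: "fin_dim pair_scale (UNIV :: (('a ^ 'n) \<times> ('a ^ 'n)) set)"
    unfolding fin_dim_def
  proof (intro exI conjI)
    let ?B1 = "(\<lambda>v. (v, 0)) ` cart_basis :: (('a ^ 'n) \<times> ('a ^ 'n)) set"
    let ?B2 = "(\<lambda>v. (0, v)) ` cart_basis :: (('a ^ 'n) \<times> ('a ^ 'n)) set"
    show "finite (?B1 \<union> ?B2)" using finite_cart_basis by auto
    interpret q: vector_space_pair "(*s) :: 'a \<Rightarrow> 'a ^ 'n \<Rightarrow> _" "pair_scale :: 'a \<Rightarrow> ('a ^ 'n) \<times> ('a ^ 'n) \<Rightarrow> _" ..
    have l: "Vector_Spaces.linear (*s) pair_scale (\<lambda>v :: 'a ^ 'n. (v, 0 :: 'a ^ 'n))"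
      "Vector_Spaces.linear (*s) pair_scale (\<lambda>v :: 'a ^ 'n. (0 :: 'a ^ 'n, v))"
      unfolding Vector_Spaces.linear_iff
      by (simp_all add: vec.vector_space_axioms pr.vector_space_axioms pair_scale_eq)
    show "UNIV \<subseteq> pr.span (?B1 \<union> ?B2)"
    proof
      fix x :: "('a ^ 'n) \<times> ('a ^ 'n)"
      have "(fst x, 0) \<in> pr.span ?B1" "(0, snd x) \<in> pr.span ?B2"
        using q.linear_span_image[OF l(1), of cart_basis] q.linear_span_image[OF l(2), of cart_basis]
        by auto
      then have "(fst x, 0) + (0, snd x) \<in> pr.span (?B1 \<union> ?B2)"
        using pr.span_mono[of ?B1 "?B1 \<union> ?B2"] pr.span_mono[of ?B2 "?B1 \<union> ?B2"] by (intro pr.span_add) auto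
      then show "x \<in> pr.span (?B1 \<union> ?B2)" by simp
    qed
  qed
  show ?thesis
  proof (intro map_space.intro map_space_axioms.intro)
    show "vector_space_pair (pair_scale :: 'a \<Rightarrow> ('a ^ 'n) \<times> ('a ^ 'n) \<Rightarrow> _)
      (pair_scale :: 'a \<Rightarrow> ('a ^ 'n) \<times> ('a ^ 'n) \<Rightarrow> _)" ..
    show "pr.subspace (UNIV \<times> E)"
      by (rule pr.subspaceI)
        (auto simp: pair_scale_eq zero_prod_def vec.subspace_0[OF E] vec.subspace_add[OF E] vec.subspace_scale[OF E])
    show "fin_dim pair_scale (UNIV \<times> E)" by (rule pr.fin_dim_subset[OF fin]) simp
    show "fin_dim pair_scale (UNIV :: (('a ^ 'n) \<times> ('a ^ 'n)) set)" by (rule fin)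
    show "mp.subspace (MPC_space V F)" unfolding MPC_space_def by (rule mp.subspace_span)
    have "MPC_space V F \<subseteq> {T. Vector_Spaces.linear pair_scale pair_scale T}"
      unfolding MPC_space_def
    proof (rule mp.span_minimal)
      show "mp.subspace {T. Vector_Spaces.linear pair_scale pair_scale T}"
        by (rule mp.subspaceI)
          (auto simp: Vector_Spaces.linear_iff fun_scale_def algebra_simps pr.vector_space_axioms pr.scale_left_commute)
      show "insert (\<lambda>(v, e). (v + e, orth_proj F v)) {\<lambda>(v, e). (A *v v, 0) |A. A \<in> V}
        \<subseteq> {T. Vector_Spaces.linear pair_scale pair_scale T}"
        using linear_orth_proj[OF F]
        by (auto simp: Vector_Spaces.linear_iff pr.vector_space_axioms pair_scale_eq matrix_vector_right_distrib
            vec.scale_right_distrib vec.scale)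
    qed
    then show "Vector_Spaces.linear pair_scale pair_scale T" if "T \<in> MPC_space V F" for T using that by blast
  qed
qed

interpretation pr: vector_space "pair_scale :: 'a::field \<Rightarrow> ('a ^ 'n) \<times> ('a ^ 'n) \<Rightarrow> _"
  by (rule vector_space_pair_scale)

interpretation pf: vector_space_pair "pair_scale :: 'a::field \<Rightarrow> ('a ^ 'n) \<times> ('a ^ 'n) \<Rightarrow> _" "(*s) :: 'a \<Rightarrow> 'a ^ 'n \<Rightarrow> _" ..

lemma linear_fst_snd:
  "Vector_Spaces.linear pair_scale (*s) (fst :: ('a::field ^ 'n) \<times> ('a ^ 'n) \<Rightarrow> _)"
  "Vector_Spaces.linear pair_scale (*s) (snd :: ('a::field ^ 'n) \<times> ('a ^ 'n) \<Rightarrow> _)"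
  unfolding Vector_Spaces.linear_iff
  by (auto simp: vec.vector_space_axioms pr.vector_space_axioms pair_scale_eq)

lemma subspace_Times:
  fixes A B :: "('a::field ^ 'n) set"
  assumes "vec.subspace A" "vec.subspace B"
  shows "pr.subspace (A \<times> B)"
  by (rule pr.subspaceI)
    (auto simp: pair_scale_eq zero_prod_def assms[THEN vec.subspace_0] assms[THEN vec.subspace_add] assms[THEN vec.subspace_scale])

lemma dim_Times:
  fixes A B :: "('a::field ^ 'n) set"
  assumes A: "vec.subspace A" and B: "vec.subspace B" and fin: "fin_dim pair_scale (A \<times> B)"
  shows "pr.dim (A \<times> B) = vec.dim A + vec.dim B"
proof -
  note 0 = vec.subspace_0[OF A] vec.subspace_0[OF B]
  have K: "{x \<in> A \<times> B. fst x = 0} = {0} \<times> B" using 0 by auto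
  have "pr.dim (A \<times> B) = vec.dim (fst ` (A \<times> B)) + pr.dim ({0} \<times> B)"
    using pf.rank_nullity[OF linear_fst_snd(1) subspace_Times[OF A B] fin] unfolding K .
  moreover have "fst ` (A \<times> B) = A" using 0 by force
  moreover have "vec.dim (snd ` ({0 :: 'a ^ 'n} \<times> B)) = pr.dim ({0} \<times> B)"
  proof (rule pf.dim_image_eq_of_inj_on[OF linear_fst_snd(2)])
    show "pr.subspace ({0} \<times> B)" by (rule subspace_Times[OF vec.subspace_single_0 B])
    show "fin_dim pair_scale ({0} \<times> B)" by (rule pr.fin_dim_subset[OF fin]) (use 0 in auto)
  qed (auto simp: inj_on_def)
  moreover have "snd ` ({0 :: 'a ^ 'n} \<times> B) = B" by force
  ultimately show ?thesis by simp
qed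

text \<open>The inclusion \<open>orth_compl F' \<subseteq> E'\<close> forces \<open>E' + F'\<close>
  to be the whole space.\<close>

lemma separator_dim:
  fixes V :: "('a::conjugatable_ordered_field ^ 'n ^ 'n) set"
  assumes "separator V E F E' F'"
  shows "vec.dim (E' \<inter> F') + CARD('n) = vec.dim E' + vec.dim F'"
proof -
  have s: "vec.subspace E'" "vec.subspace F'" "orth_compl F' \<subseteq> E'" using assms by (auto simp: separator_def)
  have "UNIV \<subseteq> {x + y |x y. x \<in> E' \<and> y \<in> F'}"
  proof
    fix v :: "'a ^ 'n"
    obtain w where w: "w \<in> F'" "v - w \<in> orth_compl F'" using orth_compl_decomposition(2)[OF s(2)] by blast
    have "v = (v - w) + w" by simp
    then show "v \<in> {x + y |x y. x \<in> E' \<and> y \<in> F'}" using w s(3) by blast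
  qed
  then have "{x + y |x y. x \<in> E' \<and> y \<in> F'} = UNIV" by blast
  then show ?thesis using vec.dim_sums_Int[OF s(1,2)] vec_dim_card[where 'a = 'a and 'n = 'n] by simp
qed

text \<open>With \<open>U = orth_compl F' \<times> E\<close>, all generators map \<open>U\<close>
  into \<open>E' \<times> {0}\<close>; the projection component vanishes since
  \<open>F \<subseteq> F'\<close>. The bound for this \<open>U\<close> is at most
  \<open>dim E' + dim F'\<close>.\<close>

lemma nc_rank_le_separator:
  fixes V :: "('a::conjugatable_ordered_field ^ 'n ^ 'n) set"
  assumes E: "vec.subspace E" and F: "vec.subspace F" and sep: "separator V E F E' F'"
  shows "nc_rank pair_scale (UNIV \<times> E) (MPC_space V F) \<le> real CARD('n) + real (vec.dim (E' \<inter> F'))"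
proof -
  interpret ms: map_space pair_scale pair_scale "UNIV \<times> E" "MPC_space V F" by (rule MPC_map_space[OF E F])
  have s: "vec.subspace E'" "vec.subspace F'" "E \<subseteq> E'" "F \<subseteq> F'" "orth_compl F' \<subseteq> E'"
    "action_span V (orth_compl F') \<subseteq> E'" using sep by (auto simp: separator_def)
  let ?G = "orth_compl F'"
  note sG = subspace_orth_compl[of F']
  have "ms.action (?G \<times> E) \<subseteq> E' \<times> {0}"
  proof (rule ms.action_subset_of_span[OF MPC_space_def subspace_Times[OF s(1) vec.subspace_single_0]])
    fix T u assume T: "T \<in> insert (\<lambda>(v, e). (v + e, orth_proj F v)) {\<lambda>(v, e). (A *v v, 0) |A. A \<in> V}"
      and u: "u \<in> ?G \<times> E"
    obtain v e where ve: "u = (v, e)" "v \<in> ?G" "e \<in> E" using u by auto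
    have "v \<in> orth_compl F" using ve(2) orth_compl_antimono[OF s(4)] by blast
    then have "orth_proj F v = 0" using orth_proj_eq_0_iff[OF F] by blast
    moreover have "v + e \<in> E'" using ve s(3,5) by (intro vec.subspace_add[OF s(1)]) auto
    moreover have "A *v v \<in> E'" if "A \<in> V" for A
      using s(6) that ve(2) unfolding action_span_def by (blast intro: vec.span_base)
    ultimately show "T u \<in> E' \<times> {0}" using T ve(1) by auto
  qed
  then have "pr.dim (ms.action (?G \<times> E)) \<le> pr.dim (E' \<times> {0})"
    by (rule pr.dim_le_of_subset) (rule ms.fin_dim_cod)
  also have "\<dots> = vec.dim E'"
    using dim_Times[OF s(1) vec.subspace_single_0 ms.fin_dim_cod] by simp
  finally have 1: "pr.dim (ms.action (?G \<times> E)) \<le> vec.dim E'" .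
  have 2: "nc_rank pair_scale (UNIV \<times> E) (MPC_space V F) \<le>
    real (pr.dim ((UNIV :: ('a ^ 'n) set) \<times> E)) + real (pr.dim (ms.action (?G \<times> E))) - real (pr.dim (?G \<times> E))"
    by (rule ms.nc_rank_le[OF subspace_Times[OF sG E]]) auto
  have 3: "pr.dim ((UNIV :: ('a ^ 'n) set) \<times> E) = CARD('n) + vec.dim E"
    using dim_Times[OF vec.subspace_UNIV E ms.fin_dim_cod] by (simp only: vec_dim_card)
  have 4: "pr.dim (?G \<times> E) = vec.dim ?G + vec.dim E" by (rule dim_Times[OF sG E ms.fin_dim_cod])
  have 5: "vec.dim F' + vec.dim ?G = CARD('n)" by (rule orth_compl_decomposition(1)[OF s(2)])
  have "vec.dim E' + CARD('n) = CARD('n) + vec.dim (E' \<inter> F') + vec.dim ?G"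
    using separator_dim[OF sep] 5 by linarith
  then have "CARD('n) + vec.dim E + pr.dim (ms.action (?G \<times> E)) \<le> CARD('n) + vec.dim (E' \<inter> F') + (vec.dim ?G + vec.dim E)"
    using 1 by linarith
  then have "real (CARD('n) + vec.dim E + pr.dim (ms.action (?G \<times> E)))
    \<le> real (CARD('n) + vec.dim (E' \<inter> F') + (vec.dim ?G + vec.dim E))" by (simp only: of_nat_le_iff)
  then show ?thesis using 2 unfolding 3 4 by simp
qed

text \<open>Cutting \<open>U\<close> down to \<open>U0\<close>, where the projection to
  \<open>F\<close> vanishes, is free: the lost dimensions are those of \<open>k\<close>
  U\<open>, and\<close>snd \<open>Act\<close> has at least as many. First components of
  \<open>U0\<close> give the complement of \<open>F'\<close>; those of \<open>W0\<close>, enlarged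
  by \<open>E\<close>, give \<open>E'\<close>.\<close>

lemma separator_le_nc_rank:
  fixes V :: "('a::conjugatable_ordered_field ^ 'n ^ 'n) set" and \<iota> :: "'a \<Rightarrow> complex"
  assumes emb: "comm_ring_hom \<iota>" "inj \<iota>" "infinite (UNIV :: 'a set)"
    and E: "vec.subspace E" and F: "vec.subspace F"
  shows "\<exists>E' F'. separator V E F E' F' \<and>
    real CARD('n) + real (vec.dim (E' \<inter> F')) \<le> nc_rank pair_scale (UNIV \<times> E) (MPC_space V F)"
proof -
  interpret ms: map_space pair_scale pair_scale "UNIV \<times> E" "MPC_space V F" by (rule MPC_map_space[OF E F])
  obtain U where U: "pr.subspace U" "U \<subseteq> UNIV \<times> E"
    "real (pr.dim ((UNIV :: ('a ^ 'n) set) \<times> E)) + real (pr.dim (ms.action U)) - real (pr.dim U)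
      \<le> nc_rank pair_scale (UNIV \<times> E) (MPC_space V F)"
    using ms.nc_rank_ge[OF emb] by blast
  note fin = ms.fin_dim_cod
  define Act where "Act = ms.action U"
  define k where "k = orth_proj F \<circ> (fst :: ('a ^ 'n) \<times> ('a ^ 'n) \<Rightarrow> 'a ^ 'n)"
  define U0 where "U0 = {u \<in> U. k u = 0}"
  define G where "G = fst ` U0"
  define K where "K = {u \<in> U0. fst u = 0}"
  define W0 where "W0 = {w \<in> Act. snd w = 0}"
  define H where "H = fst ` W0"
  let ?E = "{x + y |x y. x \<in> H \<and> y \<in> E}" and ?F = "orth_compl G"
  have k: "Vector_Spaces.linear pair_scale (*s) k"
    using linear_orth_proj[OF F] linear_fst_snd(1)
    unfolding k_def Vector_Spaces.linear_iff
    by (simp add: pair_scale_eq pr.vector_space_axioms vec.vector_space_axioms)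
  have sAct: "pr.subspace Act" unfolding Act_def ms.action_def by (rule pr.subspace_span)
  have sU0: "pr.subspace U0"
    using pr.subspace_inter[OF U(1) pf.linear_subspace_kernel[OF k]] by (simp add: U0_def Int_def)
  have sW0: "pr.subspace W0"
    using pr.subspace_inter[OF sAct pf.linear_subspace_kernel[OF linear_fst_snd(2)]] by (simp add: W0_def Int_def)
  have sK: "pr.subspace K"
    using pr.subspace_inter[OF sU0 pf.linear_subspace_kernel[OF linear_fst_snd(1)]] by (simp add: K_def Int_def)
  have sG: "vec.subspace G" unfolding G_def by (rule pf.linear_subspace_image[OF linear_fst_snd(1) sU0])
  have sH: "vec.subspace H" unfolding H_def by (rule pf.linear_subspace_image[OF linear_fst_snd(1) sW0])
  have J: "(v + e, orth_proj F v) \<in> Act" if "(v, e) \<in> U" for v e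
  proof -
    have "(\<lambda>(v, e). (v + e, orth_proj F v)) \<in> MPC_space V F"
      unfolding MPC_space_def by (intro ms.maps.span_base) simp
    from ms.in_action[OF this that] show ?thesis by (simp add: Act_def)
  qed
  have A: "(A *v v, 0) \<in> Act" if "(v, e) \<in> U" "A \<in> V" for v e A
  proof -
    have "(\<lambda>(v, e). (A *v v, 0)) \<in> MPC_space V F"
      unfolding MPC_space_def using that(2) by (intro ms.maps.span_base) blast
    from ms.in_action[OF this that(1)] show ?thesis by (simp add: Act_def)
  qed
  have JU0: "v + e \<in> H" "e \<in> E" "v \<in> orth_compl F" if "(v, e) \<in> U0" for v e
  proof -
    have *: "(v, e) \<in> U" "orth_proj F v = 0" using that by (auto simp: U0_def k_def)
    have "(v + e, 0) \<in> W0" using J[OF *(1)] *(2) by (simp add: W0_def)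
    then show "v + e \<in> H" unfolding H_def by (metis fst_conv imageI)
    show "e \<in> E" using * U(2) by auto
    show "v \<in> orth_compl F" using *(2) orth_proj_eq_0_iff[OF F] by blast
  qed
  have HE: "x + y \<in> ?E" if "x \<in> H" "y \<in> E" for x y using that by blast
  have H_le: "x \<in> ?E" if "x \<in> H" for x using HE[OF that vec.subspace_0[OF E]] by simp
  have sE: "vec.subspace ?E" by (rule vec.subspace_sums[OF sH E])
  have GG: "orth_compl ?F = G" by (rule orth_compl_orth_compl[OF sG])
  have sep: "separator V E F ?E ?F"
    unfolding separator_def GG
  proof (intro conjI)
    show "E \<subseteq> ?E" using HE[OF vec.subspace_0[OF sH]] by auto
    have "G \<subseteq> orth_compl F" using JU0(3) by (auto simp: G_def)
    then show "F \<subseteq> ?F" using orth_compl_antimono[of G "orth_compl F"] subset_orth_compl_orth_compl[of F] by blast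
    show "G \<subseteq> ?E"
    proof
      fix v assume "v \<in> G"
      then obtain e where e: "(v, e) \<in> U0" by (auto simp: G_def)
      have "(v + e) + (- e) \<in> ?E" by (rule HE[OF JU0(1)[OF e] vec.subspace_neg[OF E JU0(2)[OF e]]])
      then show "v \<in> ?E" by simp
    qed
    show "action_span V G \<subseteq> ?E"
      unfolding action_span_def
    proof (rule vec.span_minimal[OF _ sE], clarify)
      fix B v assume B: "B \<in> V" and "v \<in> G"
      then obtain e where "(v, e) \<in> U" by (auto simp: G_def U0_def)
      then have "(B *v v, 0) \<in> W0" using A B by (simp add: W0_def)
      then have "B *v v \<in> H" unfolding H_def by (metis fst_conv imageI)
      then show "\<exists>x y. B *v v = x + y \<and> x \<in> H \<and> y \<in> E" using H_le by blast
    qed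
  qed (rule sE subspace_orth_compl)+
  have d1: "pr.dim U = vec.dim (k ` U) + pr.dim U0"
    unfolding U0_def by (rule pf.rank_nullity[OF k U(1) fin])
  have d2: "pr.dim Act = vec.dim (snd ` Act) + pr.dim W0"
    unfolding W0_def by (rule pf.rank_nullity[OF linear_fst_snd(2) sAct fin])
  have "k ` U \<subseteq> snd ` Act"
  proof clarify
    fix v e assume "(v, e) \<in> U"
    then show "k (v, e) \<in> snd ` Act" using J[of v e] by (force simp: k_def)
  qed
  then have d3: "vec.dim (k ` U) \<le> vec.dim (snd ` Act)" by (rule vec.dim_subset)
  have d4: "vec.dim H \<le> pr.dim W0"
    unfolding H_def by (rule pf.dim_image_le[OF linear_fst_snd(1) sW0 fin])
  have d5: "pr.dim U0 = vec.dim G + pr.dim K"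
    unfolding G_def K_def by (rule pf.rank_nullity[OF linear_fst_snd(1) sU0 fin])
  have "vec.dim (snd ` K) = pr.dim K"
    by (rule pf.dim_image_eq_of_inj_on[OF linear_fst_snd(2) sK fin]) (auto simp: K_def inj_on_def)
  \<comment> \<open>A pair (0, e) in \<open>U0\<close> is sent to (e, 0), so e lies in
    \<open>H\<close>. The overlap of \<open>H\<close> and \<open>E\<close> in the sum
    \<open>?E\<close> thus pays for the pairs lost when projecting \<open>U0\<close> to
    \<open>G\<close>.\<close>
  moreover have "snd ` K \<subseteq> H \<inter> E" using JU0(1,2)[of 0] by (auto simp: K_def)
  ultimately have d6: "pr.dim K \<le> vec.dim (H \<inter> E)" by (metis vec.dim_subset)
  have d7: "vec.dim ?E + vec.dim (H \<inter> E) = vec.dim H + vec.dim E" by (rule vec.dim_sums_Int[OF sH E])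
  have d8: "vec.dim G + vec.dim ?F = CARD('n)" by (rule orth_compl_decomposition(1)[OF sG])
  have d9: "vec.dim (?E \<inter> ?F) + CARD('n) = vec.dim ?E + vec.dim ?F" by (rule separator_dim[OF sep])
  have d10: "pr.dim ((UNIV :: ('a ^ 'n) set) \<times> E) = CARD('n) + vec.dim E"
    using dim_Times[OF vec.subspace_UNIV E fin] by (simp only: vec_dim_card)
  have "CARD('n) + vec.dim (?E \<inter> ?F) + pr.dim U \<le> CARD('n) + vec.dim E + pr.dim Act"
    using d1 d2 d3 d4 d5 d6 d7 d8 d9 by linarith
  then have "real (CARD('n) + vec.dim (?E \<inter> ?F) + pr.dim U) \<le> real (CARD('n) + vec.dim E + pr.dim Act)"
    by (simp only: of_nat_le_iff)
  then have "real CARD('n) + real (vec.dim (?E \<inter> ?F)) \<le> nc_rank pair_scale (UNIV \<times> E) (MPC_space V F)"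
    using U(3) unfolding d10 Act_def by simp
  then show ?thesis using sep by blast
qed

text \<open>Every separator size bounds the capacity from above and one bounds it from below, so
  that one attains the minimum.\<close>

theorem MPC_eq_min_separator_size:
  fixes V :: "('a::conjugatable_ordered_field ^ 'n ^ 'n) set" and \<iota> :: "'a \<Rightarrow> complex"
  assumes emb: "comm_ring_hom \<iota>" "inj \<iota>" "infinite (UNIV :: 'a set)"
    and E: "vec.subspace E" and F: "vec.subspace F"
  shows "MPC V E F = real (min_separator_size V E F)"
proof -
  let ?S = "{vec.dim (E' \<inter> F') |E' F'. separator V E F E' F'}"
  obtain E' F' where s: "separator V E F E' F'"
    "real CARD('n) + real (vec.dim (E' \<inter> F')) \<le> nc_rank pair_scale (UNIV \<times> E) (MPC_space V F)"
    using separator_le_nc_rank[OF emb E F] by blast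
  have le: "MPC V E F \<le> real m" if "m \<in> ?S" for m
    using that nc_rank_le_separator[OF E F] by (force simp: MPC_def)
  have eq: "MPC V E F = real (vec.dim (E' \<inter> F'))"
    using s(2) le[of "vec.dim (E' \<inter> F')"] s(1) by (force simp: MPC_def)
  have "Min ?S = vec.dim (E' \<inter> F')"
  proof (rule Min_eqI)
    show "finite ?S" by (rule finite_subset[of _ "{..CARD('n)}"])
      (use vec.dim_subset_UNIV in \<open>auto simp: vec.dimension_def card_cart_basis\<close>)
    show "vec.dim (E' \<inter> F') \<le> m" if "m \<in> ?S" for m using le[OF that] eq by simp
    show "vec.dim (E' \<inter> F') \<in> ?S" using s(1) by blast
  qed
  then show ?thesis unfolding min_separator_size_def eq by simp
qed

theorem theorem2p6:
  shows "(\<forall>(V :: (real ^ 'n ^ 'n) set) E F.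
            matrix_subspace V \<longrightarrow> vec.subspace E \<longrightarrow> vec.subspace F \<longrightarrow>
            MPC V E F = real (min_separator_size V E F)) \<and>
         (\<forall>(V :: (complex ^ 'n ^ 'n) set) E F.
            matrix_subspace V \<longrightarrow> vec.subspace E \<longrightarrow> vec.subspace F \<longrightarrow>
            MPC V E F = real (min_separator_size V E F))"
proof -
  \<comment> \<open>The embeddings \<iota> of the two scalar fields into \<complex>.\<close>
  have "comm_ring_hom complex_of_real" "inj complex_of_real" "comm_ring_hom (\<lambda>c :: complex. c)"
    by (unfold_locales, auto simp: inj_def)
  then show ?thesis
    using MPC_eq_min_separator_size infinite_UNIV_char_0 inj_on_id2 by metis
qed

end
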